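(* For $x,y\in\{0,1\}^2$ and $\tau\in\mathbb{H}_2$ let $\theta_{x,y}(\tau)=\sum_{n\in\mathbb{Z}^2}\exp\pi i\big((n+\tfrac{x}{2})^T\tau(n+\tfrac{x}{2})+(n+\tfrac{x}{2})^Ty\big)$, and define $f_1=\theta_{(0,0),(0,0)}$, $f_2=\theta_{(0,0),(1,1)}$, $f_3=\theta_{(0,0),(1,0)}$, $f_4=\theta_{(0,0),(0,1)}$ (as functions $\mathbb{H}_2\to\mathbb{C}$). If $\tau,\tau'\in\mathbb{H}_2$ satisfy $(f_1(\tau),\dots,f_4(\tau))=(f_1(\tau'),\dots,f_4(\tau'))$, then $(j_1(\tau),j_2(\tau),j_3(\tau))=(j_1(\tau'),j_2(\tau'),j_3(\tau'))$. Moreover, the quotients $f_1/f_4$, $f_2/f_4$, $f_3/f_4$ are invariant under the principal congruence subgroup $\Gamma(8)=\ker(\mathrm{Sp}_4(\mathbb{Z})\to\mathrm{Sp}_4(\mathbb{Z}/8\mathbb{Z}))$.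
   Context: $\mathbb{H}_2$ is the Siegel upper half space of symmetric complex $2\times 2$ matrices with positive definite imaginary part; $\mathrm{Sp}_4(\mathbb{Z})$ acts on it in the usual way. For $\tau\in\mathbb{H}_2$, $A_\tau=\mathbb{C}^2/(\mathbb{Z}^2+\tau\mathbb{Z}^2)$ is a principally polarized abelian surface. The Igusa functions are $j_1=I_2^5/I_{10}$, $j_2=I_4I_2^3/I_{10}$, $j_3=I_6I_2^2/I_{10}$, where $I_2,I_4,I_6,I_{10}$ are the Igusa–Clebsch invariants (for a Jacobian of $Y^2=a_6\prod_{i=1}^6(X-\alpha_i)$: $I_2=a_6^2\sum_{15}(12)^2(34)^2(56)^2$, $I_4=a_6^4\sum_{10}(12)^2(23)^2(31)^2(45)^2(56)^2(64)^2$, $I_6=a_6^6\sum_{60}(12)^2(23)^2(31)^2(45)^2(56)^2(64)^2(14)^2(25)^2(36)^2$, $I_{10}=a_6^{10}\mathrm{disc}$, with $(ij)=\alpha_{k_i}-\alpha_{k_j}$ and sums over distinct terms), viewed as Siegel modular functions of $\tau$, expressible as rational functions in the fourth powers $\theta_{x,y}^4$; $j_i(\tau)$ denotes the value at $A_\tau$. *)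

theory Defs
  imports "HOL-Analysis.Analysis" "HOL-Number_Theory.Cong"
begin

section \<open>The Siegel upper half space and the symplectic group\<close>

definition siegel_H2 :: "(complex^2^2) set" where
  "siegel_H2 = {\<tau>. transpose \<tau> = \<tau> \<and>
     (\<forall>v::real^2. v \<noteq> 0 \<longrightarrow> v \<bullet> ((\<chi> i j. Im (\<tau> $ i $ j)) *v v) > 0)}"

text \<open>The index type \<open>2 + 2\<close> is a disjoint sum, so the four blocks of a matrix are
  selected by \<open>Inl\<close> and \<open>Inr\<close>.\<close>

definition symplectic_J :: "int^(2+2)^(2+2)" where
  "symplectic_J = (\<chi> i j. case (i, j) of
       (Inl k, Inr l) \<Rightarrow> if k = l then 1 else 0
     | (Inr k, Inl l) \<Rightarrow> if k = l then - 1 else 0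
     | _ \<Rightarrow> 0)"

definition Sp4_Z :: "(int^(2+2)^(2+2)) set" where
  "Sp4_Z = {\<gamma>. transpose \<gamma> ** symplectic_J ** \<gamma> = symplectic_J}"

definition principal_congruence :: "int \<Rightarrow> (int^(2+2)^(2+2)) set" where
  "principal_congruence N =
     {\<gamma> \<in> Sp4_Z. \<forall>i j. [\<gamma> $ i $ j = (mat 1 :: int^(2+2)^(2+2)) $ i $ j] (mod N)}"

definition siegel_act :: "int^(2+2)^(2+2) \<Rightarrow> complex^2^2 \<Rightarrow> complex^2^2" where
  "siegel_act \<gamma> \<tau> =
     (let A = (\<chi> i j. of_int (\<gamma> $ Inl i $ Inl j));
          B = (\<chi> i j. of_int (\<gamma> $ Inl i $ Inr j));
          C = (\<chi> i j. of_int (\<gamma> $ Inr i $ Inl j));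
          D = (\<chi> i j. of_int (\<gamma> $ Inr i $ Inr j))
      in (A ** \<tau> + B) ** matrix_inv (C ** \<tau> + D))"

section \<open>Theta functions\<close>

definition cvec :: "int^2 \<Rightarrow> complex^2" where
  "cvec n = (\<chi> i. of_int (n $ i))"

text \<open>The bilinear (not Hermitian) product \<open>u\<^sup>T v\<close>.\<close>

definition bdot :: "complex^2 \<Rightarrow> complex^2 \<Rightarrow> complex" where
  "bdot u v = (\<Sum>i\<in>UNIV. u $ i * v $ i)"

definition theta_const :: "int^2 \<Rightarrow> int^2 \<Rightarrow> complex^2^2 \<Rightarrow> complex" where
  "theta_const x y \<tau> =
     infsum (\<lambda>n. let v = cvec n + (1/2) *s cvec x
                 in exp (of_real pi * \<i> * (bdot v (\<tau> *v v) + bdot v (cvec y)))) UNIV"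

definition theta_f1 :: "complex^2^2 \<Rightarrow> complex" where
  "theta_f1 = theta_const (vector [0, 0]) (vector [0, 0])"

definition theta_f2 :: "complex^2^2 \<Rightarrow> complex" where
  "theta_f2 = theta_const (vector [0, 0]) (vector [1, 1])"

definition theta_f3 :: "complex^2^2 \<Rightarrow> complex" where
  "theta_f3 = theta_const (vector [0, 0]) (vector [1, 0])"

definition theta_f4 :: "complex^2^2 \<Rightarrow> complex" where
  "theta_f4 = theta_const (vector [0, 0]) (vector [0, 1])"

definition riemann_theta :: "complex^2^2 \<Rightarrow> complex^2 \<Rightarrow> complex" where
  "riemann_theta \<tau> z =
     infsum (\<lambda>n. exp (of_real pi * \<i> * (bdot (cvec n) (\<tau> *v cvec n) + 2 * bdot (cvec n) z))) UNIV"

section \<open>Principally polarized abelian surfaces\<close>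

text \<open>A principally polarized abelian surface is given by a pair of subsets of \<open>\<complex>\<^sup>2\<close>: the
  lattice, and the preimage of a theta divisor, i.e. of an effective divisor defining the
  polarization. For a principal polarization that divisor is reduced, and it is determined by
  the polarization exactly up to translation; hence the translation by \<open>c\<close> in the notion of
  isomorphism.\<close>

type_synonym ppas = "(complex^2) set \<times> (complex^2) set"

definition ppas_iso :: "ppas \<Rightarrow> ppas \<Rightarrow> bool" where
  "ppas_iso X Y \<longleftrightarrow>
     (\<exists>(M::complex^2^2) c. invertible M \<and>
        (\<lambda>v. M *v v) ` fst X = fst Y \<and> (\<lambda>v. M *v v + c) ` snd X = snd Y)"

text \<open>\<open>A\<^sub>\<tau> = \<complex>\<^sup>2 / (\<int>\<^sup>2 + \<tau> \<int>\<^sup>2)\<close> with its standard principal polarization.\<close>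

definition ppas_of :: "complex^2^2 \<Rightarrow> ppas" where
  "ppas_of \<tau> = ({cvec m + \<tau> *v cvec n |m n. True}, {z. riemann_theta \<tau> z = 0})"

section \<open>Genus 2 curves and their Jacobians\<close>

text \<open>The curve \<open>Y\<^sup>2 = a \<Prod>\<^sub>i (X - \<alpha>\<^sub>i)\<close> is represented by \<open>a\<close> and the values of \<open>\<alpha>\<close> on \<open>{1..6}\<close>.
  Every complex curve of genus 2 has such a model, with no branch point at infinity.\<close>

definition genus2_model :: "complex \<Rightarrow> (nat \<Rightarrow> complex) \<Rightarrow> bool" where
  "genus2_model a \<alpha> \<longleftrightarrow> a \<noteq> 0 \<and> inj_on \<alpha> {1..6}"

definition sextic :: "complex \<Rightarrow> (nat \<Rightarrow> complex) \<Rightarrow> complex \<Rightarrow> complex" where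
  "sextic a \<alpha> X = a * (\<Prod>i=1..6. X - \<alpha> i)"

text \<open>Piecewise smooth paths \<open>t \<mapsto> (p t, q t)\<close> on the affine curve that avoid the Weierstrass
  points \<open>Y = 0\<close>.\<close>

definition curve_path ::
    "complex \<Rightarrow> (nat \<Rightarrow> complex) \<Rightarrow> (real \<Rightarrow> complex) \<Rightarrow> (real \<Rightarrow> complex) \<Rightarrow> bool" where
  "curve_path a \<alpha> p q \<longleftrightarrow>
     valid_path p \<and> path q \<and> (\<forall>t\<in>{0..1}. q t ^ 2 = sextic a \<alpha> (p t) \<and> q t \<noteq> 0)"

text \<open>The integrals of the basis \<open>dX/Y\<close>, \<open>X dX/Y\<close> of the holomorphic differentials.\<close>

definition abelian_integral :: "(real \<Rightarrow> complex) \<Rightarrow> (real \<Rightarrow> complex) \<Rightarrow> complex^2" where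
  "abelian_integral p q = vector
     [integral {0..1} (\<lambda>t. vector_derivative p (at t within {0..1}) / q t),
      integral {0..1} (\<lambda>t. p t * vector_derivative p (at t within {0..1}) / q t)]"

text \<open>The loops avoid finitely many points of the compact curve, at which the differentials are
  holomorphic, so they still give every class of \<open>H\<^sub>1(C, \<int>)\<close> and this is the full period lattice.\<close>

definition period_lattice :: "complex \<Rightarrow> (nat \<Rightarrow> complex) \<Rightarrow> (complex^2) set" where
  "period_lattice a \<alpha> =
     {abelian_integral p q |p q. curve_path a \<alpha> p q \<and> p 1 = p 0 \<and> q 1 = q 0}"

text \<open>The preimage in \<open>\<complex>\<^sup>2\<close> of the image of the compact curve under the Abel-Jacobi map with
  base point \<open>(X0, Y0)\<close>; the closure adds the Weierstrass points and the points at infinity.\<close>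

definition abel_jacobi_curve ::
    "complex \<Rightarrow> (nat \<Rightarrow> complex) \<Rightarrow> complex \<Rightarrow> complex \<Rightarrow> (complex^2) set" where
  "abel_jacobi_curve a \<alpha> X0 Y0 =
     closure {abelian_integral p q |p q. curve_path a \<alpha> p q \<and> p 0 = X0 \<and> q 0 = Y0}"

text \<open>The canonical polarization of a Jacobian of dimension \<open>g\<close> is given by the divisor \<open>W\<^sub>g\<^sub>-\<^sub>1\<close>,
  which for \<open>g = 2\<close> is the Abel-Jacobi image of the curve. Another base point only
  translates it.\<close>

definition jacobian_is :: "complex \<Rightarrow> (nat \<Rightarrow> complex) \<Rightarrow> complex^2^2 \<Rightarrow> bool" where
  "jacobian_is a \<alpha> \<tau> \<longleftrightarrow>
     (\<exists>X0 Y0. Y0 ^ 2 = sextic a \<alpha> X0 \<and> Y0 \<noteq> 0 \<and>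
        ppas_iso (period_lattice a \<alpha>, abel_jacobi_curve a \<alpha> X0 Y0) (ppas_of \<tau>))"

section \<open>Igusa-Clebsch invariants and Igusa functions\<close>

text \<open>The sums run over the distinct terms obtained by permuting the roots. In the sum over all
  720 permutations each of the 15, 10 and 60 distinct terms occurs 48, 72 and 12 times.\<close>

definition igusa_I2 :: "complex \<Rightarrow> (nat \<Rightarrow> complex) \<Rightarrow> complex" where
  "igusa_I2 a \<alpha> = a ^ 2 * (\<Sum>\<sigma> | \<sigma> permutes {1..6}.
     let d = (\<lambda>i j. (\<alpha> (\<sigma> i) - \<alpha> (\<sigma> j)) ^ 2) in d 1 2 * d 3 4 * d 5 6) / 48"

definition igusa_I4 :: "complex \<Rightarrow> (nat \<Rightarrow> complex) \<Rightarrow> complex" where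
  "igusa_I4 a \<alpha> = a ^ 4 * (\<Sum>\<sigma> | \<sigma> permutes {1..6}.
     let d = (\<lambda>i j. (\<alpha> (\<sigma> i) - \<alpha> (\<sigma> j)) ^ 2)
     in d 1 2 * d 2 3 * d 3 1 * d 4 5 * d 5 6 * d 6 4) / 72"

definition igusa_I6 :: "complex \<Rightarrow> (nat \<Rightarrow> complex) \<Rightarrow> complex" where
  "igusa_I6 a \<alpha> = a ^ 6 * (\<Sum>\<sigma> | \<sigma> permutes {1..6}.
     let d = (\<lambda>i j. (\<alpha> (\<sigma> i) - \<alpha> (\<sigma> j)) ^ 2)
     in d 1 2 * d 2 3 * d 3 1 * d 4 5 * d 5 6 * d 6 4 * d 1 4 * d 2 5 * d 3 6) / 12"

definition igusa_I10 :: "complex \<Rightarrow> (nat \<Rightarrow> complex) \<Rightarrow> complex" where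
  "igusa_I10 a \<alpha> = a ^ 10 * (\<Prod>j=1..6. \<Prod>i=1..<j. (\<alpha> i - \<alpha> j) ^ 2)"

text \<open>The Igusa functions are defined at \<open>\<tau>\<close> iff \<open>A\<^sub>\<tau>\<close> is the Jacobian of a curve of genus 2;
  the remaining \<open>\<tau>\<close>, where \<open>A\<^sub>\<tau>\<close> is a product of elliptic curves, form the zero locus of
  \<open>I\<^sub>1\<^sub>0\<close>.\<close>

definition igusa_defined :: "complex^2^2 \<Rightarrow> bool" where
  "igusa_defined \<tau> \<longleftrightarrow> (\<exists>a \<alpha>. genus2_model a \<alpha> \<and> jacobian_is a \<alpha> \<tau>)"

definition value_at :: "(complex \<Rightarrow> (nat \<Rightarrow> complex) \<Rightarrow> complex) \<Rightarrow> complex^2^2 \<Rightarrow> complex" where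
  "value_at F \<tau> = (THE v. \<exists>a \<alpha>. genus2_model a \<alpha> \<and> jacobian_is a \<alpha> \<tau> \<and> v = F a \<alpha>)"

definition igusa_j1 :: "complex^2^2 \<Rightarrow> complex" where
  "igusa_j1 = value_at (\<lambda>a \<alpha>. igusa_I2 a \<alpha> ^ 5 / igusa_I10 a \<alpha>)"

definition igusa_j2 :: "complex^2^2 \<Rightarrow> complex" where
  "igusa_j2 = value_at (\<lambda>a \<alpha>. igusa_I4 a \<alpha> * igusa_I2 a \<alpha> ^ 3 / igusa_I10 a \<alpha>)"

definition igusa_j3 :: "complex^2^2 \<Rightarrow> complex" where
  "igusa_j3 = value_at (\<lambda>a \<alpha>. igusa_I6 a \<alpha> * igusa_I2 a \<alpha> ^ 2 / igusa_I10 a \<alpha>)"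

end

theory Submission
  imports Defs "HOL-Complex_Analysis.Conformal_Mappings"
begin

text \<open>
  First part. Neither curves nor Torelli's theorem are needed: if the four theta nulls of \<open>\<tau>\<close> and
  \<open>\<tau>'\<close> agree, then \<open>A\<^sub>\<tau>\<close> and \<open>A\<^sub>\<tau>\<^sub>'\<close> are isomorphic as principally polarized surfaces, hence are Jacobians
  of the same curves. The functions \<open>g\<^sub>y(z) = \<theta>(z + y/2)\<close> satisfy the addition formula
  \<open>g\<^sub>y(u+v) g\<^sub>y\<^sub>+\<^sub>d(u-v) = \<Sum>\<^sub>x (-1)\<^bsup>x\<cdot>y\<^esup> B\<^sub>x\<^sub>,\<^sub>d(u) B\<^sub>x\<^sub>,\<^sub>d(-v)\<close>. It implies a duplication formula from which the
  Taylor series of the \<open>g\<^sub>y\<close> at \<open>0\<close> can be computed from their 2-jets. Write \<open>f\<^sub>y(1 + p\<^sub>y + \<dots>)\<close> for the 2-jets.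
  Because the odd \<open>B\<^sub>x\<^sub>,\<^sub>d\<close> vanish at \<open>0\<close>, the combinations \<open>f\<^sub>a f\<^sub>b (p\<^sub>a - p\<^sub>b) \<plusminus> f\<^sub>c f\<^sub>d (p\<^sub>c - p\<^sub>d)\<close> are squares of linear
  forms; so the \<open>p\<^sub>y\<close> form an orthocentric tetrahedron for the discriminant form, whose edge lengths are
  determined by the \<open>f\<^sub>y\<close>. Hence the jets for \<open>\<tau>\<close> and \<open>\<tau>'\<close> differ by a linear substitution \<open>M\<close> and a common
  quadratic form \<open>l\<close>, and \<open>\<theta>\<^sub>\<tau>\<^sub>'(M w) = e\<^bsup>l(w)\<^esup> \<theta>\<^sub>\<tau>(w)\<close>. Lattice and theta divisor can be read off from \<open>\<theta>\<close> up
  to such factors.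

  Second part. For \<open>\<gamma>\<close> with blocks \<open>A, B, C, D\<close> the function \<open>e\<^bsup>-\<pi>i z\<^sup>T N z\<^esup> \<theta>\<^sub>\<gamma>\<^sub>\<tau>((C\<tau>+D)\<^bsup>-T\<^esup> z)\<close> has the quasi-periods of \<open>\<theta>\<^sub>\<tau>\<close>,
  so by Fourier expansion it is a constant multiple of it; evaluate at \<open>z = y/2\<close>.
\<close>

section \<open>Convergence of theta series\<close>

text \<open>In the duplication formula the Taylor coefficients of order N carry the factor 2^N - 4.
  It vanishes for N = 2, so the 2-jets are the real unknowns, and they can only be determined up to
  what leaves the formulas intact: a linear substitution in w and a factor exp(l(w)) with l
  quadratic. The jets live in the three-dimensional space of binary quadratic forms, where the
  isotropic vectors of the discriminant are the squares and GL_2 acts by similitudes; this is why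
  edge lengths suffice. Two degenerations shape the proof. If all edges were isotropic, the four
  jets would agree along a line, and there all g_y would be constant multiples of one Gaussian; the
  growth of theta forbids that. If some f_y is 0, the jets cannot be normalised to constant term 1,
  and another basis of the span of the g_y is needed in which no coordinate vanishes at 0. In the
  second part the number 8 comes from evaluating at y/2: an element of Gamma(8) displaces y/2 by
  tau' p + q with p, q divisible by 4, and the phase exp(pi i (p.q - p.y/2)) that remains is then
  1.\<close>

lemma gaussian_summable_int:
  fixes c r :: real
  assumes "c > 0"
  shows "(\<lambda>n::int. exp (- c * (of_int n)\<^sup>2 + r * \<bar>of_int n\<bar>)) summable_on UNIV"
proof -
  \<comment> \<open>The exponent is the maximum of (r+1)x - c x^2, so each term is at most K
    exp(-|n|).\<close>
  define K where "K = exp ((r + 1)\<^sup>2 / (4 * c))"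
  have nat: "(\<lambda>k::nat. exp (- real k)) summable_on UNIV"
  proof (rule summable_nonneg_imp_summable_on)
    have "summable (\<lambda>k::nat. exp (-1) ^ k :: real)"
      by (rule summable_geometric) simp
    moreover have "(\<lambda>k::nat. exp (-1) ^ k :: real) = (\<lambda>k. exp (- real k))"
      by (simp add: fun_eq_iff flip: exp_of_nat_mult)
    ultimately show "summable (\<lambda>k. exp (- real k))" by simp
  qed simp
  have 1: "(\<lambda>n::int. exp (- \<bar>real_of_int n\<bar>)) summable_on {0..}"
    using nat by (subst summable_on_reindex_bij_witness[of _ int nat UNIV, where h = "\<lambda>k. exp (- real k)"]) auto
  have 2: "(\<lambda>n::int. exp (- \<bar>real_of_int n\<bar>)) summable_on {..0}"
    using nat by (subst summable_on_reindex_bij_witness[of _ "\<lambda>k. - int k" "\<lambda>n. nat (-n)" UNIV, where h = "\<lambda>k. exp (- real k)"]) auto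
  have "(\<lambda>n::int. exp (- \<bar>real_of_int n\<bar>)) summable_on ({0..} \<union> {..0})"
    by (rule summable_on_union[OF 1 2])
  also have "{0..} \<union> {..0::int} = UNIV" by auto
  finally have "(\<lambda>n::int. K * exp (- \<bar>real_of_int n\<bar>)) summable_on UNIV"
    by (rule summable_on_cmult_right)
  then show ?thesis
  proof (rule summable_on_comparison_test)
    fix n :: int
    let ?x = "\<bar>real_of_int n\<bar>"
    have "0 \<le> (2 * c * ?x - (r + 1))\<^sup>2 / (4 * c)" using assms by simp
    also have "\<dots> = c * ?x\<^sup>2 - (r + 1) * ?x + (r + 1)\<^sup>2 / (4 * c)"
      using assms by (simp add: field_simps power2_eq_square)
    finally have "- c * (of_int n)\<^sup>2 + r * ?x \<le> (r + 1)\<^sup>2 / (4 * c) + - ?x"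
      by (simp add: algebra_simps)
    then have "exp (- c * (of_int n)\<^sup>2 + r * ?x) \<le> exp ((r + 1)\<^sup>2 / (4 * c) + - ?x)"
      by (simp only: exp_le_cancel_iff)
    then show "exp (- c * (of_int n)\<^sup>2 + r * \<bar>of_int n\<bar>) \<le> K * exp (- \<bar>real_of_int n\<bar>)"
      unfolding K_def exp_add by simp
  qed auto
qed

definition l1 :: "int^2 \<Rightarrow> real" where
  "l1 n = \<bar>of_int (n $ 1)\<bar> + \<bar>of_int (n $ 2)\<bar>"

lemma l1_nonneg [simp]: "l1 n \<ge> 0"
  by (simp add: l1_def)

lemma vector2_eta [simp]: "vector [v $ 1, v $ 2] = (v :: 'a::zero^2)"
  by (simp add: vec_eq_iff forall_2)

lemma gaussian_summable_int2:
  fixes c r :: real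
  assumes "c > 0"
  shows "(\<lambda>n::int^2. exp (- c * ((of_int (n $ 1))\<^sup>2 + (of_int (n $ 2))\<^sup>2) + r * l1 n)) summable_on UNIV"
proof -
  let ?h = "\<lambda>n::int. exp (- c * (of_int n)\<^sup>2 + r * \<bar>of_int n\<bar>)"
  have s: "?h summable_on UNIV" by (rule gaussian_summable_int[OF assms])
  have "(\<lambda>(a, b). ?h a * ?h b) summable_on UNIV \<times> UNIV"
  proof (rule summable_on_SigmaI[where g = "\<lambda>a. ?h a * infsum ?h UNIV"])
    show "((\<lambda>b. case (a, b) of (a, b) \<Rightarrow> ?h a * ?h b) has_sum ?h a * infsum ?h UNIV) UNIV" for a
      using has_sum_cmult_right[OF has_sum_infsum[OF s], of "?h a"] by simp
    show "(\<lambda>a. ?h a * infsum ?h UNIV) summable_on UNIV"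
      by (rule summable_on_cmult_left[OF s])
  qed auto
  then show ?thesis
    by (subst summable_on_reindex_bij_witness[of _ "\<lambda>(a, b). vector [a, b]" "\<lambda>n. (n $ 1, n $ 2)" "UNIV \<times> UNIV",
          where h = "\<lambda>(a, b). ?h a * ?h b"])
       (auto simp: l1_def algebra_simps simp flip: exp_add)
qed

lemma siegel_H2_coercive:
  assumes "\<tau> \<in> siegel_H2"
  obtains c where "c > 0"
    "\<And>v :: real^2. v \<bullet> ((\<chi> i j. Im (\<tau> $ i $ j)) *v v) \<ge> c * ((v $ 1)\<^sup>2 + (v $ 2)\<^sup>2)"
proof -
  let ?q = "\<lambda>v :: real^2. v \<bullet> ((\<chi> i j. Im (\<tau> $ i $ j)) *v v)"
  have "compact (sphere 0 1 :: (real^2) set)" by simp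
  moreover have "sphere 0 1 \<noteq> ({} :: (real^2) set)"
    by (simp add: sphere_eq_empty)
  moreover have "continuous_on (sphere 0 1) ?q"
    by (intro continuous_intros matrix_vector_mult_linear_continuous_on)
  ultimately obtain v0 where v0: "v0 \<in> sphere 0 1" "\<And>v. v \<in> sphere 0 1 \<Longrightarrow> ?q v0 \<le> ?q v"
    using continuous_attains_inf by meson
  show thesis
  proof
    have "v0 \<noteq> 0" using v0 by auto
    then show "?q v0 > 0" using assms by (simp add: siegel_H2_def)
    fix v :: "real^2"
    show "?q v \<ge> ?q v0 * ((v $ 1)\<^sup>2 + (v $ 2)\<^sup>2)"
    proof (cases "v = 0")
      case False
      define u where "u = (1 / norm v) *\<^sub>R v"
      have v: "v = norm v *\<^sub>R u" using False by (simp add: u_def)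
      have "?q v0 \<le> ?q u" using v0(2)[of u] False by (simp add: u_def)
      then have "?q v0 * (norm v)\<^sup>2 \<le> ?q u * (norm v)\<^sup>2"
        by (intro mult_right_mono) auto
      also have "\<dots> = ?q (norm v *\<^sub>R u)"
        by (simp add: matrix_vector_mult_scaleR power2_eq_square)
      also have "\<dots> = ?q v" using v by simp
      also have "(norm v)\<^sup>2 = (v $ 1)\<^sup>2 + (v $ 2)\<^sup>2"
        unfolding power2_norm_eq_inner by (simp add: inner_vec_def sum_2 power2_eq_square)
      finally show ?thesis .
    qed simp
  qed
qed

definition theta_term :: "complex^2^2 \<Rightarrow> complex^2 \<Rightarrow> int^2 \<Rightarrow> complex" where
  "theta_term \<tau> z n = exp (of_real pi * \<i> * (bdot (cvec n) (\<tau> *v cvec n) + 2 * bdot (cvec n) z))"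

lemma riemann_theta_eq: "riemann_theta \<tau> z = infsum (theta_term \<tau> z) UNIV"
  by (simp add: riemann_theta_def theta_term_def [abs_def])

lemma bdot_2: "bdot u v = u $ 1 * v $ 1 + u $ 2 * v $ 2"
  by (simp add: bdot_def sum_2)

lemma bdot_commute: "bdot u v = bdot v u"
  by (simp add: bdot_2 algebra_simps)
lemma bdot_add_left: "bdot (u + v) w = bdot u w + bdot v w"
  by (simp add: bdot_2 algebra_simps)
lemma bdot_add_right: "bdot w (u + v) = bdot w u + bdot w v"
  by (simp add: bdot_2 algebra_simps)
lemma bdot_diff_left: "bdot (u - v) w = bdot u w - bdot v w"
  by (simp add: bdot_2 algebra_simps)
lemma bdot_diff_right: "bdot w (u - v) = bdot w u - bdot w v"
  by (simp add: bdot_2 algebra_simps)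
lemma bdot_minus_left: "bdot (- u) w = - bdot u w"
  by (simp add: bdot_2)
lemma bdot_minus_right: "bdot w (- u) = - bdot w u"
  by (simp add: bdot_2)
lemma bdot_scale_left: "bdot (c *s u) w = c * bdot u w"
  by (simp add: bdot_2 algebra_simps)
lemma bdot_scale_right: "bdot w (c *s u) = c * bdot w u"
  by (simp add: bdot_2 algebra_simps)
lemma bdot_transpose: "bdot u (A *v v) = bdot (transpose A *v u) v"
  by (simp add: bdot_2 matrix_vector_mult_def sum_2 transpose_def algebra_simps)

lemmas bdot_simps = bdot_add_left bdot_add_right bdot_diff_left bdot_diff_right
  bdot_minus_left bdot_minus_right bdot_scale_left bdot_scale_right

lemma cvec_component [simp]: "cvec n $ i = of_int (n $ i)"
  by (simp add: cvec_def)
lemma cvec_add: "cvec (m + n) = cvec m + cvec n"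
  by (simp add: vec_eq_iff)
lemma cvec_diff: "cvec (m - n) = cvec m - cvec n"
  by (simp add: vec_eq_iff)
lemma cvec_minus: "cvec (- n) = - cvec n"
  by (simp add: vec_eq_iff)
lemma cvec_0 [simp]: "cvec 0 = 0"
  by (simp add: vec_eq_iff)
lemma cvec_scale: "cvec (c *s n) = of_int c *s cvec n"
  by (simp add: vec_eq_iff)

lemma siegel_H2_sym: "\<tau> \<in> siegel_H2 \<Longrightarrow> transpose \<tau> = \<tau>"
  by (simp add: siegel_H2_def)

lemma siegel_H2_bdot: "\<tau> \<in> siegel_H2 \<Longrightarrow> bdot u (\<tau> *v v) = bdot v (\<tau> *v u)"
  by (metis bdot_commute bdot_transpose siegel_H2_sym)

lemma norm_theta_term:
  "norm (theta_term \<tau> z n) = exp (- pi * ((\<chi> i. of_int (n $ i)) \<bullet> ((\<chi> i j. Im (\<tau> $ i $ j)) *v (\<chi> i. of_int (n $ i))))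
      - 2 * pi * (of_int (n $ 1) * Im (z $ 1) + of_int (n $ 2) * Im (z $ 2)))"
  by (simp add: theta_term_def norm_exp_eq_Re bdot_2 matrix_vector_mult_def sum_2 inner_vec_def algebra_simps)

text \<open>The weight exp(r l1 n) with arbitrary r is the reserve that later pays for shifts of z
  and for the factors that differentiation brings down.\<close>

lemma theta_term_summable:
  assumes "\<tau> \<in> siegel_H2"
  shows "(\<lambda>n. norm (theta_term \<tau> z n) * exp (r * l1 n)) summable_on UNIV"
proof -
  obtain c where c: "c > 0"
    "\<And>v :: real^2. v \<bullet> ((\<chi> i j. Im (\<tau> $ i $ j)) *v v) \<ge> c * ((v $ 1)\<^sup>2 + (v $ 2)\<^sup>2)"
    using siegel_H2_coercive[OF assms] by blast
  define R where "R = 2 * pi * (\<bar>Im (z $ 1)\<bar> + \<bar>Im (z $ 2)\<bar>)"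
  have "(\<lambda>n::int^2. exp (- (pi * c) * ((of_int (n $ 1))\<^sup>2 + (of_int (n $ 2))\<^sup>2) + (R + r) * l1 n)) summable_on UNIV"
    by (rule gaussian_summable_int2) (use c in simp)
  then show ?thesis
  proof (rule summable_on_comparison_test)
    fix n :: "int^2"
    let ?n = "(\<chi> i. of_int (n $ i)) :: real^2"
    have 1: "c * ((of_int (n $ 1))\<^sup>2 + (of_int (n $ 2))\<^sup>2) \<le> ?n \<bullet> ((\<chi> i j. Im (\<tau> $ i $ j)) *v ?n)"
      using c(2)[of ?n] by simp
    have 2: "- (of_int (n $ i) * Im (z $ i)) \<le> l1 n * \<bar>Im (z $ i)\<bar>" for i
    proof -
      have "- (of_int (n $ i) * Im (z $ i)) \<le> \<bar>of_int (n $ i)\<bar> * \<bar>Im (z $ i)\<bar>"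
        by (metis abs_ge_minus_self abs_mult)
      also have "\<dots> \<le> l1 n * \<bar>Im (z $ i)\<bar>"
        using exhaust_2[of i] by (intro mult_right_mono) (auto simp: l1_def)
      finally show ?thesis .
    qed
    have "- (of_int (n $ 1) * Im (z $ 1)) - of_int (n $ 2) * Im (z $ 2) \<le> l1 n * (\<bar>Im (z $ 1)\<bar> + \<bar>Im (z $ 2)\<bar>)"
      using 2[of 1] 2[of 2] by (simp add: algebra_simps)
    then have "2 * pi * (- (of_int (n $ 1) * Im (z $ 1)) - of_int (n $ 2) * Im (z $ 2))
        \<le> 2 * pi * (l1 n * (\<bar>Im (z $ 1)\<bar> + \<bar>Im (z $ 2)\<bar>))"
      by (rule mult_left_mono) simp
    moreover have "pi * (c * ((of_int (n $ 1))\<^sup>2 + (of_int (n $ 2))\<^sup>2)) \<le> pi * (?n \<bullet> ((\<chi> i j. Im (\<tau> $ i $ j)) *v ?n))"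
      using 1 by (rule mult_left_mono) simp
    ultimately show "norm (theta_term \<tau> z n) * exp (r * l1 n)
        \<le> exp (- (pi * c) * ((of_int (n $ 1))\<^sup>2 + (of_int (n $ 2))\<^sup>2) + (R + r) * l1 n)"
      unfolding norm_theta_term R_def by (simp add: algebra_simps flip: exp_add)
  qed auto
qed

lemma theta_term_abs_summable:
  assumes "\<tau> \<in> siegel_H2"
  shows "(\<lambda>n. norm (theta_term \<tau> z n)) summable_on UNIV"
  using theta_term_summable[OF assms, of z 0] by simp

lemma theta_term_summable_on:
  assumes "\<tau> \<in> siegel_H2"
  shows "theta_term \<tau> z summable_on UNIV"
  using theta_term_abs_summable[OF assms] by (rule abs_summable_summable)

lemma theta_term_add: "theta_term \<tau> (z + w) n = theta_term \<tau> z n * exp (2 * of_real pi * \<i> * bdot (cvec n) w)"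
  by (simp add: theta_term_def bdot_simps algebra_simps flip: exp_add)

section \<open>Series of exponentials\<close>

lemma norm_exp_minus_linear_le:
  fixes x :: complex
  shows "norm (exp x - 1 - x) \<le> norm x ^ 2 * exp (norm x)"
proof -
  have "norm (exp x - (\<Sum>k\<le>1. x ^ k / fact k)) \<le> exp (norm x) * norm x ^ Suc 1 / fact 1"
    by (rule Taylor_exp_field)
  then show ?thesis by (simp add: algebra_simps power2_eq_square)
qed

text \<open>Decay faster than every exponential of the frequencies \<open>k n\<close>. Asking for
  all r at once makes the class stable under multiplication by a frequency and by its exponential,
  so series can be differentiated termwise repeatedly.\<close>

definition rapid :: "('i \<Rightarrow> complex) \<Rightarrow> ('i \<Rightarrow> 'b::real_normed_vector) \<Rightarrow> bool" where
  "rapid a k \<longleftrightarrow> (\<forall>r. (\<lambda>n. norm (a n) * exp (r * norm (k n))) summable_on UNIV)"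

lemma rapid_dominated:
  assumes "rapid a k" "\<And>n. norm (b n) \<le> norm (a n) * exp (s * norm (k n))"
  shows "rapid b k"
  unfolding rapid_def
proof
  fix r
  have "(\<lambda>n. norm (a n) * exp ((s + r) * norm (k n))) summable_on UNIV"
    using assms by (simp add: rapid_def)
  then show "(\<lambda>n. norm (b n) * exp (r * norm (k n))) summable_on UNIV"
  proof (rule summable_on_comparison_test)
    fix n
    have "norm (b n) * exp (r * norm (k n)) \<le> norm (a n) * exp (s * norm (k n)) * exp (r * norm (k n))"
      using assms(2) by (intro mult_right_mono) auto
    then show "norm (b n) * exp (r * norm (k n)) \<le> norm (a n) * exp ((s + r) * norm (k n))"
      by (simp add: distrib_right exp_add)
  qed auto
qed

lemma rapid_weaken:
  assumes "rapid a k" "\<And>n. norm (c n) \<le> s * norm (k n)"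
  shows "rapid a c"
  unfolding rapid_def
proof
  fix r
  have "(\<lambda>n. norm (a n) * exp ((\<bar>r\<bar> * s) * norm (k n))) summable_on UNIV"
    using assms by (simp add: rapid_def)
  then show "(\<lambda>n. norm (a n) * exp (r * norm (c n))) summable_on UNIV"
  proof (rule summable_on_comparison_test)
    fix n
    have "r * norm (c n) \<le> \<bar>r\<bar> * norm (c n)" by (intro mult_right_mono) auto
    also have "\<dots> \<le> \<bar>r\<bar> * (s * norm (k n))" by (intro mult_left_mono assms) auto
    finally show "norm (a n) * exp (r * norm (c n)) \<le> norm (a n) * exp ((\<bar>r\<bar> * s) * norm (k n))"
      by (intro mult_left_mono) (auto simp: mult_ac)
  qed auto
qed

lemma rapid_mult:
  assumes "rapid a k" "\<And>n. norm (c n) \<le> norm (k n)"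
  shows "rapid (\<lambda>n. a n * c n) k"
proof (rule rapid_dominated[OF assms(1), where s = 1])
  fix n
  have "norm (c n) \<le> exp (norm (k n))"
    using assms(2)[of n] exp_ge_add_one_self[of "norm (k n)"] by linarith
  then show "norm (a n * c n) \<le> norm (a n) * exp (1 * norm (k n))"
    by (simp add: norm_mult mult_left_mono)
qed

lemma rapid_exp:
  assumes "rapid a k" "\<And>n. norm (\<phi> n) \<le> s * norm (k n)"
  shows "rapid (\<lambda>n. a n * exp (\<phi> n)) k"
proof (rule rapid_dominated[OF assms(1)])
  fix n
  have "norm (exp (\<phi> n)) \<le> exp (norm (\<phi> n))" by (rule norm_exp)
  also have "\<dots> \<le> exp (s * norm (k n))" using assms(2) by simp
  finally show "norm (a n * exp (\<phi> n)) \<le> norm (a n) * exp (s * norm (k n))"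
    by (simp only: norm_mult mult_left_mono norm_ge_zero)
qed

lemma rapid_norm_summable:
  assumes "rapid a k"
  shows "(\<lambda>n. norm (a n)) summable_on UNIV"
  using assms[unfolded rapid_def, rule_format, of 0] by simp

lemma rapid_summable: "rapid a k \<Longrightarrow> a summable_on UNIV"
  by (rule abs_summable_summable[OF rapid_norm_summable])

lemma rapid_shift:
  fixes c :: "'i \<Rightarrow> complex"
  assumes "rapid a c"
  shows "rapid (\<lambda>n. a n * exp (t * c n)) c"
  by (rule rapid_exp[OF assms, where s = "norm t"]) (simp add: norm_mult)

text \<open>For |h| at most 1 the remainder exp(hc) - 1 - hc is bounded by |h|^2 |c|^2 exp|c|, and
  the sum of these bounds converges because \<open>a\<close> is rapid.\<close>

lemma rapid_has_derivative_0:
  assumes "rapid a c"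
  shows "((\<lambda>t. infsum (\<lambda>n. a n * exp (t * c n)) UNIV) has_field_derivative infsum (\<lambda>n. a n * c n) UNIV) (at 0)"
proof -
  define F where "F t = infsum (\<lambda>n. a n * exp (t * c n)) UNIV" for t
  define D where "D = infsum (\<lambda>n. a n * c n) UNIV"
  have s: "(\<lambda>n. a n * exp (t * c n)) summable_on UNIV" for t
    by (rule rapid_summable[OF rapid_shift[OF assms]])
  have s': "(\<lambda>n. a n * c n) summable_on UNIV"
    by (rule rapid_summable[OF rapid_mult[OF assms order_refl]])
  have sK: "(\<lambda>n. norm (a n * c n * c n) * exp (1 * norm (c n))) summable_on UNIV"
    using rapid_mult[OF rapid_mult[OF assms order_refl] order_refl] unfolding rapid_def by blast
  define K where "K = infsum (\<lambda>n. norm (a n * c n * c n) * exp (1 * norm (c n))) UNIV"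
  have bound: "norm (F h - F 0 - h * D) \<le> K * (norm h)\<^sup>2" if "norm h \<le> 1" for h
  proof -
    have eq: "F h - F 0 - h * D = infsum (\<lambda>n. a n * (exp (h * c n) - 1 - h * c n)) UNIV"
    proof -
      have "((\<lambda>n. a n * exp (h * c n) + (- (a n * exp (0 * c n)) + (- h * (a n * c n)))) has_sum (F h + (- F 0 + - h * D))) UNIV"
        unfolding F_def D_def
        by (intro has_sum_add has_sum_uminusI has_sum_cmult_right has_sum_infsum s s')
      then have "((\<lambda>n. a n * (exp (h * c n) - 1 - h * c n)) has_sum (F h - F 0 - h * D)) UNIV"
        by (simp add: algebra_simps)
      then show ?thesis
        by (rule infsumI[symmetric])
    qed
    have "norm (infsum (\<lambda>n. a n * (exp (h * c n) - 1 - h * c n)) UNIV)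
        \<le> infsum (\<lambda>n. (norm (a n * c n * c n) * exp (1 * norm (c n))) * (norm h)\<^sup>2) UNIV"
    proof (rule norm_infsum_le[OF has_sum_infsum has_sum_infsum])
      show "(\<lambda>n. a n * (exp (h * c n) - 1 - h * c n)) summable_on UNIV"
      proof -
        have "(\<lambda>n. a n * exp (h * c n) + (- (a n * exp (0 * c n)) + (- h * (a n * c n)))) summable_on UNIV"
          by (intro summable_on_add summable_on_uminus[THEN iffD2] summable_on_cmult_right s s')
        then show ?thesis by (simp add: algebra_simps)
      qed
      show "(\<lambda>n. (norm (a n * c n * c n) * exp (1 * norm (c n))) * (norm h)\<^sup>2) summable_on UNIV"
        by (rule summable_on_cmult_left[OF sK])
      fix n
      have "norm (exp (h * c n) - 1 - h * c n) \<le> norm (h * c n) ^ 2 * exp (norm (h * c n))"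
        by (rule norm_exp_minus_linear_le)
      also have "\<dots> \<le> norm (h * c n) ^ 2 * exp (1 * norm (c n))"
        using mult_right_mono[OF that norm_ge_zero[of "c n"]] by (intro mult_left_mono) (auto simp: norm_mult)
      finally have "norm (a n) * norm (exp (h * c n) - 1 - h * c n) \<le> norm (a n) * (norm (h * c n) ^ 2 * exp (1 * norm (c n)))"
        by (rule mult_left_mono) simp
      then show "norm (a n * (exp (h * c n) - 1 - h * c n)) \<le> (norm (a n * c n * c n) * exp (1 * norm (c n))) * (norm h)\<^sup>2"
        by (simp add: norm_mult power2_eq_square mult_ac)
    qed
    also have "\<dots> = K * (norm h)\<^sup>2"
      unfolding K_def by (rule infsum_cmult_left) (use sK in auto)
    finally show ?thesis unfolding eq .
  qed
  have "((\<lambda>h. (F h - F 0) / h) \<longlongrightarrow> D) (at 0)"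
  proof (rule LIM_zero_cancel)
    show "((\<lambda>h. (F h - F 0) / h - D) \<longlongrightarrow> 0) (at 0)"
    proof (rule Lim_null_comparison[where g = "\<lambda>h. K * norm h"])
      have "\<forall>\<^sub>F h in at 0. norm (h::complex) < 1"
        using eventually_at_ball[of 1 "0::complex" UNIV] by (auto simp: dist_norm elim: eventually_mono)
      moreover have "\<forall>\<^sub>F h in at 0. h \<noteq> (0::complex)"
        by (rule eventually_neq_at_within)
      ultimately show "\<forall>\<^sub>F h in at 0. norm ((F h - F 0) / h - D) \<le> K * norm h"
      proof eventually_elim
        case (elim h)
        have "norm ((F h - F 0) / h - D) = norm (F h - F 0 - h * D) / norm h"
          using elim by (simp add: field_simps flip: norm_divide)
        also have "\<dots> \<le> K * (norm h)\<^sup>2 / norm h"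
          using bound[of h] elim by (intro divide_right_mono) auto
        finally show ?case using elim by (simp add: power2_eq_square)
      qed
      show "((\<lambda>h::complex. K * norm h) \<longlongrightarrow> 0) (at 0)"
        by (auto intro!: tendsto_eq_intros)
    qed
  qed
  then show ?thesis
    unfolding F_def[abs_def] D_def by (simp add: has_field_derivative_iff)
qed

lemma rapid_has_derivative:
  assumes "rapid a c"
  shows "((\<lambda>t. infsum (\<lambda>n. a n * exp (t * c n)) UNIV) has_field_derivative infsum (\<lambda>n. a n * c n * exp (t * c n)) UNIV) (at t)"
proof -
  have "((\<lambda>h. infsum (\<lambda>n. (a n * exp (t * c n)) * exp (h * c n)) UNIV) has_field_derivative
      infsum (\<lambda>n. (a n * exp (t * c n)) * c n) UNIV) (at 0)"
    by (rule rapid_has_derivative_0[OF rapid_shift[OF assms]])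
  also have "(\<lambda>h. infsum (\<lambda>n. (a n * exp (t * c n)) * exp (h * c n)) UNIV) = (\<lambda>h. infsum (\<lambda>n. a n * exp ((t + h) * c n)) UNIV)"
    by (simp add: algebra_simps exp_add)
  finally have "((\<lambda>h. infsum (\<lambda>n. a n * exp ((h + t) * c n)) UNIV) has_field_derivative
      infsum (\<lambda>n. a n * c n * exp (t * c n)) UNIV) (at 0)"
    by (simp add: algebra_simps)
  then show ?thesis
    using DERIV_at_within_shift[of "\<lambda>t. infsum (\<lambda>n. a n * exp (t * c n)) UNIV" "infsum (\<lambda>n. a n * c n * exp (t * c n)) UNIV" t 0 UNIV]
    by (simp add: algebra_simps)
qed

section \<open>Functions on C^2 with a linear and a quadratic jet at the origin\<close>

definition qform :: "complex^3 \<Rightarrow> complex^2 \<Rightarrow> complex" where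
  "qform q w = q $ 1 * (w $ 1)\<^sup>2 + q $ 2 * w $ 1 * w $ 2 + q $ 3 * (w $ 2)\<^sup>2"

text \<open>Holomorphy is asked for along complex lines only, so that one-variable theory applies.
  That the first two derivatives at 0 depend on the direction through a linear and a quadratic form
  is therefore recorded separately; the 2 makes q the Taylor coefficient.\<close>

definition entire2 :: "(complex^2 \<Rightarrow> complex) \<Rightarrow> bool" where
  "entire2 G \<longleftrightarrow> (\<forall>z w. (\<lambda>t. G (z + t *s w)) holomorphic_on UNIV) \<and>
     (\<exists>l. \<forall>w. deriv (\<lambda>t. G (t *s w)) 0 = bdot l w) \<and>
     (\<exists>q. \<forall>w. deriv (deriv (\<lambda>t. G (t *s w))) 0 = 2 * qform q w)"

lemma entire2_holomorphic: "entire2 G \<Longrightarrow> (\<lambda>t. G (z + t *s w)) holomorphic_on UNIV"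
  by (simp add: entire2_def)

lemma entire2_holomorphic_0: "entire2 G \<Longrightarrow> (\<lambda>t. G (t *s w)) holomorphic_on UNIV"
  using entire2_holomorphic[of G 0 w] by simp

lemma qform_add: "qform (p + q) w = qform p w + qform q w"
  by (simp add: qform_def algebra_simps)
lemma qform_diff: "qform (p - q) w = qform p w - qform q w"
  by (simp add: qform_def algebra_simps)
lemma qform_scale: "qform (c *s q) w = c * qform q w"
  by (simp add: qform_def algebra_simps)

lemma entire2_cmult:
  assumes "entire2 G"
  shows "entire2 (\<lambda>z. c * G z)"
proof -
  obtain l q where l: "\<And>w. deriv (\<lambda>t. G (t *s w)) 0 = bdot l w"
    and q: "\<And>w. deriv (deriv (\<lambda>t. G (t *s w))) 0 = 2 * qform q w"
    using assms unfolding entire2_def by blast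
  note h = entire2_holomorphic_0[OF assms]
  have d: "deriv (\<lambda>t. c * G (t *s w)) = (\<lambda>t. c * deriv (\<lambda>t. G (t *s w)) t)" for w
    using holomorphic_on_imp_differentiable_at[OF h] by (auto intro!: deriv_cmult)
  have dd: "deriv (deriv (\<lambda>t. c * G (t *s w))) 0 = c * deriv (deriv (\<lambda>t. G (t *s w))) 0" for w
    unfolding d using holomorphic_on_imp_differentiable_at[OF holomorphic_deriv[OF h]]
    by (auto intro!: deriv_cmult)
  show ?thesis unfolding entire2_def
  proof (intro conjI allI exI)
    show "(\<lambda>t. c * G (z + t *s w)) holomorphic_on UNIV" for z w
      by (intro holomorphic_intros entire2_holomorphic assms)
    show "deriv (\<lambda>t. c * G (t *s w)) 0 = bdot (c *s l) w" for w
      by (simp add: d l bdot_simps)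
    show "deriv (deriv (\<lambda>t. c * G (t *s w))) 0 = 2 * qform (c *s q) w" for w
      by (simp add: dd q qform_scale)
  qed
qed

lemma entire2_add:
  assumes "entire2 G" "entire2 H"
  shows "entire2 (\<lambda>z. G z + H z)"
proof -
  obtain l q where l: "\<And>w. deriv (\<lambda>t. G (t *s w)) 0 = bdot l w"
    and q: "\<And>w. deriv (deriv (\<lambda>t. G (t *s w))) 0 = 2 * qform q w"
    using assms(1) unfolding entire2_def by blast
  obtain l' q' where l': "\<And>w. deriv (\<lambda>t. H (t *s w)) 0 = bdot l' w"
    and q': "\<And>w. deriv (deriv (\<lambda>t. H (t *s w))) 0 = 2 * qform q' w"
    using assms(2) unfolding entire2_def by blast
  note h = entire2_holomorphic_0[OF assms(1)] entire2_holomorphic_0[OF assms(2)]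
  have d: "deriv (\<lambda>t. G (t *s w) + H (t *s w)) = (\<lambda>t. deriv (\<lambda>t. G (t *s w)) t + deriv (\<lambda>t. H (t *s w)) t)" for w
    using holomorphic_on_imp_differentiable_at[OF h(1)] holomorphic_on_imp_differentiable_at[OF h(2)]
    by (auto intro!: deriv_add)
  have dd: "deriv (deriv (\<lambda>t. G (t *s w) + H (t *s w))) 0 = deriv (deriv (\<lambda>t. G (t *s w))) 0 + deriv (deriv (\<lambda>t. H (t *s w))) 0" for w
    unfolding d using holomorphic_on_imp_differentiable_at[OF holomorphic_deriv[OF h(1)]]
      holomorphic_on_imp_differentiable_at[OF holomorphic_deriv[OF h(2)]]
    by (auto intro!: deriv_add)
  show ?thesis unfolding entire2_def
  proof (intro conjI allI exI)
    show "(\<lambda>t. G (z + t *s w) + H (z + t *s w)) holomorphic_on UNIV" for z w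
      by (intro holomorphic_intros entire2_holomorphic assms)
    show "deriv (\<lambda>t. G (t *s w) + H (t *s w)) 0 = bdot (l + l') w" for w
      by (simp add: d l l' bdot_simps)
    show "deriv (deriv (\<lambda>t. G (t *s w) + H (t *s w))) 0 = 2 * qform (q + q') w" for w
      by (simp add: dd q q' qform_add)
  qed
qed

lemma norm_bdot_le: "norm (bdot u v) \<le> 2 * norm u * norm v"
proof -
  have "norm (bdot u v) \<le> norm (u $ 1 * v $ 1) + norm (u $ 2 * v $ 2)"
    unfolding bdot_2 by (rule norm_triangle_ineq)
  also have "\<dots> \<le> norm u * norm v + norm u * norm v"
    unfolding norm_mult by (intro add_mono mult_mono Finite_Cartesian_Product.norm_nth_le) auto
  finally show ?thesis by simp
qed

lemma rapid_bdot:
  assumes "rapid a k"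
  shows "rapid a (\<lambda>n. bdot (k n) w)"
  by (rule rapid_weaken[OF assms, where s = "2 * norm w"]) (metis norm_bdot_le bdot_commute)

lemma rapid_exp_bdot:
  assumes "rapid a k"
  shows "rapid (\<lambda>n. a n * exp (bdot (k n) z)) k"
  by (rule rapid_exp[OF assms, where s = "2 * norm z"]) (metis norm_bdot_le bdot_commute)

lemma entire2_series:
  assumes "rapid a k"
  shows "entire2 (\<lambda>z. infsum (\<lambda>n. a n * exp (bdot (k n) z)) UNIV)"
  unfolding entire2_def
proof (intro conjI allI)
  fix z w
  have e: "(\<lambda>t. infsum (\<lambda>n. a n * exp (bdot (k n) (z + t *s w))) UNIV)
      = (\<lambda>t. infsum (\<lambda>n. (a n * exp (bdot (k n) z)) * exp (t * bdot (k n) w)) UNIV)"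
    by (simp add: bdot_simps exp_add mult_ac)
  show "(\<lambda>t. infsum (\<lambda>n. a n * exp (bdot (k n) (z + t *s w))) UNIV) holomorphic_on UNIV"
    unfolding e using rapid_has_derivative[OF rapid_bdot[OF rapid_exp_bdot[OF assms]]]
    by (auto simp: holomorphic_on_open)
next
  have e: "(\<lambda>t. infsum (\<lambda>n. a n * exp (bdot (k n) (t *s w))) UNIV)
      = (\<lambda>t. infsum (\<lambda>n. a n * exp (t * bdot (k n) w)) UNIV)" for w
    by (simp add: bdot_simps)
  have d: "deriv (\<lambda>t. infsum (\<lambda>n. a n * exp (bdot (k n) (t *s w))) UNIV)
      = (\<lambda>t. infsum (\<lambda>n. a n * bdot (k n) w * exp (t * bdot (k n) w)) UNIV)" for w
    unfolding e using rapid_has_derivative[OF rapid_bdot[OF assms]] by (auto intro!: DERIV_imp_deriv)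
  have dd: "deriv (deriv (\<lambda>t. infsum (\<lambda>n. a n * exp (bdot (k n) (t *s w))) UNIV)) 0
      = infsum (\<lambda>n. a n * bdot (k n) w * bdot (k n) w) UNIV" for w
    unfolding d
    using rapid_has_derivative[OF rapid_mult[OF rapid_bdot[OF assms] order_refl], where t = 0]
    by (auto intro!: DERIV_imp_deriv)
  define A where "A i = infsum (\<lambda>n. a n * k n $ i) UNIV" for i
  define Q where "Q i j = infsum (\<lambda>n. a n * k n $ i * k n $ j) UNIV" for i j
  have A: "((\<lambda>n. a n * k n $ i) has_sum A i) UNIV" for i
    unfolding A_def by (intro has_sum_infsum rapid_summable[of _ k] rapid_mult Finite_Cartesian_Product.norm_nth_le assms)
  have Q: "((\<lambda>n. a n * k n $ i * k n $ j) has_sum Q i j) UNIV" for i j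
    unfolding Q_def by (intro has_sum_infsum rapid_summable[of _ k] rapid_mult Finite_Cartesian_Product.norm_nth_le assms)
  show "\<exists>l. \<forall>w. deriv (\<lambda>t. infsum (\<lambda>n. a n * exp (bdot (k n) (t *s w))) UNIV) 0 = bdot l w"
  proof (intro exI allI)
    fix w :: "complex^2"
    have "((\<lambda>n. w $ 1 * (a n * k n $ 1) + w $ 2 * (a n * k n $ 2)) has_sum (w $ 1 * A 1 + w $ 2 * A 2)) UNIV"
      by (intro has_sum_add has_sum_cmult_right A)
    then show "deriv (\<lambda>t. infsum (\<lambda>n. a n * exp (bdot (k n) (t *s w))) UNIV) 0 = bdot (vector [A 1, A 2]) w"
      unfolding d by (simp add: bdot_2 algebra_simps infsumI)
  qed
  show "\<exists>q. \<forall>w. deriv (deriv (\<lambda>t. infsum (\<lambda>n. a n * exp (bdot (k n) (t *s w))) UNIV)) 0 = 2 * qform q w"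
  proof (intro exI allI)
    fix w :: "complex^2"
    have "((\<lambda>n. (w $ 1)\<^sup>2 * (a n * k n $ 1 * k n $ 1) + (2 * w $ 1 * w $ 2) * (a n * k n $ 1 * k n $ 2)
          + (w $ 2)\<^sup>2 * (a n * k n $ 2 * k n $ 2)) has_sum ((w $ 1)\<^sup>2 * Q 1 1 + (2 * w $ 1 * w $ 2) * Q 1 2 + (w $ 2)\<^sup>2 * Q 2 2)) UNIV"
      by (intro has_sum_add has_sum_cmult_right Q)
    also have "(\<lambda>n. (w $ 1)\<^sup>2 * (a n * k n $ 1 * k n $ 1) + (2 * w $ 1 * w $ 2) * (a n * k n $ 1 * k n $ 2)
          + (w $ 2)\<^sup>2 * (a n * k n $ 2 * k n $ 2)) = (\<lambda>n. a n * bdot (k n) w * bdot (k n) w)"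
      by (rule ext) (simp add: bdot_2 algebra_simps power2_eq_square)
    finally show "deriv (deriv (\<lambda>t. infsum (\<lambda>n. a n * exp (bdot (k n) (t *s w))) UNIV)) 0
        = 2 * qform (vector [Q 1 1 / 2, Q 1 2, Q 2 2 / 2]) w"
      unfolding dd by (simp add: infsumI qform_def vector_3 algebra_simps)
  qed
qed

text \<open>Joint continuity in both variables, for the compactness argument on the torus and for
  double integrals; \<open>entire2\<close> speaks about single lines only.\<close>

lemma continuous_series:
  assumes "rapid a k"
  shows "continuous_on UNIV (\<lambda>z. infsum (\<lambda>n. a n * exp (bdot (k n) z)) UNIV)"
proof -
  define F where "F z = infsum (\<lambda>n. a n * exp (bdot (k n) z)) UNIV" for z
  have "isCont F z" for z
  proof -
    define b where "b n = a n * exp (bdot (k n) z)" for n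
    have b: "rapid b k" unfolding b_def by (rule rapid_exp_bdot[OF assms])
    have s: "(\<lambda>n. a n * exp (bdot (k n) z)) summable_on UNIV" for z
      by (rule rapid_summable[OF rapid_exp_bdot[OF assms]])
    have "(\<lambda>n. norm (b n) * exp (3 * norm (k n))) summable_on UNIV"
      using b by (simp add: rapid_def)
    \<comment> \<open>Of the weight 3, two parts bound the exponential of
      \<open>bdot (k n) w\<close> for norm w at most 1, and one absorbs the factor norm (k
      n).\<close>
    define K where "K = infsum (\<lambda>n. norm (b n) * exp (3 * norm (k n))) UNIV"
    have bound: "norm (F (z + w) - F z) \<le> K * (2 * norm w)" if "norm w \<le> 1" for w
    proof -
      have "((\<lambda>n. a n * exp (bdot (k n) (z + w)) + - (a n * exp (bdot (k n) z))) has_sum (F (z + w) + - F z)) UNIV"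
        unfolding F_def by (intro has_sum_add has_sum_uminusI has_sum_infsum s)
      then have h: "((\<lambda>n. b n * (exp (bdot (k n) w) - 1)) has_sum (F (z + w) - F z)) UNIV"
        by (simp add: b_def bdot_simps exp_add algebra_simps)
      have h': "((\<lambda>n. norm (b n) * exp (3 * norm (k n)) * (2 * norm w)) has_sum K * (2 * norm w)) UNIV"
        unfolding K_def by (intro has_sum_cmult_left has_sum_infsum) fact
      show ?thesis
      proof (rule norm_infsum_le[OF h h'])
        fix n
        let ?x = "bdot (k n) w"
        have x: "norm ?x \<le> norm (k n) * (2 * norm w)" using norm_bdot_le[of "k n" w] by (simp add: mult_ac)
        also have "\<dots> \<le> norm (k n) * 2" using that by (intro mult_left_mono) auto
        finally have x2: "norm ?x \<le> 2 * norm (k n)" by simp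
        have "norm (exp ?x - (\<Sum>i\<le>0. ?x ^ i / fact i)) \<le> exp (norm ?x) * norm ?x ^ Suc 0 / fact 0"
          by (rule Taylor_exp_field)
        then have "norm (exp ?x - 1) \<le> exp (norm ?x) * norm ?x" by simp
        also have "\<dots> \<le> exp (2 * norm (k n)) * (norm (k n) * (2 * norm w))"
          using x x2 by (intro mult_mono) auto
        also have "\<dots> \<le> exp (2 * norm (k n)) * (exp (norm (k n)) * (2 * norm w))"
          using exp_ge_add_one_self[of "norm (k n)"] by (intro mult_left_mono mult_right_mono) (linarith, auto)
        also have "\<dots> = exp (3 * norm (k n)) * (2 * norm w)"
          by (simp flip: exp_add)
        finally have "norm (b n) * norm (exp ?x - 1) \<le> norm (b n) * (exp (3 * norm (k n)) * (2 * norm w))"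
          by (rule mult_left_mono) simp
        then show "norm (b n * (exp ?x - 1)) \<le> norm (b n) * exp (3 * norm (k n)) * (2 * norm w)"
          by (simp add: norm_mult mult_ac)
      qed
    qed
    have "((\<lambda>w. F (z + w) - F z) \<longlongrightarrow> 0) (at 0)"
    proof (rule Lim_null_comparison[where g = "\<lambda>w. K * (2 * norm w)"])
      have "\<forall>\<^sub>F w in at 0. norm (w::complex^2) < 1"
        using eventually_at_ball[of 1 "0::complex^2" UNIV] by (auto simp: dist_norm elim: eventually_mono)
      then show "\<forall>\<^sub>F w in at 0. norm (F (z + w) - F z) \<le> K * (2 * norm w)"
        by eventually_elim (use bound in auto)
      show "((\<lambda>w::complex^2. K * (2 * norm w)) \<longlongrightarrow> 0) (at 0)"
        by (auto intro!: tendsto_eq_intros)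
    qed
    then have "((\<lambda>w. F (z + w)) \<longlongrightarrow> F z) (at 0)"
      by (rule LIM_zero_cancel)
    then show ?thesis by (simp add: isCont_iff)
  qed
  then show ?thesis unfolding F_def by (simp add: continuous_on_eq_continuous_at)
qed

lemma norm_cvec_le: "norm (cvec n) \<le> l1 n"
proof -
  have "norm (cvec n) \<le> (\<Sum>i\<in>UNIV. norm (cvec n $ i))"
    unfolding norm_vec_def by (rule L2_set_le_sum) simp
  then show ?thesis by (simp add: sum_2 l1_def)
qed

text \<open>The affine frequencies cover theta itself (c = 1, d = 0) and the series of
  \<open>quarter_theta\<close> (c = 2, d = x).\<close>

lemma theta_rapid:
  assumes "\<tau> \<in> siegel_H2"
  shows "rapid (theta_term \<tau> z0) (\<lambda>n. (2 * of_real pi * \<i>) *s (c *s cvec n + d))"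
  unfolding rapid_def
proof
  fix r
  define R where "R = \<bar>r\<bar> * (2 * pi * norm c)"
  define S where "S = \<bar>r\<bar> * (2 * pi * norm d)"
  have "(\<lambda>n. norm (theta_term \<tau> z0 n) * exp (R * l1 n) * exp S) summable_on UNIV"
    by (rule summable_on_cmult_left[OF theta_term_summable[OF assms]])
  then show "(\<lambda>n. norm (theta_term \<tau> z0 n) * exp (r * norm ((2 * of_real pi * \<i>) *s (c *s cvec n + d)))) summable_on UNIV"
  proof (rule summable_on_comparison_test)
    fix n
    have sc: "norm (e *s v) = norm e * norm v" for e and v :: "complex^2"
      by (simp add: norm_vec_def L2_set_right_distrib norm_mult)
    have "norm ((2 * of_real pi * \<i>) *s (c *s cvec n + d)) = 2 * pi * norm (c *s cvec n + d)"
      unfolding sc by (simp add: norm_mult)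
    also have "\<dots> \<le> 2 * pi * (norm c * l1 n + norm d)"
      by (intro mult_left_mono order_trans[OF norm_triangle_ineq] add_right_mono)
         (auto simp: sc intro!: mult_left_mono norm_cvec_le)
    finally have "\<bar>r\<bar> * norm ((2 * of_real pi * \<i>) *s (c *s cvec n + d)) \<le> \<bar>r\<bar> * (2 * pi * (norm c * l1 n + norm d))"
      by (rule mult_left_mono) simp
    moreover have "r * norm ((2 * of_real pi * \<i>) *s (c *s cvec n + d)) \<le> \<bar>r\<bar> * norm ((2 * of_real pi * \<i>) *s (c *s cvec n + d))"
      by (intro mult_right_mono) auto
    ultimately have "r * norm ((2 * of_real pi * \<i>) *s (c *s cvec n + d)) \<le> R * l1 n + S"
      by (simp add: R_def S_def algebra_simps)
    then have "exp (r * norm ((2 * of_real pi * \<i>) *s (c *s cvec n + d))) \<le> exp (R * l1 n) * exp S"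
      by (simp flip: exp_add)
    then show "norm (theta_term \<tau> z0 n) * exp (r * norm ((2 * of_real pi * \<i>) *s (c *s cvec n + d)))
        \<le> norm (theta_term \<tau> z0 n) * exp (R * l1 n) * exp S"
      unfolding mult.assoc by (rule mult_left_mono) simp
  qed auto
qed

lemma riemann_theta_series:
  "riemann_theta \<tau> (c *s z + z0) = infsum (\<lambda>n. theta_term \<tau> z0 n * exp (bdot ((2 * of_real pi * \<i>) *s (c *s cvec n + 0)) z)) UNIV"
proof -
  have "theta_term \<tau> (c *s z + z0) n = theta_term \<tau> z0 n * exp (bdot ((2 * of_real pi * \<i>) *s (c *s cvec n + 0)) z)" for n
    using theta_term_add[of \<tau> z0 "c *s z" n] by (simp add: bdot_simps add.commute mult_ac)
  then show ?thesis unfolding riemann_theta_eq by (intro infsum_cong)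
qed

lemma entire2_riemann_theta:
  assumes "\<tau> \<in> siegel_H2"
  shows "entire2 (\<lambda>z. riemann_theta \<tau> (c *s z + z0))"
  unfolding riemann_theta_series by (rule entire2_series[OF theta_rapid[OF assms]])

lemma continuous_riemann_theta:
  assumes "\<tau> \<in> siegel_H2"
  shows "continuous_on UNIV (riemann_theta \<tau>)"
proof -
  have "continuous_on UNIV (\<lambda>z. riemann_theta \<tau> (1 *s z + 0))"
    unfolding riemann_theta_series by (rule continuous_series[OF theta_rapid[OF assms]])
  then show ?thesis by (simp add: vector_scalar_mult_def)
qed

section \<open>Quasi-periodicity and the addition formula\<close>

lemma exp_2pi_int: "exp (2 * of_real pi * \<i> * of_int k) = 1"
  using exp_integer_2pi[of "of_int k"] by (simp add: mult_ac)

lemma exp_pi_int: "exp (of_real pi * \<i> * of_int k) = (if even k then 1 else -1)"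
proof (cases "even k")
  case True
  then obtain m where "k = 2 * m" by blast
  then show ?thesis using exp_2pi_int[of m] by (simp add: mult_ac)
next
  case False
  then obtain m where "k = 2 * m + 1" by (meson oddE)
  then show ?thesis using exp_2pi_int[of m] by (simp add: exp_add algebra_simps)
qed

lemma bdot_cvec: "bdot (cvec m) (cvec n) = of_int (m $ 1 * n $ 1 + m $ 2 * n $ 2)"
  by (simp add: bdot_2)

lemma riemann_theta_periodic: "riemann_theta \<tau> (z + cvec m) = riemann_theta \<tau> z"
  unfolding riemann_theta_eq
  by (intro infsum_cong) (simp only: theta_term_add bdot_cvec exp_2pi_int mult_1_right)

lemma riemann_theta_quasi_periodic:
  assumes "\<tau> \<in> siegel_H2"
  shows "riemann_theta \<tau> (z + \<tau> *v cvec m)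
    = exp (- of_real pi * \<i> * (bdot (cvec m) (\<tau> *v cvec m) + 2 * bdot (cvec m) z)) * riemann_theta \<tau> z"
proof -
  define c where "c = exp (- of_real pi * \<i> * (bdot (cvec m) (\<tau> *v cvec m) + 2 * bdot (cvec m) z))"
  have t: "theta_term \<tau> (z + \<tau> *v cvec m) n = c * theta_term \<tau> z (n + m)" for n
    using siegel_H2_bdot[OF assms, of "cvec m" "cvec n"]
    by (simp add: theta_term_def c_def cvec_add bdot_simps matrix_vector_right_distrib algebra_simps flip: exp_add)
  have "riemann_theta \<tau> (z + \<tau> *v cvec m) = infsum (\<lambda>n. c * theta_term \<tau> z (n + m)) UNIV"
    unfolding riemann_theta_eq t ..
  also have "\<dots> = infsum (\<lambda>n. c * theta_term \<tau> z n) UNIV"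
    by (rule infsum_reindex_bij_witness[of _ "\<lambda>n. n - m" "\<lambda>n. n + m"]) auto
  also have "\<dots> = c * riemann_theta \<tau> z"
    unfolding riemann_theta_eq by (rule infsum_cmult_right) (use theta_term_summable_on[OF assms] in auto)
  finally show ?thesis unfolding c_def .
qed

lemma matrix_vector_mult_minus: "A *v (- v) = - (A *v v)" for A :: "complex^2^2"
  by (simp add: vec_eq_iff forall_2 matrix_vector_mult_def sum_2)

lemma riemann_theta_even: "riemann_theta \<tau> (- z) = riemann_theta \<tau> z"
proof -
  have "theta_term \<tau> (- z) (- n) = theta_term \<tau> z n" for n
    by (simp add: theta_term_def cvec_minus bdot_simps matrix_vector_mult_minus)
  then show ?thesis
    unfolding riemann_theta_eq
    by (intro infsum_reindex_bij_witness[of _ uminus uminus]) (auto, metis minus_minus)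
qed

text \<open>Model of (Z/2)^2: \<open>xor2\<close> is its addition, \<open>chi\<close> its duality
  pairing and \<open>iv\<close> the lift to {0,1}^2. Sums over UNIV are thus finite Fourier
  sums.\<close>

type_synonym f2 = "bool \<times> bool"

definition iv :: "f2 \<Rightarrow> int^2" where
  "iv y = vector [of_bool (fst y), of_bool (snd y)]"

definition chi :: "f2 \<Rightarrow> f2 \<Rightarrow> complex" where
  "chi x y = (if fst x \<and> fst y then -1 else 1) * (if snd x \<and> snd y then -1 else 1)"

definition xor2 :: "f2 \<Rightarrow> f2 \<Rightarrow> f2" where
  "xor2 x y = (fst x \<noteq> fst y, snd x \<noteq> snd y)"

definition half_theta :: "complex^2^2 \<Rightarrow> f2 \<Rightarrow> complex^2 \<Rightarrow> complex" where
  "half_theta \<tau> y z = riemann_theta \<tau> (z + (1/2) *s cvec (iv y))"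

text \<open>The sum below is, up to normalisation of the characteristic, the theta function of \<open>2\<tau>\<close> with
  characteristic \<open>(x, d)\<close> at \<open>2u\<close>.\<close>

definition quarter_term :: "complex^2^2 \<Rightarrow> f2 \<Rightarrow> f2 \<Rightarrow> complex^2 \<Rightarrow> int^2 \<Rightarrow> complex" where
  "quarter_term \<tau> x d u k = (let v = cvec (2 *s k + iv x)
     in exp (2 * of_real pi * \<i> * (bdot v (\<tau> *v v) / 4 + bdot v (u + (1/4) *s cvec (iv d)))))"

definition quarter_theta :: "complex^2^2 \<Rightarrow> f2 \<Rightarrow> f2 \<Rightarrow> complex^2 \<Rightarrow> complex" where
  "quarter_theta \<tau> x d u = infsum (quarter_term \<tau> x d u) UNIV"

lemma siegel_H2_add:
  assumes "\<sigma> \<in> siegel_H2" "\<tau> \<in> siegel_H2"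
  shows "\<sigma> + \<tau> \<in> siegel_H2"
proof -
  have "(\<chi> i j. Im ((\<sigma> + \<tau>) $ i $ j)) = (\<chi> i j. Im (\<sigma> $ i $ j)) + (\<chi> i j. Im (\<tau> $ i $ j))"
    by (simp add: vec_eq_iff)
  moreover have "transpose (\<sigma> + \<tau>) = transpose \<sigma> + transpose \<tau>"
    by (simp add: transpose_def vec_eq_iff)
  ultimately show ?thesis using assms
    by (auto simp: siegel_H2_def matrix_vector_mult_add_rdistrib inner_add_right intro!: add_pos_pos)
qed

lemma siegel_H2_nth: "\<tau> \<in> siegel_H2 \<Longrightarrow> \<tau> $ 2 $ 1 = \<tau> $ 1 $ 2"
  using arg_cong[OF siegel_H2_sym, of \<tau> "\<lambda>A. A $ 1 $ 2"] by (simp add: transpose_def)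

lemma matrix_vector_mult_scale: "A *v (c *s v) = c *s (A *v v)" for A :: "complex^2^2"
  by (simp add: vec_eq_iff forall_2 matrix_vector_mult_def sum_2 algebra_simps)

lemma matrix_vector_mult_diff: "A *v (u - v) = A *v u - A *v v" for A :: "complex^2^2"
  by (simp add: vec_eq_iff forall_2 matrix_vector_mult_def sum_2 algebra_simps)

lemmas bilinear_simps = bdot_simps cvec_add cvec_diff cvec_minus cvec_scale
  matrix_vector_right_distrib matrix_vector_mult_scale matrix_vector_mult_diff
  matrix_vector_mult_minus matrix_vector_mult_add_rdistrib

text \<open>Turns the characteristic (x, d) into a shift of the argument of the theta series of 2
  tau, from which convergence and \<open>entire2\<close> are inherited.\<close>

lemma quarter_term_eq:
  assumes "\<tau> \<in> siegel_H2"
  shows "quarter_term \<tau> x d u k =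
    exp (2 * of_real pi * \<i> * (bdot (cvec (iv x)) (\<tau> *v cvec (iv x)) / 4 + bdot (cvec (iv x)) ((1/4) *s cvec (iv d))))
    * (theta_term (\<tau> + \<tau>) ((1/2) *s cvec (iv d) + \<tau> *v cvec (iv x)) k
       * exp (bdot ((2 * of_real pi * \<i>) *s (2 *s cvec k + cvec (iv x))) u))"
  unfolding quarter_term_def theta_term_def Let_def exp_add[symmetric]
  by (rule arg_cong[where f = exp])
     (simp only: bilinear_simps siegel_H2_bdot[OF assms, of "cvec (iv x)" "cvec k"],
      simp add: algebra_simps add_divide_distrib)

lemma quarter_theta_eq:
  assumes "\<tau> \<in> siegel_H2"
  shows "quarter_theta \<tau> x d u =
    exp (2 * of_real pi * \<i> * (bdot (cvec (iv x)) (\<tau> *v cvec (iv x)) / 4 + bdot (cvec (iv x)) ((1/4) *s cvec (iv d))))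
    * infsum (\<lambda>k. theta_term (\<tau> + \<tau>) ((1/2) *s cvec (iv d) + \<tau> *v cvec (iv x)) k
       * exp (bdot ((2 * of_real pi * \<i>) *s (2 *s cvec k + cvec (iv x))) u)) UNIV"
  unfolding quarter_theta_def quarter_term_eq[OF assms]
  by (rule infsum_cmult_right') 

lemma quarter_term_abs_summable:
  assumes "\<tau> \<in> siegel_H2"
  shows "(\<lambda>k. norm (quarter_term \<tau> x d u k)) summable_on UNIV"
proof -
  have "rapid (\<lambda>k. theta_term (\<tau> + \<tau>) ((1/2) *s cvec (iv d) + \<tau> *v cvec (iv x)) k
       * exp (bdot ((2 * of_real pi * \<i>) *s (2 *s cvec k + cvec (iv x))) u)) (\<lambda>k. (2 * of_real pi * \<i>) *s (2 *s cvec k + cvec (iv x)))"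
    by (intro rapid_exp_bdot theta_rapid siegel_H2_add assms)
  from rapid_norm_summable[OF this] show ?thesis
    unfolding quarter_term_eq[OF assms] norm_mult[of "exp (2 * of_real pi * \<i> * _)"]
    by (intro summable_on_cmult_right) simp
qed

lemma entire2_half_theta: "\<tau> \<in> siegel_H2 \<Longrightarrow> entire2 (half_theta \<tau> y)"
  using entire2_riemann_theta[of \<tau> 1 "(1/2) *s cvec (iv y)"] unfolding half_theta_def[abs_def] by (simp add: vector_scalar_mult_def)

lemma entire2_quarter_theta:
  assumes "\<tau> \<in> siegel_H2"
  shows "entire2 (quarter_theta \<tau> x d)"
proof -
  have "entire2 (\<lambda>u. quarter_theta \<tau> x d u)"
    unfolding quarter_theta_eq[OF assms]
    by (intro entire2_cmult entire2_series theta_rapid siegel_H2_add assms)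
  then show ?thesis .
qed

lemma has_sum_product_abs:
  fixes a b :: "'i \<Rightarrow> complex"
  assumes a: "(\<lambda>n. norm (a n)) summable_on UNIV" and b: "(\<lambda>n. norm (b n)) summable_on UNIV"
  shows "((\<lambda>(n, m). a n * b m) has_sum (infsum a UNIV * infsum b UNIV)) UNIV"
proof -
  have "(\<lambda>(n, m). norm (a n) * norm (b m)) summable_on UNIV \<times> UNIV"
  proof (rule summable_on_SigmaI[where g = "\<lambda>n. norm (a n) * infsum (\<lambda>m. norm (b m)) UNIV"])
    show "((\<lambda>m. case (n, m) of (n, m) \<Rightarrow> norm (a n) * norm (b m)) has_sum norm (a n) * infsum (\<lambda>m. norm (b m)) UNIV) UNIV" for n
      using has_sum_cmult_right[OF has_sum_infsum[OF b], of "norm (a n)"] by simp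
    show "(\<lambda>n. norm (a n) * infsum (\<lambda>m. norm (b m)) UNIV) summable_on UNIV"
      by (rule summable_on_cmult_left[OF a])
  qed auto
  then have "(\<lambda>p. norm (case p of (n, m) \<Rightarrow> a n * b m)) summable_on UNIV \<times> UNIV"
    unfolding case_prod_unfold norm_mult .
  then have s: "(\<lambda>(n, m). a n * b m) summable_on UNIV \<times> UNIV"
    by (rule abs_summable_summable)
  have "((\<lambda>n. a n * infsum b UNIV) has_sum infsum (\<lambda>(n, m). a n * b m) (UNIV \<times> UNIV)) UNIV"
  proof (rule has_sum_SigmaD[OF has_sum_infsum[OF s]])
    show "((\<lambda>m. case (n, m) of (n, m) \<Rightarrow> a n * b m) has_sum a n * infsum b UNIV) UNIV" for n
      using has_sum_cmult_right[OF has_sum_infsum[OF abs_summable_summable[OF b]], of "a n"] by simp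
  qed
  moreover have "((\<lambda>n. a n * infsum b UNIV) has_sum (infsum a UNIV * infsum b UNIV)) UNIV"
    by (rule has_sum_cmult_left[OF has_sum_infsum[OF abs_summable_summable[OF a]]])
  ultimately have "infsum (\<lambda>(n, m). a n * b m) (UNIV \<times> UNIV) = infsum a UNIV * infsum b UNIV"
    by (rule has_sum_unique)
  then show ?thesis using has_sum_infsum[OF s] by simp
qed

lemma chi_eq_exp: "chi x y = exp (of_real pi * \<i> * bdot (cvec (iv x)) (cvec (iv y)))"
  unfolding bdot_cvec exp_pi_int by (auto simp: chi_def iv_def)

text \<open>The carries in the integer sum of y and d are even; halved they are integral periods of
  theta.\<close>

lemma half_theta_xor2:
  "half_theta \<tau> (xor2 y d) z = riemann_theta \<tau> (z + (1/2) *s cvec (iv y + iv d))"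
proof -
  define m :: "int^2" where "m = vector [of_bool (fst y \<and> fst d), of_bool (snd y \<and> snd d)]"
  have "iv y + iv d = iv (xor2 y d) + 2 *s m"
    by (auto simp: iv_def xor2_def m_def vec_eq_iff forall_2)
  then have "z + (1/2) *s cvec (iv y + iv d) = (z + (1/2) *s cvec (iv (xor2 y d))) + cvec m"
    by (simp add: vec_eq_iff field_simps)
  then show ?thesis unfolding half_theta_def by (simp only: riemann_theta_periodic)
qed

definition par2 :: "int^2 \<Rightarrow> f2" where
  "par2 n = (odd (n $ 1), odd (n $ 2))"

lemma par2_decomp: "2 *s (\<chi> i. n $ i div 2) + iv (par2 n) = n"
  by (auto simp: vec_eq_iff forall_2 iv_def par2_def elim!: oddE)

lemma par2_unique: "par2 (2 *s k + iv x) = x" "(\<chi> i. (2 *s k + iv x) $ i div 2) = k"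
  by (auto simp: par2_def iv_def vec_eq_iff forall_2 prod_eq_iff)

text \<open>The substitution n = k - l, m = k + l + x separates the variables: n + m = 2k + x and m
  - n = 2l + x, so that Q(n) + Q(m) = 2 Q(k + x/2) + 2 Q(l + x/2). The characteristic y contributes
  (k + x/2).y, that is, \<open>chi x y\<close> and an integral multiple j = k.y of 2 pi i.\<close>

lemma theta_addition_term:
  assumes "\<tau> \<in> siegel_H2"
  shows "theta_term \<tau> (u + v + (1/2) *s cvec (iv y)) (k - l) *
      theta_term \<tau> (u - v + (1/2) *s cvec (iv y + iv d)) (k + l + iv x)
    = chi x y * (quarter_term \<tau> x d u k * quarter_term \<tau> x d (- v) l)"
proof -
  define j where "j = k $ 1 * iv y $ 1 + k $ 2 * iv y $ 2"
  have j: "of_int j = bdot (cvec k) (cvec (iv y))"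
    by (simp add: j_def bdot_2)
  have "theta_term \<tau> (u + v + (1/2) *s cvec (iv y)) (k - l) *
      theta_term \<tau> (u - v + (1/2) *s cvec (iv y + iv d)) (k + l + iv x)
    = chi x y * (quarter_term \<tau> x d u k * quarter_term \<tau> x d (- v) l) * exp (2 * of_real pi * \<i> * of_int j)"
    unfolding quarter_term_def theta_term_def Let_def chi_eq_exp exp_add[symmetric]
    by (rule arg_cong[where f = exp])
       (simp add: bilinear_simps j siegel_H2_bdot[OF assms, of "cvec l" "cvec k"]
          siegel_H2_bdot[OF assms, of "cvec (iv x)" "cvec k"] siegel_H2_bdot[OF assms, of "cvec (iv x)" "cvec l"]
          algebra_simps add_divide_distrib)
  then show ?thesis unfolding exp_2pi_int by simp
qed

theorem theta_addition:
  assumes "\<tau> \<in> siegel_H2"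
  shows "half_theta \<tau> y (u + v) * half_theta \<tau> (xor2 y d) (u - v)
    = (\<Sum>x\<in>UNIV. chi x y * (quarter_theta \<tau> x d u * quarter_theta \<tau> x d (- v)))"
proof -
  let ?f = "\<lambda>(n, m). theta_term \<tau> (u + v + (1/2) *s cvec (iv y)) n * theta_term \<tau> (u - v + (1/2) *s cvec (iv y + iv d)) m"
  have 1: "(?f has_sum (half_theta \<tau> y (u + v) * half_theta \<tau> (xor2 y d) (u - v))) UNIV"
    unfolding half_theta_xor2 unfolding half_theta_def riemann_theta_eq
    by (intro has_sum_product_abs theta_term_abs_summable assms)
  \<comment> \<open>The pairs (n, m) are sorted by the class x of n + m modulo 2; on each class k
    and l range freely.\<close>
  define P where "P x = {(n, m). par2 (n + m) = x}" for x
  have 2: "(?f has_sum (chi x y * (quarter_theta \<tau> x d u * quarter_theta \<tau> x d (- v)))) (P x)" for x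
  proof -
    have "((\<lambda>p. chi x y * (case p of (k, l) \<Rightarrow> quarter_term \<tau> x d u k * quarter_term \<tau> x d (- v) l))
        has_sum (chi x y * (quarter_theta \<tau> x d u * quarter_theta \<tau> x d (- v)))) UNIV"
      unfolding quarter_theta_def
      by (intro has_sum_cmult_right has_sum_product_abs quarter_term_abs_summable assms)
    also have "?this \<longleftrightarrow> ?thesis"
    proof (rule has_sum_reindex_bij_witness[of _ "\<lambda>(n, m). ((\<chi> i. (n + m) $ i div 2), (\<chi> i. (n + m) $ i div 2) - n)"
          "\<lambda>(k, l). (k - l, k + l + iv x)"])
      have e: "k - l + (k + l + iv x) = 2 *s k + iv x" for k l
        by (simp add: vec_eq_iff)
      show "(case (case a of (k, l) \<Rightarrow> (k - l, k + l + iv x)) of (n, m) \<Rightarrow> ((\<chi> i. (n + m) $ i div 2), (\<chi> i. (n + m) $ i div 2) - n)) = a" for a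
        by (cases a) (simp only: prod.case e par2_unique, simp)
      show "(case a of (k, l) \<Rightarrow> (k - l, k + l + iv x)) \<in> P x" for a
        by (cases a) (simp only: P_def mem_Collect_eq prod.case e par2_unique)
      fix b assume "b \<in> P x"
      then obtain n m where b: "b = (n, m)" "par2 (n + m) = x" by (auto simp: P_def)
      show "(case (case b of (n, m) \<Rightarrow> ((\<chi> i. (n + m) $ i div 2), (\<chi> i. (n + m) $ i div 2) - n)) of (k, l) \<Rightarrow> (k - l, k + l + iv x)) = b"
      proof -
        have "2 *s (\<chi> i. (n + m) $ i div 2) + iv x = n + m"
          using par2_decomp[of "n + m"] b by simp
        then show ?thesis unfolding b by (simp add: vec_eq_iff algebra_simps)
      qed
    next
      show "(case (case a of (k, l) \<Rightarrow> (k - l, k + l + iv x)) of (n, m) \<Rightarrow> theta_term \<tau> (u + v + (1/2) *s cvec (iv y)) n * theta_term \<tau> (u - v + (1/2) *s cvec (iv y + iv d)) m)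
         = chi x y * (case a of (k, l) \<Rightarrow> quarter_term \<tau> x d u k * quarter_term \<tau> x d (- v) l)" for a
        by (cases a) (simp only: prod.case theta_addition_term[OF assms])
    qed auto
    finally show ?thesis .
  qed
  have "(?f has_sum (\<Sum>x\<in>UNIV. chi x y * (quarter_theta \<tau> x d u * quarter_theta \<tau> x d (- v)))) (\<Union>x\<in>UNIV. P x)"
    by (rule sum_has_sum) (use 2 in \<open>auto simp: P_def\<close>)
  also have "(\<Union>x\<in>UNIV. P x) = UNIV" by (auto simp: P_def)
  finally show ?thesis using 1 has_sum_unique by blast
qed

text \<open>Replacing k by -k - x negates 2k + x; the shift by d/4 is not negated with it and leaves
  the sign (-1)^(x.d).\<close>

lemma quarter_theta_parity:
  assumes "\<tau> \<in> siegel_H2"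
  shows "quarter_theta \<tau> x d (- u) = chi x d * quarter_theta \<tau> x d u"
proof -
  have t: "quarter_term \<tau> x d (- u) (- k - iv x) = chi x d * quarter_term \<tau> x d u k" for k
  proof -
    define j where "j = - ((k $ 1 + iv x $ 1) * iv d $ 1 + (k $ 2 + iv x $ 2) * iv d $ 2)"
    have j: "of_int j = - bdot (cvec k) (cvec (iv d)) - bdot (cvec (iv x)) (cvec (iv d))"
      by (simp add: j_def bdot_2 algebra_simps)
    have "quarter_term \<tau> x d (- u) (- k - iv x) = chi x d * quarter_term \<tau> x d u k * exp (2 * of_real pi * \<i> * of_int j)"
      unfolding quarter_term_def Let_def chi_eq_exp exp_add[symmetric]
      by (rule arg_cong[where f = exp])
         (simp add: bilinear_simps j siegel_H2_bdot[OF assms, of "cvec (iv x)" "cvec k"]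
            algebra_simps add_divide_distrib)
    then show ?thesis unfolding exp_2pi_int by simp
  qed
  have "quarter_theta \<tau> x d (- u) = infsum (\<lambda>k. chi x d * quarter_term \<tau> x d u k) UNIV"
    unfolding quarter_theta_def
    by (rule infsum_reindex_bij_witness[of _ "\<lambda>k. - k - iv x" "\<lambda>k. - k - iv x"])
       (auto simp flip: t)
  also have "\<dots> = chi x d * quarter_theta \<tau> x d u"
    unfolding quarter_theta_def by (rule infsum_cmult_right')
  finally show ?thesis .
qed

section \<open>Nonvanishing\<close>

text \<open>Summing the addition formula with d = 0 over y leaves only x = 0, by orthogonality of
  characters. This links the zeros of theta for tau and for 2 tau.\<close>

lemma theta_addition_sum:
  assumes "\<tau> \<in> siegel_H2"
  shows "(\<Sum>y\<in>UNIV. half_theta \<tau> y (u + v) * half_theta \<tau> y (u - v))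
    = 4 * (riemann_theta (\<tau> + \<tau>) (2 *s u) * riemann_theta (\<tau> + \<tau>) (- (2 *s v)))"
proof -
  have q: "quarter_theta \<tau> (False, False) (False, False) w = riemann_theta (\<tau> + \<tau>) (2 *s w)" for w
  proof -
    have iv0: "iv (False, False) = 0" by (simp add: iv_def vec_eq_iff forall_2)
    have "theta_term (\<tau> + \<tau>) 0 k * exp (bdot ((2 * of_real pi * \<i>) *s (2 *s cvec k)) w)
        = theta_term (\<tau> + \<tau>) (2 *s w) k" for k
      using theta_term_add[of "\<tau> + \<tau>" 0 "2 *s w" k] by (simp add: bdot_simps mult.assoc)
    then show ?thesis
      unfolding quarter_theta_eq[OF assms] iv0 riemann_theta_eq
      by (simp add: bdot_2 cong: infsum_cong)
  qed
  have x: "xor2 y (False, False) = y" for y by (simp add: xor2_def)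
  have "(\<Sum>y\<in>UNIV. half_theta \<tau> y (u + v) * half_theta \<tau> y (u - v))
     = (\<Sum>y\<in>UNIV. \<Sum>x\<in>UNIV. chi x y * (quarter_theta \<tau> x (False, False) u * quarter_theta \<tau> x (False, False) (- v)))"
    using theta_addition[OF assms, where d = "(False, False)"] by (simp add: x)
  also have "\<dots> = 4 * (quarter_theta \<tau> (False, False) (False, False) u * quarter_theta \<tau> (False, False) (False, False) (- v))"
    by (simp add: UNIV_Times_UNIV[symmetric] UNIV_bool sum.cartesian_product[symmetric] chi_def del: UNIV_Times_UNIV)
  finally show ?thesis by (simp add: q)
qed

lemma theta_term_double: "theta_term (\<tau> + \<tau>) 0 n = (theta_term \<tau> 0 n)\<^sup>2"
proof -
  have "theta_term (\<tau> + \<tau>) 0 n = theta_term \<tau> 0 n * theta_term \<tau> 0 n"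
    unfolding theta_term_def exp_add[symmetric] bilinear_simps by (simp add: bdot_2 algebra_simps)
  then show ?thesis by (simp add: power2_eq_square)
qed

text \<open>If theta vanished identically for tau, it would do so for every 2^k tau. But the terms
  at z = 0 are then raised to the power 2^k: the term n = 0 stays 1 and the others, of modulus at
  most rho < 1, become too small in total to cancel it.\<close>

lemma riemann_theta_not_zero:
  assumes "\<tau> \<in> siegel_H2"
  obtains z where "riemann_theta \<tau> z \<noteq> 0"
proof (rule ccontr)
  assume "\<not> thesis"
  then have z0: "riemann_theta \<tau> z = 0" for z using that by blast
  define \<sigma> where "\<sigma> k = ((\<lambda>\<sigma>. \<sigma> + \<sigma>) ^^ k) \<tau>" for k
  have \<sigma>: "\<sigma> k \<in> siegel_H2 \<and> (\<forall>z. riemann_theta (\<sigma> k) z = 0)" for k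
  proof (induction k)
    case 0
    then show ?case using assms z0 by (simp add: \<sigma>_def)
  next
    case (Suc k)
    have S: "\<sigma> (Suc k) = \<sigma> k + \<sigma> k" by (simp add: \<sigma>_def)
    \<comment> \<open>With u = z/2 and v = -z/2 the right-hand side of the formula is four times the
      square of this value.\<close>
    have "riemann_theta (\<sigma> k + \<sigma> k) z = 0" for z
      using theta_addition_sum[of "\<sigma> k" "(1/2) *s z" "- ((1/2) *s z)"] Suc by (simp add: half_theta_def)
    then show ?case unfolding S using siegel_H2_add[of "\<sigma> k" "\<sigma> k"] Suc by blast
  qed
  have t: "theta_term (\<sigma> k) 0 n = theta_term \<tau> 0 n ^ (2 ^ k)" for k n
  proof (induction k)
    case (Suc k)
    have "\<sigma> (Suc k) = \<sigma> k + \<sigma> k" by (simp add: \<sigma>_def)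
    then show ?case using theta_term_double[of "\<sigma> k" n] Suc by (simp add: power_mult[symmetric] mult.commute)
  qed (simp add: \<sigma>_def)
  obtain c where c: "c > 0"
    "\<And>v :: real^2. v \<bullet> ((\<chi> i j. Im (\<tau> $ i $ j)) *v v) \<ge> c * ((v $ 1)\<^sup>2 + (v $ 2)\<^sup>2)"
    using siegel_H2_coercive[OF assms] by blast
  define \<rho> where "\<rho> = exp (- pi * c)"
  have \<rho>: "0 < \<rho>" "\<rho> < 1" using c by (simp_all add: \<rho>_def)
  have \<rho>t: "norm (theta_term \<tau> 0 n) \<le> \<rho>" if "n \<noteq> 0" for n
  proof -
    have "1 \<le> (n $ 1)\<^sup>2 + (n $ 2)\<^sup>2"
    proof -
      have "n $ 1 \<noteq> 0 \<or> n $ 2 \<noteq> 0" using that by (auto simp: vec_eq_iff forall_2)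
      then have "0 < (n $ 1)\<^sup>2 + (n $ 2)\<^sup>2" by (rule sum_power2_gt_zero_iff[THEN iffD2])
      then show ?thesis by simp
    qed
    then have "(1::real) \<le> of_int ((n $ 1)\<^sup>2 + (n $ 2)\<^sup>2)" by (simp only: of_int_1_le_iff)
    then have "c * 1 \<le> c * ((of_int (n $ 1))\<^sup>2 + (of_int (n $ 2))\<^sup>2)"
      using c(1) by (intro mult_left_mono) auto
    also have "\<dots> \<le> (\<chi> i. of_int (n $ i)) \<bullet> ((\<chi> i j. Im (\<tau> $ i $ j)) *v (\<chi> i. of_int (n $ i)))"
      using c(2)[of "\<chi> i. of_int (n $ i)"] by simp
    finally show ?thesis unfolding norm_theta_term \<rho>_def by (simp add: mult_left_mono)
  qed
  define S where "S = infsum (\<lambda>n. norm (theta_term \<tau> 0 n)) (UNIV - {0})"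
  have bound: "1 \<le> \<rho> ^ (2 ^ k - 1) * S" for k
  proof -
    have s: "theta_term (\<sigma> k) 0 summable_on UNIV" using \<sigma> theta_term_summable_on by blast
    have "infsum (theta_term (\<sigma> k) 0) UNIV = 0" using \<sigma>[of k] by (simp add: riemann_theta_eq)
    moreover have "infsum (theta_term (\<sigma> k) 0) UNIV = theta_term (\<sigma> k) 0 0 + infsum (theta_term (\<sigma> k) 0) (UNIV - {0})"
    proof -
      have "theta_term (\<sigma> k) 0 summable_on (UNIV - {0})"
        by (rule summable_on_subset[OF s]) auto
      then show ?thesis
        using infsum_insert[of "theta_term (\<sigma> k) 0" "UNIV - {0}" 0] by (simp add: insert_Diff_single insert_UNIV)
    qed
    moreover have "theta_term (\<sigma> k) 0 0 = 1" by (simp add: theta_term_def bdot_2)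
    ultimately have "infsum (theta_term (\<sigma> k) 0) (UNIV - {0}) = - 1"
      by (simp add: eq_neg_iff_add_eq_0 add.commute)
    then have "1 = norm (infsum (theta_term (\<sigma> k) 0) (UNIV - {0}))" by simp
    also have "\<dots> \<le> \<rho> ^ (2 ^ k - 1) * S"
    proof (rule norm_infsum_le)
      show "(theta_term (\<sigma> k) 0 has_sum infsum (theta_term (\<sigma> k) 0) (UNIV - {0})) (UNIV - {0})"
        by (rule has_sum_infsum[OF summable_on_subset[OF s]]) auto
      show "((\<lambda>n. \<rho> ^ (2 ^ k - 1) * norm (theta_term \<tau> 0 n)) has_sum \<rho> ^ (2 ^ k - 1) * S) (UNIV - {0})"
        unfolding S_def
        by (intro has_sum_cmult_right has_sum_infsum summable_on_subset[OF theta_term_abs_summable[OF assms]]) auto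
      fix n :: "int^2" assume "n \<in> UNIV - {0}"
      then have "norm (theta_term \<tau> 0 n) ^ (2 ^ k - 1) \<le> \<rho> ^ (2 ^ k - 1)"
        by (intro power_mono \<rho>t) auto
      then have "norm (theta_term \<tau> 0 n) ^ (2 ^ k - 1) * norm (theta_term \<tau> 0 n) \<le> \<rho> ^ (2 ^ k - 1) * norm (theta_term \<tau> 0 n)"
        by (rule mult_right_mono) simp
      moreover have "norm (theta_term \<tau> 0 n) ^ (2 ^ k - 1) * norm (theta_term \<tau> 0 n) = norm (theta_term \<tau> 0 n) ^ (2 ^ k)"
        by (simp flip: power_Suc2)
      ultimately show "norm (theta_term (\<sigma> k) 0 n) \<le> \<rho> ^ (2 ^ k - 1) * norm (theta_term \<tau> 0 n)"
        by (simp add: t norm_power)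
    qed
    finally show ?thesis .
  qed
  have S: "S \<ge> 0" unfolding S_def by (rule infsum_nonneg) simp
  have "1 / (S + 1) > 0" using S by simp
  then obtain j where j: "\<rho> ^ j < 1 / (S + 1)"
    using real_arch_pow_inv[of "1 / (S + 1)" \<rho>] \<rho> by blast
  have "j \<le> 2 ^ j - 1" using less_exp[of j] by linarith
  then have "\<rho> ^ (2 ^ j - 1) \<le> \<rho> ^ j" using \<rho> by (intro power_decreasing) auto
  then have "\<rho> ^ (2 ^ j - 1) * S \<le> \<rho> ^ j * S" using S by (rule mult_right_mono)
  also have "\<dots> \<le> 1 / (S + 1) * S" using j S by (intro mult_right_mono) auto
  also have "\<dots> < 1" using S by (simp add: field_simps)
  finally show False using bound[of j] by simp
qed

lemma entire_mult_eq_0: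
  fixes h k :: "complex \<Rightarrow> complex"
  assumes "h holomorphic_on UNIV" "k holomorphic_on UNIV" "\<And>t. h t * k t = 0" "h a \<noteq> 0"
  shows "k b = 0"
proof -
  have "continuous_on UNIV h" using assms(1) by (rule holomorphic_on_imp_continuous_on)
  then have "isCont h a" by (simp add: continuous_on_eq_continuous_at)
  then obtain e where e: "e > 0" "\<And>t. dist t a < e \<Longrightarrow> h t \<noteq> 0"
    using continuous_at_avoid[of a h 0] assms(4) by (auto simp: dist_commute)
  show ?thesis
  proof (rule analytic_continuation_open[of "ball a e" UNIV k "\<lambda>_. 0"])
    show "k z = 0" if "z \<in> ball a e" for z
      using e(2)[of z] assms(3)[of z] that by (auto simp: dist_commute)
  qed (use e assms in auto)
qed

text \<open>If all g_y vanished at u, the arguments z/2 and u - z/2 in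
  \<open>theta_addition_sum\<close> would give T(z) T(z - 2u) = 0 for all z, where T is theta for 2
  tau. On the line through a point p with T(p) nonzero, in direction 2u, one factor is nonzero near
  p, so the other vanishes on the whole line, which contains p.\<close>

lemma half_theta_no_common_zero:
  assumes "\<tau> \<in> siegel_H2"
  obtains y where "half_theta \<tau> y u \<noteq> 0"
proof (rule ccontr)
  assume "\<not> thesis"
  then have h0: "half_theta \<tau> y u = 0" for y using that by blast
  let ?T = "riemann_theta (\<tau> + \<tau>)"
  have TT: "\<tau> + \<tau> \<in> siegel_H2" using siegel_H2_add assms by blast
  obtain p where p: "?T p \<noteq> 0" using riemann_theta_not_zero[OF TT] by blast
  have prod: "?T z * ?T (z - 2 *s u) = 0" for z
  proof -
    have "u = (1/2) *s z + (u - (1/2) *s z)" by simp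
    then have "(\<Sum>y\<in>UNIV. half_theta \<tau> y ((1/2) *s z + (u - (1/2) *s z)) * half_theta \<tau> y ((1/2) *s z - (u - (1/2) *s z))) = 0"
      using h0 by simp
    then have "?T (2 *s ((1/2) *s z)) * ?T (- (2 *s (u - (1/2) *s z))) = 0"
      unfolding theta_addition_sum[OF assms] by simp
    moreover have "2 *s ((1/2) *s z) = z" "- (2 *s (u - (1/2) *s z)) = z - 2 *s u"
      by (simp_all add: vec_eq_iff)
    ultimately show ?thesis by simp
  qed
  have ent: "entire2 ?T" using entire2_riemann_theta[OF TT, of 1 0] by (simp add: vector_scalar_mult_def)
  have "?T (p - 2 *s u + 1 *s (2 *s u)) = 0"
  proof (rule entire_mult_eq_0[of "\<lambda>t. ?T (p + t *s (2 *s u))" "\<lambda>t. ?T (p - 2 *s u + t *s (2 *s u))" 0])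
    show "(\<lambda>t. ?T (p + t *s (2 *s u))) holomorphic_on UNIV" "(\<lambda>t. ?T (p - 2 *s u + t *s (2 *s u))) holomorphic_on UNIV"
      by (rule entire2_holomorphic[OF ent])+
    show "?T (p + t *s (2 *s u)) * ?T (p - 2 *s u + t *s (2 *s u)) = 0" for t
      using prod[of "p + t *s (2 *s u)"] by (simp add: algebra_simps)
  qed (use p in simp)
  then show False using p by (simp add: vector_scalar_mult_def)
qed

section \<open>Growth\<close>

lemma Re_of_real_times: "Re (of_real r * z) = r * Re z"
  by simp

definition rvec :: "real^2 \<Rightarrow> complex^2" where
  "rvec x = (\<chi> i. of_real (x $ i))"

definition imq :: "complex^2^2 \<Rightarrow> real^2 \<Rightarrow> real" where
  "imq \<tau> v = v \<bullet> ((\<chi> i j. Im (\<tau> $ i $ j)) *v v)"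

lemma rvec_component [simp]: "rvec x $ i = of_real (x $ i)"
  by (simp add: rvec_def)

lemma imq_2:
  assumes "\<tau> \<in> siegel_H2"
  shows "imq \<tau> v = Im (\<tau> $ 1 $ 1) * (v $ 1)\<^sup>2 + 2 * Im (\<tau> $ 1 $ 2) * v $ 1 * v $ 2 + Im (\<tau> $ 2 $ 2) * (v $ 2)\<^sup>2"
  by (simp add: imq_def inner_vec_def matrix_vector_mult_def sum_2 siegel_H2_nth[OF assms] power2_eq_square algebra_simps)

lemma imq_pos: "\<tau> \<in> siegel_H2 \<Longrightarrow> v \<noteq> 0 \<Longrightarrow> imq \<tau> v > 0"
  by (simp add: siegel_H2_def imq_def)

text \<open>In the real coordinates z = x + tau n this weighted modulus is a function on the torus;
  the shift y/2 only adds a phase to the quasi-period.\<close>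

lemma half_theta_norm_periodic:
  fixes m k :: "int^2" and x n :: "real^2"
  assumes "\<tau> \<in> siegel_H2"
  defines "x' \<equiv> x + (\<chi> i. of_int (m $ i))" and "n' \<equiv> n + (\<chi> i. of_int (k $ i))"
  shows "norm (half_theta \<tau> y (rvec x' + \<tau> *v rvec n')) * exp (- pi * imq \<tau> n')
    = norm (half_theta \<tau> y (rvec x + \<tau> *v rvec n)) * exp (- pi * imq \<tau> n)"
proof -
  define z where "z = rvec x + \<tau> *v rvec n + (1/2) *s cvec (iv y)"
  have e: "rvec x' + \<tau> *v rvec n' + (1/2) *s cvec (iv y) = (z + \<tau> *v cvec k) + cvec m"
  proof -
    have "rvec x' = rvec x + cvec m" "rvec n' = rvec n + cvec k"
      by (simp_all add: vec_eq_iff x'_def n'_def)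
    then show ?thesis by (simp add: z_def matrix_vector_right_distrib)
  qed
  have "norm (half_theta \<tau> y (rvec x' + \<tau> *v rvec n'))
      = norm (exp (- of_real pi * \<i> * (bdot (cvec k) (\<tau> *v cvec k) + 2 * bdot (cvec k) z))) * norm (riemann_theta \<tau> z)"
    unfolding half_theta_def e riemann_theta_periodic riemann_theta_quasi_periodic[OF assms(1)] norm_mult ..
  also have "norm (exp (- of_real pi * \<i> * (bdot (cvec k) (\<tau> *v cvec k) + 2 * bdot (cvec k) z)))
      = exp (pi * imq \<tau> n' - pi * imq \<tau> n)"
    unfolding norm_exp_eq_Re
    by (rule arg_cong[where f = exp])
       (simp add: imq_2[OF assms(1)] bdot_2 matrix_vector_mult_def sum_2 siegel_H2_nth[OF assms(1)] z_def n'_def power2_eq_square algebra_simps)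
  finally show ?thesis
    unfolding half_theta_def z_def by (simp add: exp_diff exp_minus field_simps)
qed

lemma continuous_on_imq: "continuous_on S (imq \<tau>)"
  unfolding imq_def by (intro continuous_intros matrix_vector_mult_linear_continuous_on)

lemma continuous_on_vec_2:
  fixes f :: "'a::topological_space \<Rightarrow> 'b::real_normed_vector^2"
  assumes "continuous_on S (\<lambda>x. f x $ 1)" "continuous_on S (\<lambda>x. f x $ 2)"
  shows "continuous_on S f"
proof -
  have "continuous_on S (\<lambda>x. \<chi> i. f x $ i)"
    by (rule continuous_on_vec_lambda) (use assms exhaust_2 in metis)
  then show ?thesis by simp
qed

text \<open>By periodicity it suffices to look at the unit cube, where the weighted sum is
  continuous and positive because the g_y have no common zero.\<close>

lemma half_theta_lower_bound:
  assumes "\<tau> \<in> siegel_H2"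
  obtains c where "c > 0" "\<And>x n. c * exp (pi * imq \<tau> n) \<le> (\<Sum>y\<in>UNIV. norm (half_theta \<tau> y (rvec x + \<tau> *v rvec n)))"
proof -
  define \<Phi> where "\<Phi> p = (\<Sum>y\<in>UNIV. norm (half_theta \<tau> y (rvec (fst p) + \<tau> *v rvec (snd p))) * exp (- pi * imq \<tau> (snd p)))" for p :: "(real^2) \<times> (real^2)"
  let ?C = "cbox (0::real^2) 1 \<times> cbox (0::real^2) 1"
  have "compact ?C" by (intro compact_Times compact_cbox)
  moreover have "(0, 0) \<in> ?C" by (auto simp: mem_box_cart)
  then have "?C \<noteq> {}" by blast
  moreover have "continuous_on ?C \<Phi>"
  proof -
    have "continuous_on ?C (\<lambda>p. rvec (fst p) + \<tau> *v rvec (snd p) + (1/2) *s cvec (iv y))" for y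
      by (rule continuous_on_vec_2) (auto simp: matrix_vector_mult_def sum_2 intro!: continuous_intros)
    then have "continuous_on ?C (\<lambda>p. half_theta \<tau> y (rvec (fst p) + \<tau> *v rvec (snd p)))" for y
      unfolding half_theta_def
      by (intro continuous_on_compose2[OF continuous_riemann_theta[OF assms], of _ "\<lambda>p. rvec (fst p) + \<tau> *v rvec (snd p) + (1/2) *s cvec (iv y)"]) auto
    moreover have "continuous_on ?C (\<lambda>p. imq \<tau> (snd p))"
      by (rule continuous_on_compose2[OF continuous_on_imq[of UNIV]]) (auto intro!: continuous_intros)
    ultimately show ?thesis
      unfolding \<Phi>_def by (intro continuous_intros) auto
  qed
  ultimately obtain p0 where p0: "\<And>p. p \<in> ?C \<Longrightarrow> \<Phi> p0 \<le> \<Phi> p"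
    using continuous_attains_inf by meson
  show thesis
  proof
    show "\<Phi> p0 > 0"
    proof -
      obtain y where "half_theta \<tau> y (rvec (fst p0) + \<tau> *v rvec (snd p0)) \<noteq> 0"
        using half_theta_no_common_zero[OF assms] by blast
      then show ?thesis
        unfolding \<Phi>_def by (intro sum_pos2[of _ y]) auto
    qed
    fix x n :: "real^2"
    define m k :: "int^2" where "m = (\<chi> i. \<lfloor>x $ i\<rfloor>)" and "k = (\<chi> i. \<lfloor>n $ i\<rfloor>)"
    define x0 n0 where "x0 = x - (\<chi> i. of_int (m $ i))" and "n0 = n - (\<chi> i. of_int (k $ i))"
    have "(x0, n0) \<in> ?C"
      by (simp add: mem_box_cart forall_2 x0_def n0_def m_def k_def) (intro conjI; linarith)
    then have "\<Phi> p0 \<le> \<Phi> (x0, n0)" by (rule p0)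
    also have "\<dots> = \<Phi> (x, n)"
      using half_theta_norm_periodic[OF assms, where x = x0 and n = n0 and m = m and k = k] unfolding \<Phi>_def
      by (intro sum.cong) (auto simp: x0_def n0_def)
    also have "\<dots> = (\<Sum>y\<in>UNIV. norm (half_theta \<tau> y (rvec x + \<tau> *v rvec n))) * exp (- pi * imq \<tau> n)"
      by (simp add: \<Phi>_def sum_distrib_right)
    finally show "\<Phi> p0 * exp (pi * imq \<tau> n) \<le> (\<Sum>y\<in>UNIV. norm (half_theta \<tau> y (rvec x + \<tau> *v rvec n)))"
      by (simp add: exp_minus field_simps)
  qed
qed

lemma siegel_decomposition:
  assumes "\<tau> \<in> siegel_H2"
  obtains x n where "z = rvec x + \<tau> *v rvec n"
proof -
  let ?Y = "(\<chi> i j. Im (\<tau> $ i $ j)) :: real^2^2"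
  have "linear (\<lambda>v. ?Y *v v)" by (rule matrix_vector_mul_linear)
  moreover have "inj (\<lambda>v. ?Y *v v)"
  proof (rule linear_injective_0[THEN iffD2], goal_cases)
    case 2
    show ?case
    proof (intro allI impI)
      fix v assume "?Y *v v = 0"
      then have "imq \<tau> v = 0" by (simp add: imq_def)
      then show "v = 0" using imq_pos[OF assms, of v] by force
    qed
  qed (rule matrix_vector_mul_linear)
  ultimately have "surj (\<lambda>v. ?Y *v v)" by (rule linear_injective_imp_surjective) simp
  then obtain n where n: "?Y *v n = (\<chi> i. Im (z $ i))" by (metis surjD)
  define x where "x = (\<chi> i. Re ((z - \<tau> *v rvec n) $ i))"
  have "Im ((\<tau> *v rvec n) $ i) = Im (z $ i)" for i
    using arg_cong[OF n, of "\<lambda>v. v $ i"] by (simp add: matrix_vector_mult_def sum_2)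
  then have "z = rvec x + \<tau> *v rvec n"
    by (simp add: vec_eq_iff x_def complex_eq_iff)
  then show thesis using that by blast
qed

text \<open>Geometrically: the Kummer map \<open>z \<mapsto> [g\<^sub>y(z)]\<close> is not constant along any line.\<close>

lemma half_theta_not_gaussian:
  assumes "\<tau> \<in> siegel_H2" and g: "\<And>t y. half_theta \<tau> y (t *s w) = f y * exp (p * t\<^sup>2)"
  shows "w = 0"
proof -
  obtain c where c: "c > 0" "\<And>x n. c * exp (pi * imq \<tau> n) \<le> (\<Sum>y\<in>UNIV. norm (half_theta \<tau> y (rvec x + \<tau> *v rvec n)))"
    using half_theta_lower_bound[OF assms(1)] by blast
  \<comment> \<open>Along the real ray r s w the lower bound grows like exp(pi r^2 imq n), whereas
    the hypothesis gives a constant times exp(r^2 Re(p s^2)).\<close>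
  have key: "pi * imq \<tau> n \<le> Re (p * s\<^sup>2)" if s: "s *s w = rvec x + \<tau> *v rvec n" for s x n
  proof (rule ccontr)
    assume "\<not> ?thesis"
    then have d: "pi * imq \<tau> n - Re (p * s\<^sup>2) > 0" by simp
    define F where "F = (\<Sum>y\<in>UNIV. norm (f y))"
    have b: "c * (1 + (pi * imq \<tau> n - Re (p * s\<^sup>2)) * r\<^sup>2) \<le> F" for r :: real
    proof -
      have "rvec (r *\<^sub>R x) + \<tau> *v rvec (r *\<^sub>R n) = of_real r *s (s *s w)"
        unfolding s by (simp add: vec_eq_iff matrix_vector_mult_def sum_2 forall_2 algebra_simps)
      also have "\<dots> = (of_real r * s) *s w" by simp
      finally have e: "rvec (r *\<^sub>R x) + \<tau> *v rvec (r *\<^sub>R n) = (of_real r * s) *s w" .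
      have "c * exp (pi * (r\<^sup>2 * imq \<tau> n)) \<le> (\<Sum>y\<in>UNIV. norm (half_theta \<tau> y ((of_real r * s) *s w)))"
        using c(2)[of "r *\<^sub>R n" "r *\<^sub>R x"] unfolding e
        by (simp add: imq_2[OF assms(1)] power2_eq_square algebra_simps)
      also have "\<dots> = F * exp (r\<^sup>2 * Re (p * s\<^sup>2))"
      proof -
        have "p * (of_real r * s)\<^sup>2 = of_real (r\<^sup>2) * (p * s\<^sup>2)" by (simp add: power_mult_distrib)
        then have "Re (p * (of_real r * s)\<^sup>2) = r\<^sup>2 * Re (p * s\<^sup>2)" by (simp only: Re_of_real_times)
        then show ?thesis unfolding g norm_mult norm_exp_eq_Re F_def sum_distrib_right by (simp only:)
      qed
      finally have "c * exp (pi * (r\<^sup>2 * imq \<tau> n)) / exp (r\<^sup>2 * Re (p * s\<^sup>2)) \<le> F"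
        by (simp only: pos_divide_le_eq exp_gt_zero)
      moreover have "exp (r\<^sup>2 * (pi * imq \<tau> n - Re (p * s\<^sup>2))) = exp (pi * (r\<^sup>2 * imq \<tau> n)) / exp (r\<^sup>2 * Re (p * s\<^sup>2))"
        unfolding exp_diff[symmetric] by (rule arg_cong[where f = exp]) (simp only: right_diff_distrib mult_ac)
      ultimately have "c * exp (r\<^sup>2 * (pi * imq \<tau> n - Re (p * s\<^sup>2))) \<le> F"
        by (simp only: times_divide_eq_right)
      moreover have "c * (1 + (pi * imq \<tau> n - Re (p * s\<^sup>2)) * r\<^sup>2) \<le> c * exp (r\<^sup>2 * (pi * imq \<tau> n - Re (p * s\<^sup>2)))"
        using exp_ge_add_one_self[of "r\<^sup>2 * (pi * imq \<tau> n - Re (p * s\<^sup>2))"] c(1) by (intro mult_left_mono) (auto simp: mult_ac)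
      ultimately show ?thesis by linarith
    qed
    have F: "F \<ge> 0" unfolding F_def by (intro sum_nonneg) auto
    define D where "D = pi * imq \<tau> n - Re (p * s\<^sup>2)"
    have "D > 0" using d by (simp only: D_def)
    \<comment> \<open>At r^2 = F / (c D) the bound \<open>b\<close> reads c + F <= F.\<close>
    have "(sqrt (F / (c * D)))\<^sup>2 = F / (c * D)" using F \<open>D > 0\<close> c(1) by simp
    then have "c * (1 + D * (F / (c * D))) \<le> F"
      using b[of "sqrt (F / (c * D))", folded D_def] by (simp only:)
    moreover have "c * (1 + D * (F / (c * D))) = c + F" using \<open>D > 0\<close> c(1) by (simp add: field_simps)
    ultimately have "c + F \<le> F" by linarith
    then show False using c(1) by simp
  qed
  \<comment> \<open>The values s = 1 and s = i give opposite Re(p s^2), so imq n + imq n' <= 0 and n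
    = n' = 0. Then w and i w both have real coordinates.\<close>
  obtain x n where 1: "1 *s w = rvec x + \<tau> *v rvec n" using siegel_decomposition[OF assms(1)] by blast
  obtain x' n' where 2: "\<i> *s w = rvec x' + \<tau> *v rvec n'" using siegel_decomposition[OF assms(1)] by blast
  have s: "pi * imq \<tau> n + pi * imq \<tau> n' \<le> 0" using key[OF 1] key[OF 2] by simp
  have nn: "imq \<tau> v \<ge> 0" for v using imq_pos[OF assms(1), of v] by (cases "v = 0") (auto simp: imq_def)
  have "imq \<tau> n + imq \<tau> n' \<le> 0" using s by (metis distrib_left mult_pos_pos not_le pi_gt_zero)
  then have "imq \<tau> n = 0" "imq \<tau> n' = 0" using nn[of n] nn[of n'] by linarith+
  then have nz: "n = 0" "n' = 0" using imq_pos[OF assms(1)] by force+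
  have "rvec 0 = 0" by (simp add: vec_eq_iff)
  then have e: "w $ i = of_real (x $ i)" "\<i> * w $ i = of_real (x' $ i)" for i
    using arg_cong[OF 1, of "\<lambda>v. v $ i"] arg_cong[OF 2, of "\<lambda>v. v $ i"] nz by simp_all
  have "w $ i = 0" for i
    using arg_cong[OF e(1), of Im i] arg_cong[OF e(2), of Im i] by (simp add: complex_eq_iff)
  then show ?thesis by (simp add: vec_eq_iff)
qed

section \<open>Binary quadratic forms\<close>

text \<open>The polarised discriminant: \<open>bil q q\<close> is q2^2 - 4 q1 q3, so the isotropic
  vectors are the squares of linear forms. Forms are kept as coefficient vectors so that jets can be
  subtracted and measured in this space.\<close>

definition bil :: "complex^3 \<Rightarrow> complex^3 \<Rightarrow> complex" where
  "bil p q = p $ 2 * q $ 2 - 2 * p $ 1 * q $ 3 - 2 * p $ 3 * q $ 1"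

lemma bil_simps:
  "bil (p + q) r = bil p r + bil q r" "bil r (p + q) = bil r p + bil r q"
  "bil (p - q) r = bil p r - bil q r" "bil r (p - q) = bil r p - bil r q"
  "bil (c *s p) r = c * bil p r" "bil r (c *s p) = c * bil r p"
  "bil (- p) r = - bil p r" "bil r (- p) = - bil r p"
  by (simp_all add: bil_def algebra_simps)

lemma bil_commute: "bil p q = bil q p"
  by (simp add: bil_def algebra_simps)

definition pull :: "complex^2^2 \<Rightarrow> complex^3 \<Rightarrow> complex^3" where
  "pull M q = vector
     [qform q (vector [M $ 1 $ 1, M $ 2 $ 1]),
      2 * q $ 1 * M $ 1 $ 1 * M $ 1 $ 2 + q $ 2 * (M $ 1 $ 1 * M $ 2 $ 2 + M $ 1 $ 2 * M $ 2 $ 1) + 2 * q $ 3 * M $ 2 $ 1 * M $ 2 $ 2,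
      qform q (vector [M $ 1 $ 2, M $ 2 $ 2])]"

lemma qform_pull: "qform (pull M q) w = qform q (M *v w)"
  by (simp add: pull_def qform_def matrix_vector_mult_def sum_2 vector_3 power2_eq_square algebra_simps)

lemma pull_linear: "pull M (p - q) = pull M p - pull M q" "pull M (p + q) = pull M p + pull M q" "pull M (c *s q) = c *s pull M q"
  by (simp_all add: pull_def qform_def vec_eq_iff forall_3 vector_3 algebra_simps)

lemma bil_pull: "bil (pull M p) (pull M q) = (M $ 1 $ 1 * M $ 2 $ 2 - M $ 1 $ 2 * M $ 2 $ 1)\<^sup>2 * bil p q"
  by (simp add: pull_def qform_def bil_def vector_3) algebra

lemma qform_inject: "(\<And>w. qform p w = qform q w) \<Longrightarrow> p = q"
proof -
  assume *: "\<And>w. qform p w = qform q w"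
  show "p = q"
    using *[of "vector [1, 0]"] *[of "vector [0, 1]"] *[of "vector [1, 1]"]
    by (simp add: qform_def vec_eq_iff forall_3)
qed

lemma isotropic_is_square:
  assumes "bil q q = 0"
  obtains l where "\<And>w. qform q w = (bdot l w)\<^sup>2"
proof -
  have q2: "(q $ 2)\<^sup>2 = 4 * q $ 1 * q $ 3" using assms by (simp add: bil_def power2_eq_square algebra_simps)
  define x where "x = csqrt (q $ 1)"
  have x: "x\<^sup>2 = q $ 1" by (simp add: x_def)
  show thesis
  proof (cases "x = 0")
    case True
    define y where "y = csqrt (q $ 3)"
    have y: "y\<^sup>2 = q $ 3" by (simp add: y_def)
    have "q $ 1 = 0" "q $ 2 = 0" using True x q2 by auto
    then show thesis using that[of "vector [0, y]"] y by (simp add: qform_def bdot_2 power_mult_distrib)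
  next
    case False
    define y where "y = q $ 2 / (2 * x)"
    have "4 * x\<^sup>2 * y\<^sup>2 = 4 * x\<^sup>2 * q $ 3" unfolding y_def using q2 False x by (simp add: power_divide power_mult_distrib)
    then have y: "y\<^sup>2 = q $ 3" using False by simp
    have xy: "2 * x * y = q $ 2" using False by (simp add: y_def)
    have "qform q w = (bdot (vector [x, y]) w)\<^sup>2" for w
      unfolding qform_def x[symmetric] y[symmetric] xy[symmetric] by (simp add: bdot_2 power2_eq_square algebra_simps)
    then show thesis by (rule that)
  qed
qed

lemma square_coeffs:
  assumes "\<And>w. qform q w = (bdot l w)\<^sup>2"
  shows "q $ 1 = (l $ 1)\<^sup>2" "q $ 3 = (l $ 2)\<^sup>2" "q $ 2 = 2 * l $ 1 * l $ 2"
proof -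
  show 1: "q $ 1 = (l $ 1)\<^sup>2" "q $ 3 = (l $ 2)\<^sup>2"
    using assms[of "vector [1, 0]"] assms[of "vector [0, 1]"] by (simp_all add: qform_def bdot_2)
  show "q $ 2 = 2 * l $ 1 * l $ 2"
    using assms[of "vector [1, 1]"] 1 by (simp add: qform_def bdot_2 power2_eq_square algebra_simps)
qed

text \<open>If q_i = l^2 and w is the root of l, then bil q_i q_j = -2 q_j(w); orthogonality to l^2
  means vanishing at w.\<close>

lemma isotropic_common_root:
  assumes "\<And>i j. i \<in> I \<Longrightarrow> j \<in> I \<Longrightarrow> bil (q i) (q j) = 0"
  obtains w where "w \<noteq> 0" "\<And>i. i \<in> I \<Longrightarrow> qform (q i) w = 0"
proof (cases "\<exists>i\<in>I. q i \<noteq> 0")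
  case False
  then show thesis using that[of "vector [1, 0]"] by (auto simp: qform_def vec_eq_iff forall_2)
next
  case True
  then obtain i where i: "i \<in> I" "q i \<noteq> 0" by blast
  obtain l where l: "\<And>w. qform (q i) w = (bdot l w)\<^sup>2"
    using isotropic_is_square assms i by blast
  note qi = square_coeffs[OF l]
  show thesis
  proof
    show "vector [- l $ 2, l $ 1] \<noteq> (0 :: complex^2)"
      using i(2) qi by (auto simp: vec_eq_iff forall_2 forall_3)
    fix j assume "j \<in> I"
    then have "bil (q i) (q j) = 0" using assms i by blast
    moreover have "bil (q i) (q j) = - 2 * qform (q j) (vector [- l $ 2, l $ 1])"
      by (simp add: bil_def qi qform_def algebra_simps power2_eq_square)
    ultimately show "qform (q j) (vector [- l $ 2, l $ 1]) = 0" by simp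
  qed
qed

text \<open>The conditions on the 2-jets \<open>p\<close> of the four functions \<open>g\<close> that come from the addition formula. The last
  three reflect that a quadric through the point \<open>(f\<^sub>y)\<close> of the form \<open>g\<^sub>a g\<^sub>b = \<plusminus> g\<^sub>c g\<^sub>d\<close> contains the whole
  image.\<close>

definition qcond :: "complex \<Rightarrow> complex \<Rightarrow> complex \<Rightarrow> complex \<Rightarrow> complex^3 \<Rightarrow> complex^3 \<Rightarrow> complex^3 \<Rightarrow> complex^3 \<Rightarrow> bool" where
  "qcond fa fb fc fd pa pb pc pd \<longleftrightarrow>
     bil (pa - pb) (pc - pd) = 0 \<and> bil (pa - pc) (pb - pd) = 0 \<and> bil (pa - pd) (pb - pc) = 0 \<and>
     (fa * fb)\<^sup>2 * bil (pa - pb) (pa - pb) + (fc * fd)\<^sup>2 * bil (pc - pd) (pc - pd) = 0 \<and>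
     (fa * fc)\<^sup>2 * bil (pa - pc) (pa - pc) + (fb * fd)\<^sup>2 * bil (pb - pd) (pb - pd) = 0 \<and>
     (fa * fd)\<^sup>2 * bil (pa - pd) (pa - pd) + (fb * fc)\<^sup>2 * bil (pb - pc) (pb - pc) = 0 \<and>
     ((fa * fb)\<^sup>2 = (fc * fd)\<^sup>2 \<longrightarrow> pa + pb = pc + pd) \<and>
     ((fa * fc)\<^sup>2 = (fb * fd)\<^sup>2 \<longrightarrow> pa + pc = pb + pd) \<and>
     ((fa * fd)\<^sup>2 = (fb * fc)\<^sup>2 \<longrightarrow> pa + pd = pb + pc)"

section \<open>Congruence of the tetrahedra of normalised 2-jets\<close>

lemma qcond_pull:
  assumes "qcond fa fb fc fd pa pb pc pd"
  shows "qcond fa fb fc fd (pull M pa) (pull M pb) (pull M pc) (pull M pd)"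
proof -
  define D where "D = (M $ 1 $ 1 * M $ 2 $ 2 - M $ 1 $ 2 * M $ 2 $ 1)\<^sup>2"
  have e: "x * (D * y) + x' * (D * y') = D * (x * y + x' * y')" for x x' y y'
    by (simp add: algebra_simps)
  show ?thesis
    using assms unfolding qcond_def pull_linear[symmetric] bil_pull D_def[symmetric] e by auto
qed

text \<open>Used to move any edge at pa to the position of pa - pb, since only some edge is known to
  be non-isotropic.\<close>

lemma qcond_swap:
  "qcond fa fb fc fd pa pb pc pd \<Longrightarrow> qcond fa fc fb fd pa pc pb pd"
  "qcond fa fb fc fd pa pb pc pd \<Longrightarrow> qcond fa fd fc fb pa pd pc pb"
proof -
  have s: "bil p (q - r) = 0 \<longleftrightarrow> bil p (r - q) = 0" "bil (q - r) (q - r) = bil (r - q) (r - q)" for p q r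
    by (auto simp: bil_simps)
  show "qcond fa fb fc fd pa pb pc pd \<Longrightarrow> qcond fa fc fb fd pa pc pb pd"
    unfolding qcond_def using s(1)[of "pa - pd" pb pc] s(2)[of pb pc] by (simp add: mult.commute add.commute)
  show "qcond fa fb fc fd pa pb pc pd \<Longrightarrow> qcond fa fd fc fb pa pd pc pb"
    unfolding qcond_def using s(1)[of "pa - pb" pc pd] s(1)[of "pa - pc" pb pd] s(1)[of "pa - pd" pb pc] s(2)[of pb pc] s(2)[of pb pd] s(2)[of pc pd]
    by (simp add: mult.commute add.commute)
qed

lemma matrix_2_invertible:
  fixes A :: "complex^2^2"
  assumes "A $ 1 $ 1 * A $ 2 $ 2 - A $ 1 $ 2 * A $ 2 $ 1 \<noteq> 0"
  shows "invertible A"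
  using assms by (simp add: invertible_det_nz det_2)

text \<open>Put e = fa fb (pb - pa) and e' = fc fd (pd - pc). By \<open>qcond\<close> they are
  orthogonal and bil e e = - bil e' e', so e + e' and e - e' are isotropic, hence squares of linear
  forms l1 and l2. These are independent because bil e e is nonzero, and in suitable multiples of
  them as coordinates e = x^2 + y^2 and e' = x^2 - y^2.\<close>

lemma qcond_normal_form:
  assumes q: "qcond fa fb fc fd pa pb pc pd" and nz: "fa \<noteq> 0" "fb \<noteq> 0" "fc \<noteq> 0" "fd \<noteq> 0"
    and E: "bil (pa - pb) (pa - pb) \<noteq> 0"
  obtains A where "invertible A"
    "(fa * fb) *s (pull A pb - pull A pa) = vector [1, 0, 1]"
    "(fc * fd) *s (pull A pd - pull A pc) = vector [1, 0, - 1]"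
proof -
  define s t where "s = fa * fb" and "t = fc * fd"
  define e e' where "e = s *s (pb - pa)" and "e' = t *s (pd - pc)"
  have eE: "bil e e = s\<^sup>2 * bil (pa - pb) (pa - pb)" "bil e' e' = t\<^sup>2 * bil (pc - pd) (pc - pd)"
    "bil e e' = s * t * bil (pa - pb) (pc - pd)"
    by (simp_all add: e_def e'_def bil_simps power2_eq_square algebra_simps)
  have o: "bil e e + bil e' e' = 0" "bil e e' = 0"
    using q unfolding eE s_def t_def qcond_def by simp_all
  have c: "bil e' e = bil e e'" by (rule bil_commute)
  have "bil (e + e') (e + e') = 0" "bil (e - e') (e - e') = 0"
    using o c by (simp_all add: bil_simps)
  then obtain l1 l2 where l1: "\<And>w. qform (e + e') w = (bdot l1 w)\<^sup>2" and l2: "\<And>w. qform (e - e') w = (bdot l2 w)\<^sup>2"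
    using isotropic_is_square by metis
  note a = square_coeffs[OF l1] and b = square_coeffs[OF l2]
  define dt where "dt = l1 $ 1 * l2 $ 2 - l1 $ 2 * l2 $ 1"
  have "bil (e + e') (e - e') = - 2 * dt\<^sup>2"
    unfolding bil_def a b dt_def by (simp add: power2_eq_square algebra_simps)
  moreover have "bil (e + e') (e - e') = 2 * bil e e"
    using o c by (simp add: bil_simps add_eq_0_iff2)
  moreover have "bil e e \<noteq> 0" using E nz unfolding eE s_def by simp
  ultimately have dt: "dt \<noteq> 0" by auto
  define k where "k = csqrt 2"
  have k: "k\<^sup>2 = 2" "k \<noteq> 0" by (simp_all only: k_def power2_csqrt csqrt_eq_0, simp)
  \<comment> \<open>The square root of 2 times the inverse of the matrix with rows l1 and l2, so
    that l1^2 and l2^2 become 2 x^2 and 2 y^2.\<close>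
  define A :: "complex^2^2" where "A = vector [vector [k * l2 $ 2 / dt, - k * l1 $ 2 / dt], vector [- k * l2 $ 1 / dt, k * l1 $ 1 / dt]]"
  have A1: "bdot l1 (A *v w) = k * w $ 1" and A2: "bdot l2 (A *v w) = k * w $ 2" for w
  proof -
    have "bdot l1 (A *v w) * dt = k * w $ 1 * dt" 
      using dt by (simp add: A_def bdot_2 matrix_vector_mult_def sum_2 field_simps) (simp add: dt_def algebra_simps)
    then show "bdot l1 (A *v w) = k * w $ 1" using dt by simp
    have "bdot l2 (A *v w) * dt = k * w $ 2 * dt"
      using dt by (simp add: A_def bdot_2 matrix_vector_mult_def sum_2 field_simps) (simp add: dt_def algebra_simps)
    then show "bdot l2 (A *v w) = k * w $ 2" using dt by simp
  qed
  have p1: "pull A (e + e') = vector [2, 0, 0]"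
    by (rule qform_inject) (simp add: qform_pull l1 A1 power_mult_distrib k, simp add: qform_def vector_3)
  have p2: "pull A (e - e') = vector [0, 0, 2]"
    by (rule qform_inject) (simp add: qform_pull l2 A2 power_mult_distrib k, simp add: qform_def vector_3)
  have half: "v = (1/2) *s ((v + w) + (v - w))" "w = (1/2) *s ((v + w) - (v - w))" for v w :: "complex^3"
    by (simp_all add: vec_eq_iff)
  have "pull A e = vector [1, 0, 1]" "pull A e' = vector [1, 0, - 1]"
    by (subst half(1)[of _ "pull A e'"] half(2)[of _ "pull A e"],
        simp only: p1[unfolded pull_linear] p2[unfolded pull_linear],
        simp add: vec_eq_iff forall_3 vector_3)+
  moreover have "A $ 1 $ 1 * A $ 2 $ 2 - A $ 1 $ 2 * A $ 2 $ 1 \<noteq> 0"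
  proof -
    have "A $ 1 $ 1 * A $ 2 $ 2 - A $ 1 $ 2 * A $ 2 $ 1 = k\<^sup>2 * (l1 $ 1 * l2 $ 2 - l1 $ 2 * l2 $ 1) / dt\<^sup>2"
      unfolding A_def using dt by (simp add: field_simps power2_eq_square)
    also have "\<dots> = 2 / dt" unfolding dt_def[symmetric] k using dt by (simp add: power2_eq_square)
    finally show ?thesis using dt by simp
  qed
  ultimately show thesis
    using that[of A] nz unfolding e_def e'_def pull_linear s_def t_def by (simp add: matrix_2_invertible)
qed

text \<open>With r = pc - pa and the orthogonal opposite edges d = pb - pa, d' = pd - pc the
  conditions become equations that are linear in the Gram entries of r, d, d'.\<close>

lemma qcond_equations:
  assumes q: "qcond fa fb fc fd pa pb pc pd"
  defines "N \<equiv> bil (pc - pa) (pc - pa)" and "P \<equiv> bil (pc - pa) (pb - pa)" and "S \<equiv> bil (pc - pa) (pd - pc)"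
    and "D \<equiv> bil (pb - pa) (pb - pa)" and "D' \<equiv> bil (pd - pc) (pd - pc)"
  shows "N + S - P = 0"
    "(fa * fc)\<^sup>2 * N + (fb * fd)\<^sup>2 * (N + 2 * S - 2 * P + D' + D) = 0"
    "(fa * fd)\<^sup>2 * (N + 2 * S + D') + (fb * fc)\<^sup>2 * (N - 2 * P + D) = 0"
    "(fa * fb)\<^sup>2 * D + (fc * fd)\<^sup>2 * D' = 0"
proof -
  define r d d' where "r = pc - pa" and "d = pb - pa" and "d' = pd - pc"
  have e: "pa - pb = - d" "pc - pd = - d'" "pa - pc = - r" "pb - pd = d - r - d'" "pa - pd = - (r + d')" "pb - pc = d - r"
    by (simp_all add: r_def d_def d'_def)
  have o: "bil d d' = 0" "bil d' d = 0"
    using q unfolding qcond_def e by (simp_all add: bil_simps bil_commute[of d' d])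
  note c = bil_commute[of d r] bil_commute[of d' r]
  show 1: "N + S - P = 0"
    using q unfolding qcond_def e N_def S_def P_def r_def[symmetric] d_def[symmetric] d'_def[symmetric]
    by (simp add: bil_simps c o algebra_simps)
  show "(fa * fc)\<^sup>2 * N + (fb * fd)\<^sup>2 * (N + 2 * S - 2 * P + D' + D) = 0"
    "(fa * fd)\<^sup>2 * (N + 2 * S + D') + (fb * fc)\<^sup>2 * (N - 2 * P + D) = 0"
    "(fa * fb)\<^sup>2 * D + (fc * fd)\<^sup>2 * D' = 0"
    using q unfolding qcond_def e N_def S_def P_def D_def D'_def r_def[symmetric] d_def[symmetric] d'_def[symmetric]
    by (simp_all add: bil_simps c o algebra_simps)
qed

text \<open>If one of the differences were 0, the equations would give D + D' = 0 and then (fa fb)^2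
  = (fc fd)^2. Two of the implications in \<open>qcond\<close> now apply, and their conclusions
  identify the four points in pairs; so D = D', hence D = 0, against E.\<close>

lemma qcond_nondegenerate:
  assumes q: "qcond fa fb fc fd pa pb pc pd" and nz: "fa \<noteq> 0" "fb \<noteq> 0" "fc \<noteq> 0" "fd \<noteq> 0"
    and E: "bil (pa - pb) (pa - pb) \<noteq> 0"
  shows "(fa * fc)\<^sup>2 \<noteq> (fb * fd)\<^sup>2" "(fa * fd)\<^sup>2 \<noteq> (fb * fc)\<^sup>2"
proof -
  note eq = qcond_equations[OF q]
  let ?D = "bil (pb - pa) (pb - pa)" and ?D' = "bil (pd - pc) (pd - pc)"
  let ?N = "bil (pc - pa) (pc - pa)" and ?P = "bil (pc - pa) (pb - pa)" and ?S = "bil (pc - pa) (pd - pc)"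
  have DE: "?D = bil (pa - pb) (pa - pb)" by (simp add: bil_simps)
  have P: "?P = ?N + ?S" using eq(1) by (simp add: algebra_simps)
  have fbd: "(fb * fd)\<^sup>2 \<noteq> 0" "(fb * fc)\<^sup>2 \<noteq> 0" using nz by simp_all
  have deg: False if "?D' + ?D = 0" "pa + pc = pb + pd \<or> pa + pd = pb + pc"
  proof -
    have D': "?D' = - ?D" using that(1) by (simp add: add_eq_0_iff)
    have "(fa * fb)\<^sup>2 * ?D = (fc * fd)\<^sup>2 * ?D" using eq(4) unfolding D' by (simp add: algebra_simps)
    then have "(fa * fb)\<^sup>2 = (fc * fd)\<^sup>2" using E DE by simp
    then have pp: "pa + pb = pc + pd" using q unfolding qcond_def by blast
    have "pa = pd \<and> pb = pc \<or> pa = pc \<and> pb = pd"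
      using that(2)
    proof
      assume as: "pa + pc = pb + pd"
      have "2 * pa $ i = 2 * pd $ i" "2 * pb $ i = 2 * pc $ i" for i
        using arg_cong[OF pp, of "\<lambda>v. v $ i"] arg_cong[OF as, of "\<lambda>v. v $ i"]
        unfolding vector_add_component by algebra+
      then show ?thesis by (simp add: vec_eq_iff)
    next
      assume as: "pa + pd = pb + pc"
      have "2 * pa $ i = 2 * pc $ i" "2 * pb $ i = 2 * pd $ i" for i
        using arg_cong[OF pp, of "\<lambda>v. v $ i"] arg_cong[OF as, of "\<lambda>v. v $ i"]
        unfolding vector_add_component by algebra+
      then show ?thesis by (simp add: vec_eq_iff)
    qed
    then have "?D' = ?D" by (auto simp: bil_simps)
    then have "2 * ?D = 0" using that(1) by simp
    then show False using E DE by simp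
  qed
  show "(fa * fc)\<^sup>2 \<noteq> (fb * fd)\<^sup>2"
  proof
    assume u: "(fa * fc)\<^sup>2 = (fb * fd)\<^sup>2"
    then have pp: "pa + pc = pb + pd" using q unfolding qcond_def by blast
    have "(fb * fd)\<^sup>2 * (?D' + ?D) = 0" using eq(2) unfolding u P by (simp add: algebra_simps)
    then show False using deg pp fbd by simp
  qed
  show "(fa * fd)\<^sup>2 \<noteq> (fb * fc)\<^sup>2"
  proof
    assume u: "(fa * fd)\<^sup>2 = (fb * fc)\<^sup>2"
    then have pp: "pa + pd = pb + pc" using q unfolding qcond_def by blast
    have "(fb * fc)\<^sup>2 * (?D' + ?D) = 0" using eq(3) unfolding u P by (simp add: algebra_simps)
    then show False using deg pp fbd by simp
  qed
qed

text \<open>After P = N + S is substituted, one equation determines N and the other N + 2 S; their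
  leading coefficients are the two nonzero differences.\<close>

lemma qcond_unique_products:
  assumes q: "qcond fa fb fc fd pa pb pc pd" and q': "qcond fa fb fc fd pa' pb' pc' pd'"
    and ne: "(fa * fc)\<^sup>2 \<noteq> (fb * fd)\<^sup>2" "(fa * fd)\<^sup>2 \<noteq> (fb * fc)\<^sup>2"
    and D: "bil (pb - pa) (pb - pa) = bil (pb' - pa') (pb' - pa')" "bil (pd - pc) (pd - pc) = bil (pd' - pc') (pd' - pc')"
  shows "bil (pc - pa) (pc - pa) = bil (pc' - pa') (pc' - pa')"
    "bil (pc - pa) (pb - pa) = bil (pc' - pa') (pb' - pa')"
    "bil (pc - pa) (pd - pc) = bil (pc' - pa') (pd' - pc')"
proof -
  note eq = qcond_equations[OF q] and eq' = qcond_equations[OF q']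
  let ?N = "bil (pc - pa) (pc - pa)" and ?P = "bil (pc - pa) (pb - pa)" and ?S = "bil (pc - pa) (pd - pc)"
  let ?N' = "bil (pc' - pa') (pc' - pa')" and ?P' = "bil (pc' - pa') (pb' - pa')" and ?S' = "bil (pc' - pa') (pd' - pc')"
  have P: "?P = ?N + ?S" "?P' = ?N' + ?S'" using eq(1) eq'(1) by (simp_all add: algebra_simps)
  have "((fa * fc)\<^sup>2 - (fb * fd)\<^sup>2) * (?N - ?N') = 0"
    using eq(2) eq'(2) unfolding P D by algebra
  then show N: "?N = ?N'" using ne by simp
  have "2 * ((fa * fd)\<^sup>2 - (fb * fc)\<^sup>2) * (?S - ?S') = 0"
    using eq(3) eq'(3) unfolding P D N by algebra
  then show S: "?S = ?S'" using ne by simp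
  show "?P = ?P'" unfolding P N S ..
qed

text \<open>The products of r = pc - pa with x^2 + y^2 and x^2 - y^2 give its outer coefficients,
  and bil r r then gives the square of the middle one. Only a sign stays open.\<close>

lemma qcond_normal_unique:
  assumes q: "qcond fa fb fc fd pa pb pc pd" and q': "qcond fa fb fc fd pa' pb' pc' pd'"
    and ne: "(fa * fc)\<^sup>2 \<noteq> (fb * fd)\<^sup>2" "(fa * fd)\<^sup>2 \<noteq> (fb * fc)\<^sup>2"
    and s: "s \<noteq> 0" "s *s (pb - pa) = vector [1, 0, 1]" "s *s (pb' - pa') = vector [1, 0, 1]"
    and t: "t \<noteq> 0" "t *s (pd - pc) = vector [1, 0, - 1]" "t *s (pd' - pc') = vector [1, 0, - 1]"
  shows "(pc - pa) $ 1 = (pc' - pa') $ 1" "(pc - pa) $ 3 = (pc' - pa') $ 3"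
    "(pc - pa) $ 2 = (pc' - pa') $ 2 \<or> (pc - pa) $ 2 = - ((pc' - pa') $ 2)"
    "pb - pa = pb' - pa'" "pd - pc = pd' - pc'" "(pb - pa) $ 2 = 0" "(pd - pc) $ 2 = 0"
proof -
  have cancel: "v = w" if "c *s v = c *s w" "c \<noteq> 0" for c and v w :: "complex^3"
    using that by (simp add: vec_eq_iff)
  show d: "pb - pa = pb' - pa'" "pd - pc = pd' - pc'"
    using cancel[of s "pb - pa" "pb' - pa'"] cancel[of t "pd - pc" "pd' - pc'"] s t by metis+
  have c1: "s * (pb - pa) $ i = vector [1, 0, 1] $ i" for i using arg_cong[OF s(2), of "\<lambda>v. v $ i"] by (simp add: algebra_simps)
  have c2: "t * (pd - pc) $ i = vector [1, 0, - 1] $ i" for i using arg_cong[OF t(2), of "\<lambda>v. v $ i"] by (simp add: algebra_simps)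
  show z: "(pb - pa) $ 2 = 0" "(pd - pc) $ 2 = 0" using c1[of 2] c2[of 2] s(1) t(1) by simp_all
  note pr = qcond_unique_products[OF q q' ne arg_cong2[OF d(1) d(1), of bil] arg_cong2[OF d(2) d(2), of bil]]
  define r r' where "r = pc - pa" and "r' = pc' - pa'"
  have "bil r (s *s (pb - pa)) = bil r' (s *s (pb - pa))" "bil r (t *s (pd - pc)) = bil r' (t *s (pd - pc))"
    using pr unfolding r_def r'_def bil_simps(6) d by simp_all
  then have e: "r $ 1 + r $ 3 = r' $ 1 + r' $ 3" "r $ 1 - r $ 3 = r' $ 1 - r' $ 3"
    unfolding s(2) t(2) by (simp_all add: bil_def vector_3) algebra+
  have "2 * r $ 1 = 2 * r' $ 1" "2 * r $ 3 = 2 * r' $ 3" using e by algebra+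
  then have e13: "r $ 1 = r' $ 1" "r $ 3 = r' $ 3" by simp_all
  then show "(pc - pa) $ 1 = (pc' - pa') $ 1" "(pc - pa) $ 3 = (pc' - pa') $ 3" by (simp_all add: r_def r'_def)
  have "bil r r = bil r' r'" using pr(1) by (simp add: r_def r'_def)
  then have "r $ 2 * r $ 2 = r' $ 2 * r' $ 2" using e13 by (simp add: bil_def)
  then show "(pc - pa) $ 2 = (pc' - pa') $ 2 \<or> (pc - pa) $ 2 = - ((pc' - pa') $ 2)"
    unfolding r_def[symmetric] r'_def[symmetric] by (simp only: square_eq_iff)
qed

lemma matrix_inv_mult:
  assumes "invertible A"
  shows "A ** matrix_inv A = mat 1" "matrix_inv A ** A = mat 1"
  using someI_ex[OF assms[unfolded invertible_def]] unfolding matrix_inv_def by blast+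

lemma invertible_matrix_inv: "invertible A \<Longrightarrow> invertible (matrix_inv A)"
  using matrix_inv_mult[of A] unfolding invertible_def by blast

lemma matrix_vector_mult_compose_inv:
  fixes A :: "complex^2^2"
  assumes "invertible A"
  shows "A *v (matrix_inv A *v w) = w" "matrix_inv A *v (A *v w) = w"
  using assms by (simp_all add: matrix_vector_mul_assoc matrix_inv_mult)

text \<open>In normal form the two tetrahedra agree up to a translation and possibly the sign of the
  xy-coefficient of pc - pa. The reflection R = diag(1, -1) changes this sign and fixes the two
  normalised edges.\<close>

lemma qcond_congruent_aux:
  assumes q: "qcond fa fb fc fd pa pb pc pd" and q': "qcond fa fb fc fd pa' pb' pc' pd'"
    and nz: "fa \<noteq> 0" "fb \<noteq> 0" "fc \<noteq> 0" "fd \<noteq> 0"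
    and E: "bil (pa - pb) (pa - pb) \<noteq> 0" and E': "bil (pa' - pb') (pa' - pb') \<noteq> 0"
  obtains M l where "invertible M" "\<And>w. qform pa' (M *v w) = qform pa w + qform l w"
    "\<And>w. qform pb' (M *v w) = qform pb w + qform l w"
    "\<And>w. qform pc' (M *v w) = qform pc w + qform l w"
    "\<And>w. qform pd' (M *v w) = qform pd w + qform l w"
proof -
  obtain A where A: "invertible A" "(fa * fb) *s (pull A pb - pull A pa) = vector [1, 0, 1]"
    "(fc * fd) *s (pull A pd - pull A pc) = vector [1, 0, - 1]"
    using qcond_normal_form[OF q nz E] by metis
  obtain A' where A': "invertible A'" "(fa * fb) *s (pull A' pb' - pull A' pa') = vector [1, 0, 1]"
    "(fc * fd) *s (pull A' pd' - pull A' pc') = vector [1, 0, - 1]"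
    using qcond_normal_form[OF q' nz E'] by metis
  note ne = qcond_nondegenerate[OF q nz E]
  have st: "fa * fb \<noteq> 0" "fc * fd \<noteq> 0" using nz by auto
  note u = qcond_normal_unique[OF qcond_pull[OF q, of A] qcond_pull[OF q', of A'] ne st(1) A(2) A'(2) st(2) A(3) A'(3)]
  define e :: complex where "e = (if (pull A pc - pull A pa) $ 2 = (pull A' pc' - pull A' pa') $ 2 then 1 else - 1)"
  have e2: "e * e = 1" by (simp add: e_def)
  define R :: "complex^2^2" where "R = vector [vector [1, 0], vector [0, e]]"
  have pR: "pull R v = vector [v $ 1, e * v $ 2, v $ 3]" for v
    using e2 by (simp add: pull_def R_def qform_def power2_eq_square vec_eq_iff forall_3 vector_3)
  define B where "B = A' ** R ** matrix_inv A"
  have invR: "invertible R"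
    using e2 by (intro matrix_2_invertible) (auto simp: R_def)
  have invB: "invertible B"
    unfolding B_def using A A' invR by (intro invertible_mult) (auto simp: invertible_matrix_inv)
  have d: "pull R (pull A' x' - pull A' pa') = pull A x - pull A pa"
    if "(x, x') \<in> {(pa, pa'), (pb, pb'), (pc, pc'), (pd, pd')}" for x x'
  proof -
    have c: "pull R (pull A' pc' - pull A' pa') = pull A pc - pull A pa"
      unfolding pR using u(1,2,3) by (auto simp: vec_eq_iff forall_3 vector_3 e_def)
    have dd: "pull R (pull A' pd' - pull A' pc') = pull A pd - pull A pc"
      unfolding pR u(5)[symmetric] using u(7) by (auto simp: vec_eq_iff forall_3 vector_3)
    have "pull R (pull A' pd' - pull A' pa') = pull R (pull A' pd' - pull A' pc') + pull R (pull A' pc' - pull A' pa')"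
      by (simp only: pull_linear[symmetric]) simp
    also have "\<dots> = pull A pd - pull A pa" unfolding c dd by simp
    finally have d: "pull R (pull A' pd' - pull A' pa') = pull A pd - pull A pa" .
    have b: "pull R (pull A' pb' - pull A' pa') = pull A pb - pull A pa"
      unfolding pR u(4)[symmetric] using u(6) by (auto simp: vec_eq_iff forall_3 vector_3)
    have a: "pull R (pull A' pa' - pull A' pa') = pull A pa - pull A pa"
      unfolding pR by (auto simp: vec_eq_iff forall_3 vector_3)
    show ?thesis using that a b c d by auto
  qed
  \<comment> \<open>Only differences of jets have been matched so far; l is the translation between
    the tetrahedra.\<close>
  define l where "l = pull B pa' - pa"
  have qB: "qform x' (B *v w) = qform x w + qform l w"
    if "(x, x') \<in> {(pa, pa'), (pb, pb'), (pc, pc'), (pd, pd')}" for x x' w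
  proof -
    let ?w = "matrix_inv A *v w"
    have "qform (pull R (pull A' x' - pull A' pa')) ?w = qform (pull A x - pull A pa) ?w"
      using d[OF that] by simp
    then have "qform x' (A' *v (R *v ?w)) - qform pa' (A' *v (R *v ?w)) = qform x (A *v ?w) - qform pa (A *v ?w)"
      by (simp add: qform_diff qform_pull)
    moreover have "A' *v (R *v ?w) = B *v w" by (simp add: B_def matrix_vector_mul_assoc matrix_mul_assoc)
    ultimately have "qform x' (B *v w) - qform pa' (B *v w) = qform x w - qform pa w"
      using matrix_vector_mult_compose_inv[OF A(1)] by simp
    then show ?thesis unfolding l_def by (simp add: qform_diff qform_pull algebra_simps)
  qed
  show thesis by (rule that[OF invB, of l]) (use qB in auto)
qed

text \<open>An edge that is non-isotropic for p is so for p' as well: otherwise D = D' = 0 there,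
  the linear equations, whose coefficients depend on the f alone, give N = S = 0, and every edge at
  pa' would be isotropic.\<close>

lemma qcond_congruent:
  assumes q: "qcond fa fb fc fd pa pb pc pd" and q': "qcond fa fb fc fd pa' pb' pc' pd'"
    and nz: "fa \<noteq> 0" "fb \<noteq> 0" "fc \<noteq> 0" "fd \<noteq> 0"
    and E: "bil (pa - pb) (pa - pb) \<noteq> 0 \<or> bil (pa - pc) (pa - pc) \<noteq> 0 \<or> bil (pa - pd) (pa - pd) \<noteq> 0"
    and E': "bil (pa' - pb') (pa' - pb') \<noteq> 0 \<or> bil (pa' - pc') (pa' - pc') \<noteq> 0 \<or> bil (pa' - pd') (pa' - pd') \<noteq> 0"
  obtains M l where "invertible M" "\<And>w. qform pa' (M *v w) = qform pa w + qform l w"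
    "\<And>w. qform pb' (M *v w) = qform pb w + qform l w"
    "\<And>w. qform pc' (M *v w) = qform pc w + qform l w"
    "\<And>w. qform pd' (M *v w) = qform pd w + qform l w"
proof -
  have key: "bil (pa' - pb') (pa' - pb') \<noteq> 0"
    if q: "qcond fa fb fc fd pa pb pc pd" and q': "qcond fa fb fc fd pa' pb' pc' pd'"
      and nz: "fa \<noteq> 0" "fb \<noteq> 0" "fc \<noteq> 0" "fd \<noteq> 0"
      and E: "bil (pa - pb) (pa - pb) \<noteq> 0"
      and E': "bil (pa' - pb') (pa' - pb') \<noteq> 0 \<or> bil (pa' - pc') (pa' - pc') \<noteq> 0 \<or> bil (pa' - pd') (pa' - pd') \<noteq> 0"
    for fa fb fc fd pa pb pc pd pa' pb' pc' pd'
  proof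
    assume "bil (pa' - pb') (pa' - pb') = 0"
    then have D: "bil (pb' - pa') (pb' - pa') = 0" by (simp add: bil_simps algebra_simps)
    note eq = qcond_equations[OF q']
    note ne = qcond_nondegenerate[OF q nz E]
    have D': "bil (pd' - pc') (pd' - pc') = 0" using eq(4) nz by (simp add: D)
    let ?N = "bil (pc' - pa') (pc' - pa')" and ?P = "bil (pc' - pa') (pb' - pa')" and ?S = "bil (pc' - pa') (pd' - pc')"
    have P: "?P = ?N + ?S" using eq(1) by (simp add: algebra_simps)
    have "((fa * fc)\<^sup>2 - (fb * fd)\<^sup>2) * ?N = 0" using eq(2) unfolding P D D' by algebra
    then have N: "?N = 0" using ne by simp
    have "2 * ((fa * fd)\<^sup>2 - (fb * fc)\<^sup>2) * ?S = 0" using eq(3) unfolding P D D' N by algebra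
    then have S: "?S = 0" using ne by simp
    have "bil (pa' - pc') (pa' - pc') = ?N" by (simp add: bil_simps)
    moreover have "bil (pa' - pd') (pa' - pd') = ?N + 2 * ?S + bil (pd' - pc') (pd' - pc')"
      by (simp add: bil_def algebra_simps)
    moreover have "bil (pa' - pb') (pa' - pb') = bil (pb' - pa') (pb' - pa')" by (simp add: bil_simps)
    ultimately show False using E' N S D D' by simp
  qed
  consider "bil (pa - pb) (pa - pb) \<noteq> 0" | "bil (pa - pc) (pa - pc) \<noteq> 0" | "bil (pa - pd) (pa - pd) \<noteq> 0"
    using E by blast
  then show thesis
  proof cases
    case 1
    show thesis by (rule qcond_congruent_aux[OF q q' nz 1 key[OF q q' nz 1 E']]) (rule that)
  next
    case 2
    have E'': "bil (pa' - pc') (pa' - pc') \<noteq> 0 \<or> bil (pa' - pb') (pa' - pb') \<noteq> 0 \<or> bil (pa' - pd') (pa' - pd') \<noteq> 0"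
      using E' by blast
    note nz' = nz(1) nz(3) nz(2) nz(4)
    show thesis
      by (rule qcond_congruent_aux[OF qcond_swap(1)[OF q] qcond_swap(1)[OF q'] nz' 2
            key[OF qcond_swap(1)[OF q] qcond_swap(1)[OF q'] nz' 2 E'']]) (rule that)
  next
    case 3
    have E'': "bil (pa' - pd') (pa' - pd') \<noteq> 0 \<or> bil (pa' - pc') (pa' - pc') \<noteq> 0 \<or> bil (pa' - pb') (pa' - pb') \<noteq> 0"
      using E' by blast
    note nz' = nz(1) nz(4) nz(3) nz(2)
    show thesis
      by (rule qcond_congruent_aux[OF qcond_swap(2)[OF q] qcond_swap(2)[OF q'] nz' 3
            key[OF qcond_swap(2)[OF q] qcond_swap(2)[OF q'] nz' 3 E'']]) (rule that)
  qed
qed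

text \<open>The quadratic conditions carry isotropy over to the opposite edges. Hence the
  differences from pa span a totally isotropic space and share a root w, along which the four jets
  agree.\<close>

lemma qcond_common_root:
  assumes q: "qcond fa fb fc fd pa pb pc pd" and nz: "fa \<noteq> 0" "fb \<noteq> 0" "fc \<noteq> 0" "fd \<noteq> 0"
    and E: "bil (pa - pb) (pa - pb) = 0" "bil (pa - pc) (pa - pc) = 0" "bil (pa - pd) (pa - pd) = 0"
  obtains w where "w \<noteq> 0" "qform pb w = qform pa w" "qform pc w = qform pa w" "qform pd w = qform pa w"
proof -
  define b c d where "b = pb - pa" and "c = pc - pa" and "d = pd - pa"
  have i: "bil (pc - pd) (pc - pd) = 0" "bil (pb - pd) (pb - pd) = 0" "bil (pb - pc) (pb - pc) = 0"
    using q E nz unfolding qcond_def by simp_all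
  have e: "pa - pb = - b" "pa - pc = - c" "pa - pd = - d" "pc - pd = c - d" "pb - pd = b - d" "pb - pc = b - c"
    by (simp_all add: b_def c_def d_def)
  have z: "bil b b = 0" "bil c c = 0" "bil d d = 0" using E unfolding e by (simp_all add: bil_simps)
  have z': "bil b c = 0" "bil b d = 0" "bil c d = 0"
    using i z bil_commute[of c b] bil_commute[of d b] bil_commute[of d c] unfolding e by (simp_all add: bil_simps)
  have z'': "bil c b = 0" "bil d b = 0" "bil d c = 0" using z' by (simp_all add: bil_commute)
  obtain w where w: "w \<noteq> 0" "\<And>i. i \<in> {b, c, d} \<Longrightarrow> qform i w = 0"
    using isotropic_common_root[of "{b, c, d}" "\<lambda>i. i"] z z' z'' by auto
  show thesis
    using that[OF w(1)] w(2)[of b] w(2)[of c] w(2)[of d] by (simp add: b_def c_def d_def qform_diff)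
qed

section \<open>Uniqueness along lines\<close>

lemma entire_differentiable:
  assumes "F holomorphic_on UNIV"
  shows "F field_differentiable at z" "deriv F field_differentiable at z"
  using holomorphic_on_imp_differentiable_at[OF assms] holomorphic_on_imp_differentiable_at[OF holomorphic_deriv[OF assms]]
  by auto

lemma entire_leading_coefficient:
  fixes F :: "complex \<Rightarrow> complex"
  assumes "F holomorphic_on UNIV" "\<And>m. m < N \<Longrightarrow> (deriv ^^ m) F 0 = 0"
  shows "((\<lambda>t. F t / t ^ N) \<longlongrightarrow> (deriv ^^ N) F 0 / fact N) (at 0)"
proof -
  define c where "c n = (deriv ^^ n) F 0 / fact n" for n
  have c: "(\<lambda>n. c n * t ^ n) sums F t" for t
    using holomorphic_power_series[of F 0 "norm t + 1" t] assms(1)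
    by (auto simp: c_def intro: holomorphic_on_subset)
  have "((\<lambda>t. F t / t ^ N) \<longlongrightarrow> c (0 + N)) (at 0)"
  proof (rule powser_limit_0_strong[where s = 1 and a = "\<lambda>n. c (n + N)"])
    fix t :: complex assume "t \<noteq> 0" "norm t < 1"
    have "(\<lambda>n. c (n + N) * t ^ (n + N)) sums (F t - (\<Sum>n<N. c n * t ^ n))"
      using sums_split_initial_segment[OF c[of t], of N] by simp
    moreover have "(\<Sum>n<N. c n * t ^ n) = 0"
      by (intro sum.neutral) (auto simp: c_def assms(2))
    ultimately have "(\<lambda>n. c (n + N) * t ^ (n + N) / t ^ N) sums (F t / t ^ N)"
      by (simp add: sums_divide)
    then show "(\<lambda>n. c (n + N) * t ^ n) sums (F t / t ^ N)"
      using \<open>t \<noteq> 0\<close> by (simp add: power_add)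
  qed simp
  then show ?thesis by (simp add: c_def)
qed

lemma sum_f2: "(\<Sum>x\<in>(UNIV :: f2 set). g x) = g (False, False) + g (False, True) + g (True, False) + g (True, True)"
  for g :: "f2 \<Rightarrow> complex"
  by (simp add: UNIV_Times_UNIV[symmetric] UNIV_bool sum.cartesian_product' del: UNIV_Times_UNIV)

lemma chi_orthogonal:
  assumes "\<And>x. (\<Sum>y\<in>UNIV. chi x y * g y) = 0"
  shows "g y = 0"
proof -
  have "4 * g y = (\<Sum>x\<in>UNIV. chi x y * (\<Sum>y\<in>UNIV. chi x y * g y))"
    by (cases y) (auto simp: sum_f2 chi_def)
  then show ?thesis using assms by simp
qed

text \<open>If \<open>h\<close> and \<open>k\<close> first differ in order \<open>N\<close>, by \<open>r\<^sub>y t\<^sup>N\<close>, then comparing coefficients in the duplication formula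
  gives \<open>b\<^sub>x (2\<^sup>N - 4) \<Sum>\<^sub>y (-1)\<^bsup>x\<cdot>y\<^esup> f\<^sub>y r\<^sub>y = 0\<close>; for \<open>b\<^sub>x = 0\<close> the vanishing of the quadric replaces it.\<close>

lemma duplication_unique:
  fixes h k :: "f2 \<Rightarrow> complex \<Rightarrow> complex" and f b :: "f2 \<Rightarrow> complex"
  assumes hol: "\<And>y. h y holomorphic_on UNIV" "\<And>y. k y holomorphic_on UNIV"
    and nz: "\<And>y. f y \<noteq> 0"
    and j0: "\<And>y. h y 0 = f y" "\<And>y. k y 0 = f y"
    and j1: "\<And>y. deriv (h y) 0 = deriv (k y) 0"
    and j2: "\<And>y. deriv (deriv (h y)) 0 = deriv (deriv (k y)) 0"
    and b: "\<And>x. 4 * b x = (\<Sum>y\<in>UNIV. chi x y * (f y)\<^sup>2)"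
    and dup: "\<And>x t. b x * (\<Sum>y\<in>UNIV. chi x y * (f y * h y (2 * t))) * 4 = (\<Sum>y\<in>UNIV. chi x y * (h y t)\<^sup>2)\<^sup>2"
      "\<And>x t. b x * (\<Sum>y\<in>UNIV. chi x y * (f y * k y (2 * t))) * 4 = (\<Sum>y\<in>UNIV. chi x y * (k y t)\<^sup>2)\<^sup>2"
    and van: "\<And>x t. b x = 0 \<Longrightarrow> (\<Sum>y\<in>UNIV. chi x y * (h y t)\<^sup>2) = 0"
      "\<And>x t. b x = 0 \<Longrightarrow> (\<Sum>y\<in>UNIV. chi x y * (k y t)\<^sup>2) = 0"
  shows "h y t = k y t"
proof -
  define d where "d y t = h y t - k y t" for y t
  have hd: "d y holomorphic_on UNIV" for y
    unfolding d_def by (intro holomorphic_intros hol)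
  have cont: "(h y \<longlongrightarrow> f y) (at 0)" "(k y \<longlongrightarrow> f y) (at 0)" for y
    using holomorphic_on_imp_continuous_on[OF hol(1)[of y]] holomorphic_on_imp_continuous_on[OF hol(2)[of y]] j0[of y]
    unfolding continuous_on_eq_continuous_at[OF open_UNIV] isCont_def by (metis UNIV_I)+
  have "\<forall>y. (deriv ^^ N) (d y) 0 = 0" for N
  proof (induction N rule: less_induct)
    case (less N)
    show ?case
    \<comment> \<open>Order 2 has to come from the hypotheses: it is where 2^N - 4 vanishes.\<close>
    proof (cases "N < 3")
      case True
      have d1: "deriv (d y) = (\<lambda>t. deriv (h y) t - deriv (k y) t)" for y
        unfolding d_def by (rule ext) (intro deriv_diff entire_differentiable hol)
      have d2: "deriv (deriv (d y)) 0 = deriv (deriv (h y)) 0 - deriv (deriv (k y)) 0" for y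
        unfolding d1 by (intro deriv_diff entire_differentiable hol)
      have "d y 0 = 0" "deriv (d y) 0 = 0" "deriv (deriv (d y)) 0 = 0" for y
        unfolding d2 unfolding d1 by (simp_all add: d_def j0 j1 j2)
      moreover have "N = 0 \<or> N = 1 \<or> N = 2" using True by linarith
      ultimately show ?thesis by (elim disjE) (simp_all add: numeral_2_eq_2)
    next
      case False
      define r where "r y = (deriv ^^ N) (d y) 0 / fact N" for y
      have r: "((\<lambda>t. d y t / t ^ N) \<longlongrightarrow> r y) (at 0)" for y
        unfolding r_def by (rule entire_leading_coefficient[OF hd]) (use less in blast)
      have r2: "((\<lambda>t. d y (2 * t) / t ^ N) \<longlongrightarrow> 2 ^ N * r y) (at 0)" for y
      proof -
        have "filterlim (\<lambda>t::complex. 2 * t) (at 0) (at 0)"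
          by (auto simp: filterlim_at intro!: tendsto_eq_intros eventually_mono[OF eventually_neq_at_within])
        then have "((\<lambda>t. d y (2 * t) / (2 * t) ^ N) \<longlongrightarrow> r y) (at 0)"
          by (rule filterlim_compose[OF r])
        then have "((\<lambda>t. 2 ^ N * (d y (2 * t) / (2 * t) ^ N)) \<longlongrightarrow> 2 ^ N * r y) (at 0)"
          by (intro tendsto_intros)
        then show ?thesis by (simp add: power_mult_distrib)
      qed
      have S: "(\<Sum>y\<in>UNIV. chi x y * (f y * r y)) = 0" for x
      proof -
        let ?S = "\<Sum>y\<in>UNIV. chi x y * (f y * r y)"
        \<comment> \<open>The right-hand sides of the two duplication formulas are H^2 and K^2. The
          difference (H - K)(H + K) has leading coefficient 2 S times 8 b, against 4 b 2^N S on the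
          left.\<close>
        define H where "H t = (\<Sum>y\<in>UNIV. chi x y * (h y t)\<^sup>2)" for t
        define K where "K t = (\<Sum>y\<in>UNIV. chi x y * (k y t)\<^sup>2)" for t
        have HK: "H t - K t = (\<Sum>y\<in>UNIV. chi x y * (d y t * (h y t + k y t)))" for t
          unfolding H_def K_def d_def sum_subtractf[symmetric]
          by (intro sum.cong refl) (simp add: power2_eq_square algebra_simps)
        have lim: "((\<lambda>t. (H t - K t) / t ^ N) \<longlongrightarrow> 2 * ?S) (at 0)"
        proof -
          have "((\<lambda>t. \<Sum>y\<in>UNIV. chi x y * (d y t / t ^ N * (h y t + k y t))) \<longlongrightarrow> (\<Sum>y\<in>UNIV. chi x y * (r y * (f y + f y)))) (at 0)"
            by (intro tendsto_intros r cont)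
          also have "(\<Sum>y\<in>UNIV. chi x y * (r y * (f y + f y))) = 2 * ?S"
            unfolding sum_distrib_left by (intro sum.cong refl) (simp add: algebra_simps)
          also have "(\<lambda>t. \<Sum>y\<in>UNIV. chi x y * (d y t / t ^ N * (h y t + k y t))) = (\<lambda>t. (H t - K t) / t ^ N)"
            unfolding HK sum_divide_distrib by (simp add: mult_ac)
          finally show ?thesis .
        qed
        show ?thesis
        proof (cases "b x = 0")
          case True
          then have "H t - K t = 0" for t using van by (simp add: H_def K_def)
          then have "((\<lambda>t::complex. 0) \<longlongrightarrow> 2 * ?S) (at 0)" using lim by simp
          then have "2 * ?S = 0" using tendsto_unique[OF _ _ tendsto_const] trivial_limit_at by metis
          then show ?thesis by simp
        next
          case False
          have limHK: "((\<lambda>t. H t + K t) \<longlongrightarrow> 8 * b x) (at 0)"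
          proof -
            have "((\<lambda>t. H t + K t) \<longlongrightarrow> (\<Sum>y\<in>UNIV. chi x y * (f y)\<^sup>2) + (\<Sum>y\<in>UNIV. chi x y * (f y)\<^sup>2)) (at 0)"
              unfolding H_def K_def by (intro tendsto_intros cont)
            then show ?thesis by (simp flip: b)
          qed
          have eq: "4 * b x * (\<Sum>y\<in>UNIV. chi x y * (f y * (d y (2 * t) / t ^ N))) = (H t - K t) / t ^ N * (H t + K t)" for t
          proof -
            have "4 * b x * (\<Sum>y\<in>UNIV. chi x y * (f y * d y (2 * t)))
                = b x * (\<Sum>y\<in>UNIV. chi x y * (f y * h y (2 * t))) * 4 - b x * (\<Sum>y\<in>UNIV. chi x y * (f y * k y (2 * t))) * 4"
              unfolding d_def by (simp add: algebra_simps sum_subtractf)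
            also have "\<dots> = (H t - K t) * (H t + K t)"
              unfolding dup H_def[symmetric] K_def[symmetric] by (simp add: power2_eq_square algebra_simps)
            finally have "4 * b x * (\<Sum>y\<in>UNIV. chi x y * (f y * d y (2 * t))) / t ^ N = (H t - K t) * (H t + K t) / t ^ N" by simp
            moreover have "(\<Sum>y\<in>UNIV. chi x y * (f y * (d y (2 * t) / t ^ N))) = (\<Sum>y\<in>UNIV. chi x y * (f y * d y (2 * t))) / t ^ N"
              by (simp add: sum_divide_distrib)
            ultimately show ?thesis by simp
          qed
          have "((\<lambda>t. 4 * b x * (\<Sum>y\<in>UNIV. chi x y * (f y * (d y (2 * t) / t ^ N)))) \<longlongrightarrow>
              4 * b x * (\<Sum>y\<in>UNIV. chi x y * (f y * (2 ^ N * r y)))) (at 0)"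
            by (intro tendsto_intros r2)
          moreover have "((\<lambda>t. (H t - K t) / t ^ N * (H t + K t)) \<longlongrightarrow> 2 * ?S * (8 * b x)) (at 0)"
            by (intro tendsto_intros lim limHK)
          ultimately have "4 * b x * (\<Sum>y\<in>UNIV. chi x y * (f y * (2 ^ N * r y))) = 2 * ?S * (8 * b x)"
            unfolding eq using tendsto_unique[OF trivial_limit_at] by blast
          also have "(\<Sum>y\<in>UNIV. chi x y * (f y * (2 ^ N * r y))) = 2 ^ N * ?S"
            by (simp add: sum_distrib_left mult_ac)
          finally have "4 * b x * ((2 ^ N - 4) * ?S) = 0" by (simp add: algebra_simps)
          moreover have "(2 ^ N - 4 :: complex) \<noteq> 0"
          proof -
            have "2 ^ 2 < (2 :: nat) ^ N" using False \<open>\<not> N < 3\<close> by (intro power_strict_increasing) auto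
            then have "(2 :: nat) ^ N \<noteq> 4" by simp
            then have "of_nat (2 ^ N) \<noteq> (of_nat 4 :: complex)" by (simp only: of_nat_eq_iff not_False_eq_True)
            then show ?thesis by simp
          qed
          ultimately show ?thesis using False by simp
        qed
      qed
      have "f y * r y = 0" for y by (rule chi_orthogonal[OF S])
      then show ?thesis using nz by (simp add: r_def)
    qed
  qed
  then have dz: "(deriv ^^ N) (d y) 0 = 0" for N by blast
  have "d y t = 0"
    by (rule holomorphic_fun_eq_0_on_connected[OF hd open_UNIV connected_UNIV dz UNIV_I UNIV_I])
  then show ?thesis by (simp add: d_def)
qed

section \<open>Second order jets\<close>

definition jet2 :: "(complex \<Rightarrow> complex) \<Rightarrow> complex \<Rightarrow> complex \<Rightarrow> complex \<Rightarrow> bool" where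
  "jet2 F a b c \<longleftrightarrow> F holomorphic_on UNIV \<and> F 0 = a \<and> deriv F 0 = b \<and> deriv (deriv F) 0 = c"

lemma jet2_add:
  assumes "jet2 F a b c" "jet2 G a' b' c'"
  shows "jet2 (\<lambda>t. F t + G t) (a + a') (b + b') (c + c')"
proof -
  have h: "F holomorphic_on UNIV" "G holomorphic_on UNIV" using assms by (auto simp: jet2_def)
  note d = entire_differentiable[OF h(1)] entire_differentiable[OF h(2)]
  have 1: "deriv (\<lambda>t. F t + G t) = (\<lambda>t. deriv F t + deriv G t)" using d by (auto intro!: deriv_add)
  show ?thesis unfolding jet2_def 1 using assms h d by (auto simp: jet2_def intro!: holomorphic_intros)
qed

lemma jet2_mult:
  assumes "jet2 F a b c" "jet2 G a' b' c'"
  shows "jet2 (\<lambda>t. F t * G t) (a * a') (a * b' + b * a') (a * c' + 2 * b * b' + c * a')"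
proof -
  have h: "F holomorphic_on UNIV" "G holomorphic_on UNIV" using assms by (auto simp: jet2_def)
  note d = entire_differentiable[OF h(1)] entire_differentiable[OF h(2)]
  have 1: "deriv (\<lambda>t. F t * G t) = (\<lambda>t. F t * deriv G t + deriv F t * G t)" using d by (auto intro!: deriv_mult)
  have "deriv (\<lambda>t. F t * deriv G t + deriv F t * G t) 0 = F 0 * deriv (deriv G) 0 + deriv F 0 * deriv G 0 + (deriv F 0 * deriv G 0 + deriv (deriv F) 0 * G 0)"
    using d by (subst deriv_add) (auto intro!: field_differentiable_mult)
  then show ?thesis unfolding jet2_def 1 using assms h by (auto simp: jet2_def algebra_simps intro!: holomorphic_intros)
qed

lemma jet2_const: "jet2 (\<lambda>t. a) a 0 0"
  by (simp add: jet2_def)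

lemma jet2_cmult: "jet2 F a b c \<Longrightarrow> jet2 (\<lambda>t. k * F t) (k * a) (k * b) (k * c)"
  using jet2_mult[OF jet2_const[of k]] by simp

lemma jet2_double:
  assumes "jet2 F a b c"
  shows "jet2 (\<lambda>t. F (2 * t)) a (2 * b) (4 * c)"
proof -
  have h: "F holomorphic_on UNIV" using assms by (auto simp: jet2_def)
  have dc: "deriv (\<lambda>t. H (2 * t)) t = 2 * deriv H (2 * t)" if "H holomorphic_on UNIV" for H :: "complex \<Rightarrow> complex" and t
  proof -
    have "((\<lambda>t. H (2 * t)) has_field_derivative deriv H (2 * t) * 2) (at t)"
      by (rule DERIV_chain2[where g = "\<lambda>t. 2 * t"])
         (use entire_differentiable(1)[OF that] in \<open>auto simp: DERIV_deriv_iff_field_differentiable intro!: derivative_eq_intros\<close>)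
    then show ?thesis by (simp add: DERIV_imp_deriv mult.commute)
  qed
  have 1: "deriv (\<lambda>t. F (2 * t)) = (\<lambda>t. 2 * deriv F (2 * t))" using dc[OF h] by auto
  have hd: "deriv F holomorphic_on UNIV" using h by (rule holomorphic_deriv) simp
  have hc: "(\<lambda>t. H (2 * t)) holomorphic_on UNIV" if "H holomorphic_on UNIV" for H :: "complex \<Rightarrow> complex"
    using holomorphic_on_compose_gen[of "\<lambda>t. 2 * t" UNIV H UNIV] that by (auto simp: o_def intro!: holomorphic_intros)
  have "deriv (\<lambda>t. 2 * deriv F (2 * t)) 0 = 2 * (2 * deriv (deriv F) (2 * 0))"
    unfolding dc[OF hd, symmetric] using entire_differentiable(1)[OF hc[OF hd]] by (intro deriv_cmult)
  then show ?thesis unfolding jet2_def 1 using assms hc[OF h] by (auto simp: jet2_def)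
qed

lemma jet2_even:
  assumes "jet2 F a b c" "\<And>t. F (- t) = F t"
  shows "b = 0"
proof -
  have h: "F holomorphic_on UNIV" using assms by (auto simp: jet2_def)
  have "((\<lambda>t. F (- t)) has_field_derivative deriv F (- 0) * - 1) (at 0)"
    by (rule DERIV_chain2[where g = "\<lambda>t. - t"])
       (use entire_differentiable(1)[OF h] in \<open>auto simp: DERIV_deriv_iff_field_differentiable intro!: derivative_eq_intros\<close>)
  then have "(F has_field_derivative - deriv F 0) (at 0)" using assms(2) by simp
  then have "deriv F 0 = - deriv F 0" by (rule DERIV_imp_deriv)
  then show ?thesis using assms(1) by (simp add: jet2_def)
qed

lemma jet2_unique: "jet2 F a b c \<Longrightarrow> jet2 F a' b' c' \<Longrightarrow> a = a' \<and> b = b' \<and> c = c'"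
  by (simp add: jet2_def)

lemma jet2_exp: "jet2 (\<lambda>t. exp (p * t\<^sup>2)) 1 0 (2 * p)"
proof -
  have 1: "deriv (\<lambda>t. exp (p * t\<^sup>2)) = (\<lambda>t. 2 * p * t * exp (p * t\<^sup>2))"
    by (rule ext, rule DERIV_imp_deriv) (auto intro!: derivative_eq_intros)
  have "deriv (\<lambda>t. 2 * p * t * exp (p * t\<^sup>2)) 0 = 2 * p"
    by (rule DERIV_imp_deriv) (auto intro!: derivative_eq_intros)
  then show ?thesis unfolding jet2_def 1 by (auto intro!: holomorphic_intros)
qed

lemma entire2_even_jet:
  assumes "entire2 G" "\<And>u. G (- u) = G u"
  obtains q where "\<And>w. jet2 (\<lambda>t. G (t *s w)) (G 0) 0 (2 * qform q w)"
proof -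
  obtain q where q: "\<And>w. deriv (deriv (\<lambda>t. G (t *s w))) 0 = 2 * qform q w"
    using assms(1) unfolding entire2_def by blast
  have "jet2 (\<lambda>t. G (t *s w)) (G 0) 0 (2 * qform q w)" for w
  proof -
    have j: "jet2 (\<lambda>t. G (t *s w)) (G 0) (deriv (\<lambda>t. G (t *s w)) 0) (2 * qform q w)"
      unfolding jet2_def using q entire2_holomorphic_0[OF assms(1)] by auto
    moreover have "deriv (\<lambda>t. G (t *s w)) 0 = 0"
    proof (rule jet2_even[OF j])
      fix t
      have "(- t) *s w = - (t *s w)" by (simp add: vec_eq_iff)
      then show "G ((- t) *s w) = G (t *s w)" by (simp only: assms(2))
    qed
    ultimately show ?thesis by simp
  qed
  then show thesis by (rule that)
qed

lemma entire2_odd_jet: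
  assumes "entire2 G" "\<And>u. G (- u) = - G u"
  obtains l where "\<And>w. \<exists>c. jet2 (\<lambda>t. G (t *s w)) 0 (bdot l w) c"
proof -
  obtain l where l: "\<And>w. deriv (\<lambda>t. G (t *s w)) 0 = bdot l w"
    using assms(1) unfolding entire2_def by blast
  have "G 0 = 0" using assms(2)[of 0] by simp
  then have "jet2 (\<lambda>t. G (t *s w)) 0 (bdot l w) (deriv (deriv (\<lambda>t. G (t *s w))) 0)" for w
    unfolding jet2_def using l entire2_holomorphic_0[OF assms(1)] by auto
  then show thesis using that by blast
qed

definition sq :: "complex^2 \<Rightarrow> complex^3" where
  "sq l = vector [(l $ 1)\<^sup>2, 2 * l $ 1 * l $ 2, (l $ 2)\<^sup>2]"

lemma qform_sq: "qform (sq l) w = (bdot l w)\<^sup>2"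
  by (simp add: sq_def qform_def bdot_2 vector_3 power2_eq_square algebra_simps)

lemma bil_sq: "bil (sq l) (sq l) = 0"
  by (simp add: sq_def bil_def vector_3 power2_eq_square algebra_simps)

text \<open>The squares of the odd functions B and B' begin with the squares of linear forms l and
  l'. Comparing second-order terms gives 2e = -(l^2 + l'^2) and 2e' = -(l^2 - l'^2). As l^2 and l'^2
  are isotropic, only their mutual product survives, and it cancels in both claims.\<close>

lemma pairing_isotropic:
  assumes j: "\<And>w. jet2 (\<lambda>t. ga (t *s w)) fa 0 (2 * qform qa w)" "\<And>w. jet2 (\<lambda>t. gb (t *s w)) fb 0 (2 * qform qb w)"
    "\<And>w. jet2 (\<lambda>t. gc (t *s w)) fc 0 (2 * qform qc w)" "\<And>w. jet2 (\<lambda>t. gd (t *s w)) fd 0 (2 * qform qd w)"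
    and B: "entire2 B" "\<And>u. B (- u) = - B u" "entire2 B'" "\<And>u. B' (- u) = - B' u"
    and eq: "\<And>u. ga (u + u) * fb - gb (u + u) * fa = - 2 * ((B u)\<^sup>2 + (B' u)\<^sup>2)"
      "\<And>u. gc (u + u) * fd - gd (u + u) * fc = - 2 * ((B u)\<^sup>2 - (B' u)\<^sup>2)"
  shows "bil (fb *s qa - fa *s qb) (fd *s qc - fc *s qd) = 0"
    "bil (fb *s qa - fa *s qb) (fb *s qa - fa *s qb) + bil (fd *s qc - fc *s qd) (fd *s qc - fc *s qd) = 0"
proof -
  obtain l where l: "\<And>w. \<exists>c. jet2 (\<lambda>t. B (t *s w)) 0 (bdot l w) c" using entire2_odd_jet B by blast
  obtain l' where l': "\<And>w. \<exists>c. jet2 (\<lambda>t. B' (t *s w)) 0 (bdot l' w) c" using entire2_odd_jet B by blast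
  define e e' where "e = fb *s qa - fa *s qb" and "e' = fd *s qc - fc *s qd"
  have dbl: "t *s w + t *s w = (2 * t) *s w" for t and w :: "complex^2" by (simp add: vec_eq_iff)
  have e: "2 *s e = - (sq l + sq l')" "2 *s e' = - (sq l - sq l')"
  proof -
    have "qform (2 *s e) w = qform (- (sq l + sq l')) w \<and> qform (2 *s e') w = qform (- (sq l - sq l')) w" for w
    proof -
      obtain c where c: "jet2 (\<lambda>t. B (t *s w)) 0 (bdot l w) c" using l by blast
      obtain c' where c': "jet2 (\<lambda>t. B' (t *s w)) 0 (bdot l' w) c'" using l' by blast
      note P = jet2_mult[OF c c] and P' = jet2_mult[OF c' c']
      have cancel: "2 * X = - Y" if "4 * X = - 2 * Y" for X Y :: complex
      proof -
        have "2 * (2 * X) = 2 * (- Y)" using that by simp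
        then show ?thesis by (simp only: mult_cancel_left) simp
      qed
      have m: "qform (- v) w = - qform v w" for v using qform_scale[of "-1" v w] by (simp add: qform_def)
      have "4 * qform e w = - 2 * (bdot l w * bdot l w + bdot l' w * bdot l' w)"
      proof -
        note L = jet2_add[OF jet2_cmult[OF jet2_double[OF j(1)[of w]], of fb] jet2_cmult[OF jet2_double[OF j(2)[of w]], of "- fa"]]
        note R = jet2_cmult[OF jet2_add[OF P P'], of "-2"]
        have f: "(\<lambda>t. fb * ga ((2 * t) *s w) + - fa * gb ((2 * t) *s w)) = (\<lambda>t. - 2 * (B (t *s w) * B (t *s w) + B' (t *s w) * B' (t *s w)))"
          using eq(1)[of "_ *s w"] unfolding dbl by (simp add: fun_eq_iff power2_eq_square mult_ac)
        have "fb * (4 * (2 * qform qa w)) + - fa * (4 * (2 * qform qb w)) = - 2 * (2 * bdot l w * bdot l w + 2 * bdot l' w * bdot l' w)"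
          using jet2_unique[OF L R[folded f]] by simp
        then show ?thesis unfolding e_def qform_diff qform_scale by algebra
      qed
      moreover have "4 * qform e' w = - 2 * (bdot l w * bdot l w - bdot l' w * bdot l' w)"
      proof -
        note L = jet2_add[OF jet2_cmult[OF jet2_double[OF j(3)[of w]], of fd] jet2_cmult[OF jet2_double[OF j(4)[of w]], of "- fc"]]
        note R = jet2_cmult[OF jet2_add[OF P jet2_cmult[OF P', of "-1"]], of "-2"]
        have f: "(\<lambda>t. fd * gc ((2 * t) *s w) + - fc * gd ((2 * t) *s w)) = (\<lambda>t. - 2 * (B (t *s w) * B (t *s w) + -1 * (B' (t *s w) * B' (t *s w))))"
          using eq(2)[of "_ *s w"] unfolding dbl by (simp add: fun_eq_iff power2_eq_square mult_ac)
        have "fd * (4 * (2 * qform qc w)) + - fc * (4 * (2 * qform qd w)) = - 2 * (2 * bdot l w * bdot l w + -1 * (2 * bdot l' w * bdot l' w))"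
          using jet2_unique[OF L R[folded f]] by simp
        then show ?thesis unfolding e'_def qform_diff qform_scale by algebra
      qed
      ultimately show ?thesis
        unfolding m qform_add qform_diff qform_scale qform_sq power2_eq_square
        using cancel by blast
    qed
    then show "2 *s e = - (sq l + sq l')" "2 *s e' = - (sq l - sq l')" by (auto intro: qform_inject)
  qed
  have "4 * bil e e' = bil (2 *s e) (2 *s e')" "4 * (bil e e + bil e' e') = bil (2 *s e) (2 *s e) + bil (2 *s e') (2 *s e')"
    by (simp_all add: bil_simps)
  moreover have "bil (2 *s e) (2 *s e') = 0" "bil (2 *s e) (2 *s e) + bil (2 *s e') (2 *s e') = 0"
    unfolding e by (simp_all add: bil_simps bil_sq bil_commute[of "sq l'" "sq l"])
  ultimately show "bil e e' = 0" "bil e e + bil e' e' = 0"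
    by (metis mult_eq_0_iff zero_neq_numeral)+
qed

lemma pairing_degenerate:
  assumes j: "\<And>w. jet2 (\<lambda>t. ga (t *s w)) fa 0 (2 * qform qa w)" "\<And>w. jet2 (\<lambda>t. gb (t *s w)) fb 0 (2 * qform qb w)"
    "\<And>w. jet2 (\<lambda>t. gc (t *s w)) fc 0 (2 * qform qc w)" "\<And>w. jet2 (\<lambda>t. gd (t *s w)) fd 0 (2 * qform qd w)"
    and eq: "\<And>u. ga u * gb u = s * (gc u * gd u)"
  shows "fb *s qa + fa *s qb = s *s (fd *s qc + fc *s qd)"
proof (rule qform_inject)
  fix w
  note L = jet2_mult[OF j(1)[of w] j(2)[of w]] and R = jet2_cmult[OF jet2_mult[OF j(3)[of w] j(4)[of w]], of s]
  have f: "(\<lambda>t. ga (t *s w) * gb (t *s w)) = (\<lambda>t. s * (gc (t *s w) * gd (t *s w)))" using eq by simp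
  have "fa * (2 * qform qb w) + 2 * qform qa w * fb = s * (fc * (2 * qform qd w) + 2 * qform qc w * fd)"
    using jet2_unique[OF L R[folded f]] by simp
  then have "2 * qform (fb *s qa + fa *s qb) w = 2 * qform (s *s (fd *s qc + fc *s qd)) w"
    unfolding qform_add qform_scale by algebra
  then show "qform (fb *s qa + fa *s qb) w = qform (s *s (fd *s qc + fc *s qd)) w" by simp
qed

section \<open>Kummer systems\<close>

text \<open>Collects what the argument uses of the pair \<open>half_theta\<close>,
  \<open>quarter_theta\<close>, so that it also applies after the change of basis
  \<open>hat\<close>.\<close>

definition kummer :: "(f2 \<Rightarrow> complex^2 \<Rightarrow> complex) \<Rightarrow> (f2 \<Rightarrow> f2 \<Rightarrow> complex^2 \<Rightarrow> complex) \<Rightarrow> bool" where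
  "kummer g B \<longleftrightarrow> (\<forall>y. entire2 (g y)) \<and> (\<forall>x d. entire2 (B x d)) \<and>
     (\<forall>y d u v. g y (u + v) * g (xor2 y d) (u - v) = (\<Sum>x\<in>UNIV. chi x y * (B x d u * B x d (- v)))) \<and>
     (\<forall>x d u. B x d (- u) = chi x d * B x d u) \<and> (\<forall>y u. g y (- u) = g y u)"

lemma kummerD:
  assumes "kummer g B"
  shows "entire2 (g y)" "entire2 (B x d)"
    "g y (u + v) * g (xor2 y d) (u - v) = (\<Sum>x\<in>UNIV. chi x y * (B x d u * B x d (- v)))"
    "B x d (- u) = chi x d * B x d u" "g y (- u) = g y u"
  using assms unfolding kummer_def by blast+

lemma kummer_double:
  assumes "kummer g B"
  shows "g y (u + u) * g (xor2 y d) 0 = (\<Sum>x\<in>UNIV. chi x y * (chi x d * (B x d u)\<^sup>2))"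
  using kummerD(3)[OF assms, of y u u d] by (simp add: kummerD(4)[OF assms] power2_eq_square mult_ac)

lemma kummer_square:
  assumes "kummer g B"
  shows "g y u * g (xor2 y d) u = (\<Sum>x\<in>UNIV. chi x y * (B x d u * B x d 0))"
  using kummerD(3)[OF assms, of y u 0 d] by simp

text \<open>For d = 0, Fourier inversion in y turns the case v = 0 of the addition formula into 4
  B_x(u) B_x(0) and the case v = u into 4 B_x(u)^2. Eliminating B_x(u) gives the duplication
  formula.\<close>

lemma kummer_duplication:
  assumes "kummer g B"
  defines "b \<equiv> \<lambda>x. (B x (False, False) 0)\<^sup>2"
  shows "4 * b x = (\<Sum>y\<in>UNIV. chi x y * (g y 0)\<^sup>2)"
    "b x * (\<Sum>y\<in>UNIV. chi x y * (g y 0 * g y (u + u))) * 4 = (\<Sum>y\<in>UNIV. chi x y * (g y u)\<^sup>2)\<^sup>2"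
    "b x = 0 \<Longrightarrow> (\<Sum>y\<in>UNIV. chi x y * (g y u)\<^sup>2) = 0"
proof -
  have x0: "xor2 y (False, False) = y" for y by (simp add: xor2_def)
  have sqr: "(\<Sum>y\<in>UNIV. chi x y * (g y u)\<^sup>2) = 4 * (B x (False, False) u * B x (False, False) 0)" for u
    unfolding power2_eq_square kummer_square[OF assms(1), where d = "(False, False)", unfolded x0]
    by (cases x) (auto simp: sum_f2 chi_def)
  have dbl: "(\<Sum>y\<in>UNIV. chi x y * (g y 0 * g y (u + u))) = 4 * (B x (False, False) u)\<^sup>2"
    unfolding mult.commute[of "g _ 0"] kummer_double[OF assms(1), where d = "(False, False)", unfolded x0]
    by (cases x) (auto simp: sum_f2 chi_def)
  show "4 * b x = (\<Sum>y\<in>UNIV. chi x y * (g y 0)\<^sup>2)"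
    unfolding sqr b_def by (simp add: power2_eq_square)
  show "b x * (\<Sum>y\<in>UNIV. chi x y * (g y 0 * g y (u + u))) * 4 = (\<Sum>y\<in>UNIV. chi x y * (g y u)\<^sup>2)\<^sup>2"
    unfolding sqr dbl b_def by (simp add: power2_eq_square)
  show "b x = 0 \<Longrightarrow> (\<Sum>y\<in>UNIV. chi x y * (g y u)\<^sup>2) = 0"
    unfolding sqr b_def by simp
qed

lemma kummer_jets:
  assumes "kummer g B"
  obtains q where "\<And>y w. jet2 (\<lambda>t. g y (t *s w)) (g y 0) 0 (2 * qform (q y) w)"
proof -
  have "\<exists>q. \<forall>w. jet2 (\<lambda>t. g y (t *s w)) (g y 0) 0 (2 * qform q w)" for y
    using entire2_even_jet[OF kummerD(1)[OF assms] kummerD(5)[OF assms], of y] by metis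
  then show thesis using that by metis
qed

text \<open>The part of \<open>qcond\<close> that belongs to one splitting {a, b}, {c, d}; it is
  instantiated for the three splittings. The p are the 2-jets after division by the constant
  term.\<close>

lemma pairing_conditions:
  assumes j: "\<And>w. jet2 (\<lambda>t. ga (t *s w)) (ga 0) 0 (2 * qform qa w)" "\<And>w. jet2 (\<lambda>t. gb (t *s w)) (gb 0) 0 (2 * qform qb w)"
    "\<And>w. jet2 (\<lambda>t. gc (t *s w)) (gc 0) 0 (2 * qform qc w)" "\<And>w. jet2 (\<lambda>t. gd (t *s w)) (gd 0) 0 (2 * qform qd w)"
    and nz: "ga 0 \<noteq> 0" "gb 0 \<noteq> 0" "gc 0 \<noteq> 0" "gd 0 \<noteq> 0"
    and B: "entire2 B" "\<And>u. B (- u) = - B u" "entire2 B'" "\<And>u. B' (- u) = - B' u"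
    and eq: "\<And>u. ga (u + u) * gb 0 - gb (u + u) * ga 0 = - 2 * ((B u)\<^sup>2 + (B' u)\<^sup>2)"
      "\<And>u. gc (u + u) * gd 0 - gd (u + u) * gc 0 = - 2 * ((B u)\<^sup>2 - (B' u)\<^sup>2)"
    and E: "\<And>u. ga u * gb u + gc u * gd u = 2 * (E u * E 0)" "\<And>u. ga u * gb u - gc u * gd u = 2 * (E' u * E' 0)"
  defines "pa \<equiv> (1 / ga 0) *s qa" and "pb \<equiv> (1 / gb 0) *s qb" and "pc \<equiv> (1 / gc 0) *s qc" and "pd \<equiv> (1 / gd 0) *s qd"
  shows "bil (pa - pb) (pc - pd) = 0"
    "(ga 0 * gb 0)\<^sup>2 * bil (pa - pb) (pa - pb) + (gc 0 * gd 0)\<^sup>2 * bil (pc - pd) (pc - pd) = 0"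
    "(ga 0 * gb 0)\<^sup>2 = (gc 0 * gd 0)\<^sup>2 \<Longrightarrow> pa + pb = pc + pd"
proof -
  have e: "gb 0 *s qa - ga 0 *s qb = (ga 0 * gb 0) *s (pa - pb)" "gd 0 *s qc - gc 0 *s qd = (gc 0 * gd 0) *s (pc - pd)"
    using nz by (simp_all add: pa_def pb_def pc_def pd_def vec_eq_iff field_simps)
  have e': "gb 0 *s qa + ga 0 *s qb = (ga 0 * gb 0) *s (pa + pb)" "gd 0 *s qc + gc 0 *s qd = (gc 0 * gd 0) *s (pc + pd)"
    using nz by (simp_all add: pa_def pb_def pc_def pd_def vec_eq_iff field_simps)
  note i = pairing_isotropic[OF j B eq, unfolded e]
  show "bil (pa - pb) (pc - pd) = 0" using i(1) nz unfolding bil_simps(5,6) by simp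
  show "(ga 0 * gb 0)\<^sup>2 * bil (pa - pb) (pa - pb) + (gc 0 * gd 0)\<^sup>2 * bil (pc - pd) (pc - pd) = 0"
    using i(2) unfolding bil_simps(5,6) by (simp add: power2_eq_square mult.assoc)
  assume "(ga 0 * gb 0)\<^sup>2 = (gc 0 * gd 0)\<^sup>2"
  \<comment> \<open>At u = 0 this forces E' 0 = 0 or E 0 = 0, and by \<open>E\<close> the relation
    ga gb = s gc gd with s = 1 or s = -1 then holds at every u.\<close>
  then have "ga 0 * gb 0 = gc 0 * gd 0 \<or> ga 0 * gb 0 = - (gc 0 * gd 0)" by (simp add: power2_eq_iff)
  then obtain s where s: "s * s = 1" "ga 0 * gb 0 = s * (gc 0 * gd 0)" "\<And>u. ga u * gb u = s * (gc u * gd u)"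
  proof
    assume a: "ga 0 * gb 0 = gc 0 * gd 0"
    then have "E' 0 = 0" using E(2)[of 0] by simp
    then have "ga u * gb u = 1 * (gc u * gd u)" for u using E(2)[of u] by simp
    then show thesis using that[of 1] a by simp
  next
    assume a: "ga 0 * gb 0 = - (gc 0 * gd 0)"
    then have "E 0 = 0" using E(1)[of 0] by simp
    then have "ga u * gb u = (-1) * (gc u * gd u)" for u using E(1)[of u] by (simp add: add_eq_0_iff2)
    then show thesis using that[of "-1"] a by simp
  qed
  have "(ga 0 * gb 0) *s (pa + pb) = s *s ((gc 0 * gd 0) *s (pc + pd))"
    using pairing_degenerate[OF j s(3)] unfolding e' .
  also have "\<dots> = (ga 0 * gb 0) *s (pc + pd)" unfolding s(2) by simp
  finally have "(ga 0 * gb 0) * (pa + pb) $ i = (ga 0 * gb 0) * (pc + pd) $ i" for i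
    by (metis vector_smult_component)
  then show "pa + pb = pc + pd" using nz unfolding vec_eq_iff by (metis mult_cancel_left mult_eq_0_iff)
qed

lemma kummer_qcond:
  assumes k: "kummer g B" and nz: "\<And>y. g y 0 \<noteq> 0"
    and q: "\<And>y w. jet2 (\<lambda>t. g y (t *s w)) (g y 0) 0 (2 * qform (q y) w)"
  defines "p \<equiv> \<lambda>y. (1 / g y 0) *s q y"
  shows "qcond (g (False, False) 0) (g (False, True) 0) (g (True, False) 0) (g (True, True) 0)
    (p (False, False)) (p (False, True)) (p (True, False)) (p (True, True))"
proof -
  note ent = kummerD(2)[OF k]
  note par = kummerD(4)[OF k]
  note D = kummer_double[OF k] and S = kummer_square[OF k]
  let ?a = "(False, False)" and ?b = "(False, True)" and ?c = "(True, False)" and ?d = "(True, True)"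
  \<comment> \<open>The six odd characteristics: two x for each nonzero d, and each such d splits
    the four functions into two pairs.\<close>
  have od: "B x d (- u) = - B x d u" if "(x, d) \<in> {(?b, ?b), (?d, ?b), (?c, ?c), (?d, ?c), (?c, ?d), (?b, ?d)}" for x d u
    using that par[of x d u] by (auto simp: chi_def)
  have odd: "\<And>u. B ?b ?b (- u) = - B ?b ?b u" "\<And>u. B ?d ?b (- u) = - B ?d ?b u"
    "\<And>u. B ?c ?c (- u) = - B ?c ?c u" "\<And>u. B ?d ?c (- u) = - B ?d ?c u"
    "\<And>u. B ?c ?d (- u) = - B ?c ?d u" "\<And>u. B ?b ?d (- u) = - B ?b ?d u"
    by (rule od; simp)+
  have B0: "B ?b ?b 0 = 0" "B ?d ?b 0 = 0" "B ?c ?c 0 = 0" "B ?d ?c 0 = 0" "B ?c ?d 0 = 0" "B ?b ?d 0 = 0"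
    using odd[of 0] by simp_all
  note simps = sum_f2 chi_def xor2_def fst_conv snd_conv simp_thms if_True if_False mult_1_left mult_minus_left mult_minus_right B0 mult_zero_right
  have 1: "g ?a (u + u) * g ?b 0 - g ?b (u + u) * g ?a 0 = - 2 * ((B ?b ?b u)\<^sup>2 + (B ?d ?b u)\<^sup>2)"
    "g ?c (u + u) * g ?d 0 - g ?d (u + u) * g ?c 0 = - 2 * ((B ?b ?b u)\<^sup>2 - (B ?d ?b u)\<^sup>2)"
    "g ?a u * g ?b u + g ?c u * g ?d u = 2 * (B ?a ?b u * B ?a ?b 0)"
    "g ?a u * g ?b u - g ?c u * g ?d u = 2 * (B ?c ?b u * B ?c ?b 0)" for u
    unfolding D[of ?a u ?b, unfolded simps] D[of ?b u ?b, unfolded simps]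
      D[of ?c u ?b, unfolded simps] D[of ?d u ?b, unfolded simps]
      S[of ?a u ?b, unfolded simps] S[of ?c u ?b, unfolded simps]
    by (simp_all add: algebra_simps)
  have 2: "g ?a (u + u) * g ?c 0 - g ?c (u + u) * g ?a 0 = - 2 * ((B ?c ?c u)\<^sup>2 + (B ?d ?c u)\<^sup>2)"
    "g ?b (u + u) * g ?d 0 - g ?d (u + u) * g ?b 0 = - 2 * ((B ?c ?c u)\<^sup>2 - (B ?d ?c u)\<^sup>2)"
    "g ?a u * g ?c u + g ?b u * g ?d u = 2 * (B ?a ?c u * B ?a ?c 0)"
    "g ?a u * g ?c u - g ?b u * g ?d u = 2 * (B ?b ?c u * B ?b ?c 0)" for u
    unfolding D[of ?a u ?c, unfolded simps] D[of ?c u ?c, unfolded simps]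
      D[of ?b u ?c, unfolded simps] D[of ?d u ?c, unfolded simps]
      S[of ?a u ?c, unfolded simps] S[of ?b u ?c, unfolded simps]
    by (simp_all add: algebra_simps)
  have 3: "g ?a (u + u) * g ?d 0 - g ?d (u + u) * g ?a 0 = - 2 * ((B ?c ?d u)\<^sup>2 + (B ?b ?d u)\<^sup>2)"
    "g ?b (u + u) * g ?c 0 - g ?c (u + u) * g ?b 0 = - 2 * ((B ?c ?d u)\<^sup>2 - (B ?b ?d u)\<^sup>2)"
    "g ?a u * g ?d u + g ?b u * g ?c u = 2 * (B ?a ?d u * B ?a ?d 0)"
    "g ?a u * g ?d u - g ?b u * g ?c u = 2 * (B ?d ?d u * B ?d ?d 0)" for u
    unfolding D[of ?a u ?d, unfolded simps] D[of ?d u ?d, unfolded simps]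
      D[of ?b u ?d, unfolded simps] D[of ?c u ?d, unfolded simps]
      S[of ?a u ?d, unfolded simps] S[of ?b u ?d, unfolded simps]
    by (simp_all add: algebra_simps)
  note c1 = pairing_conditions[OF q[of ?a] q[of ?b] q[of ?c] q[of ?d] nz nz nz nz ent odd(1) ent odd(2) 1]
  note c2 = pairing_conditions[OF q[of ?a] q[of ?c] q[of ?b] q[of ?d] nz nz nz nz ent odd(3) ent odd(4) 2]
  note c3 = pairing_conditions[OF q[of ?a] q[of ?d] q[of ?b] q[of ?c] nz nz nz nz ent odd(5) ent odd(6) 3]
  show ?thesis
    unfolding qcond_def p_def using c1 c2 c3 by blast
qed

lemma f2_cases: "P (False, False) \<Longrightarrow> P (False, True) \<Longrightarrow> P (True, False) \<Longrightarrow> P (True, True) \<Longrightarrow> P y"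
  by (cases y) (metis (full_types))

theorem kummer_congruent:
  assumes k: "kummer g B" "kummer g' B'" and f: "\<And>y. g y 0 = g' y 0" and nz: "\<And>y. g y 0 \<noteq> 0"
    and ng: "\<And>w p. (\<And>t y. g y (t *s w) = g y 0 * exp (p * t\<^sup>2)) \<Longrightarrow> w = 0"
      "\<And>w p. (\<And>t y. g' y (t *s w) = g' y 0 * exp (p * t\<^sup>2)) \<Longrightarrow> w = 0"
  obtains M l where "invertible M" "\<And>y w. g' y (M *v w) = exp (qform l w) * g y w"
proof -
  note D = kummer_duplication
  have dbl: "(2 * t) *s w = t *s w + t *s w" for t and w :: "complex^2" by (simp add: vec_eq_iff)
  \<comment> \<open>The comparison functions h only have to satisfy the duplication formula:
    constants serve to exclude a degenerate tetrahedron, g along w serves for the conclusion. A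
    Gaussian factor respects the formula because exp(c (2t)^2) is the fourth power of exp(c
    t^2).\<close>
  have unique: "g' y (t *s w') = exp (c * t\<^sup>2) * h y t"
    if k: "kummer g B" "kummer g' B'" and f: "\<And>y. g y 0 = g' y 0" and nz: "\<And>y. g y 0 \<noteq> 0"
      and q': "\<And>y. jet2 (\<lambda>t. g' y (t *s w')) (g' y 0) 0 (2 * qform (q' y) w')"
      and h: "\<And>y. jet2 (h y) (g y 0) 0 (2 * r y)"
      and r: "\<And>y. qform (q' y) w' = r y + g y 0 * c"
      and dup: "\<And>x t. (B x (False, False) 0)\<^sup>2 * (\<Sum>y\<in>UNIV. chi x y * (g y 0 * h y (2 * t))) * 4 = (\<Sum>y\<in>UNIV. chi x y * (h y t)\<^sup>2)\<^sup>2"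
      and van: "\<And>x t. (B x (False, False) 0)\<^sup>2 = 0 \<Longrightarrow> (\<Sum>y\<in>UNIV. chi x y * (h y t)\<^sup>2) = 0"
    for g B g' B' q' h r y t c w'
  proof -
    have b: "(B' x (False, False) 0)\<^sup>2 = (B x (False, False) 0)\<^sup>2" for x
      using D(1)[OF k(1), of x] D(1)[OF k(2), of x] unfolding f by (metis mult_cancel_left zero_neq_numeral)
    have E: "jet2 (\<lambda>t. exp (c * t\<^sup>2) * h y t) (g y 0) 0 (2 * r y + 2 * c * g y 0)" for y
      using jet2_mult[OF jet2_exp[of c] h[of y]] by simp
    show ?thesis
    proof (rule duplication_unique[where h = "\<lambda>y t. g' y (t *s w')" and k = "\<lambda>y t. exp (c * t\<^sup>2) * h y t"
          and f = "\<lambda>y. g y 0" and b = "\<lambda>x. (B x (False, False) 0)\<^sup>2"])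
      show "(\<lambda>t. g' y (t *s w')) holomorphic_on UNIV" "(\<lambda>t. exp (c * t\<^sup>2) * h y t) holomorphic_on UNIV" for y
        using q'[of y] E[of y] by (simp_all add: jet2_def)
      show "deriv (\<lambda>t. g' y (t *s w')) 0 = deriv (\<lambda>t. exp (c * t\<^sup>2) * h y t) 0" for y
        using q'[of y] E[of y] by (simp add: jet2_def)
      show "deriv (deriv (\<lambda>t. g' y (t *s w'))) 0 = deriv (deriv (\<lambda>t. exp (c * t\<^sup>2) * h y t)) 0" for y
        using q'[of y] E[of y] r[of y] by (simp add: jet2_def algebra_simps)
      show "exp (c * 0\<^sup>2) * h y 0 = g y 0" for y using h[of y] by (simp add: jet2_def)
      show "g' y (0 *s w') = g y 0" for y using f by simp
      show "4 * (B x (False, False) 0)\<^sup>2 = (\<Sum>y\<in>UNIV. chi x y * (g y 0)\<^sup>2)" for x by (rule D(1)[OF k(1)])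
      show "(B x (False, False) 0)\<^sup>2 * (\<Sum>y\<in>UNIV. chi x y * (g y 0 * g' y ((2 * t) *s w'))) * 4 = (\<Sum>y\<in>UNIV. chi x y * (g' y (t *s w'))\<^sup>2)\<^sup>2" for x t
        using D(2)[OF k(2), of x "t *s w'"] unfolding b dbl f .
      show "(\<Sum>y\<in>UNIV. chi x y * (g' y (t *s w'))\<^sup>2) = 0" if "(B x (False, False) 0)\<^sup>2 = 0" for x t
        using D(3)[OF k(2), of x "t *s w'"] that unfolding b by simp
      have s: "(\<Sum>y\<in>UNIV. chi x y * (exp (c * t\<^sup>2) * h y t)\<^sup>2) = (exp (c * t\<^sup>2))\<^sup>2 * (\<Sum>y\<in>UNIV. chi x y * (h y t)\<^sup>2)" for x t
        by (simp add: sum_distrib_left power_mult_distrib mult_ac)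
      show "(\<Sum>y\<in>UNIV. chi x y * (exp (c * t\<^sup>2) * h y t)\<^sup>2) = 0" if "(B x (False, False) 0)\<^sup>2 = 0" for x t
        unfolding s using van[OF that] by simp
      show "(B x (False, False) 0)\<^sup>2 * (\<Sum>y\<in>UNIV. chi x y * (g y 0 * (exp (c * (2 * t)\<^sup>2) * h y (2 * t)))) * 4 = (\<Sum>y\<in>UNIV. chi x y * (exp (c * t\<^sup>2) * h y t)\<^sup>2)\<^sup>2" for x t
      proof -
        have e: "exp (c * (2 * t)\<^sup>2) = ((exp (c * t\<^sup>2))\<^sup>2)\<^sup>2"
          by (simp add: power2_eq_square mult_ac flip: exp_add)
        have "(\<Sum>y\<in>UNIV. chi x y * (g y 0 * (exp (c * (2 * t)\<^sup>2) * h y (2 * t)))) = exp (c * (2 * t)\<^sup>2) * (\<Sum>y\<in>UNIV. chi x y * (g y 0 * h y (2 * t)))"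
          by (simp add: sum_distrib_left mult_ac)
        then show ?thesis unfolding s power_mult_distrib[of "(exp (c * t\<^sup>2))\<^sup>2"] dup[symmetric] e by (simp add: mult_ac)
      qed
    qed (rule nz)
  qed
  let ?a = "(False, False)" and ?b = "(False, True)" and ?c = "(True, False)" and ?d = "(True, True)"
  \<comment> \<open>Otherwise the four jets agree along some w. Constants times a Gaussian have the
    same jets there, so by \<open>unique\<close> the g_y are of this form on the line, which
    \<open>ng\<close> forbids.\<close>
  have nondeg: "bil (p ?a - p ?b) (p ?a - p ?b) \<noteq> 0 \<or> bil (p ?a - p ?c) (p ?a - p ?c) \<noteq> 0 \<or> bil (p ?a - p ?d) (p ?a - p ?d) \<noteq> 0"
    if k: "kummer g B" and nz: "\<And>y. g y 0 \<noteq> 0"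
      and ng: "\<And>w p. (\<And>t y. g y (t *s w) = g y 0 * exp (p * t\<^sup>2)) \<Longrightarrow> w = 0"
      and q: "\<And>y w. jet2 (\<lambda>t. g y (t *s w)) (g y 0) 0 (2 * qform (q y) w)"
      and p: "p = (\<lambda>y. (1 / g y 0) *s q y)" for g B q p
  proof (rule ccontr)
    assume "\<not> ?thesis"
    then have z: "bil (p ?a - p ?b) (p ?a - p ?b) = 0" "bil (p ?a - p ?c) (p ?a - p ?c) = 0" "bil (p ?a - p ?d) (p ?a - p ?d) = 0"
      by auto
    have qc: "qcond (g ?a 0) (g ?b 0) (g ?c 0) (g ?d 0) (p ?a) (p ?b) (p ?c) (p ?d)"
      unfolding p by (rule kummer_qcond[OF k nz q])
    obtain w where w: "w \<noteq> 0" "qform (p ?b) w = qform (p ?a) w" "qform (p ?c) w = qform (p ?a) w" "qform (p ?d) w = qform (p ?a) w"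
      using qcond_common_root[OF qc nz nz nz nz z] by blast
    have wy: "qform (p y) w = qform (p ?a) w" for y by (rule f2_cases[of _ y]) (use w in simp_all)
    have "g y (t *s w) = exp (qform (p ?a) w * t\<^sup>2) * g y 0" for y t
    proof (rule unique[OF k k refl nz q, where r = "\<lambda>y. 0"])
      show "jet2 (\<lambda>t. g y 0) (g y 0) 0 (2 * 0)" for y using jet2_const by simp
      show "qform (q y) w = 0 + g y 0 * qform (p ?a) w" for y
        using wy[of y] nz[of y] unfolding p qform_scale by (simp add: field_simps)
      show "(B x ?a 0)\<^sup>2 * (\<Sum>y\<in>UNIV. chi x y * (g y 0 * g y 0)) * 4 = (\<Sum>y\<in>UNIV. chi x y * (g y 0)\<^sup>2)\<^sup>2" for x
        using D(2)[OF k, of x 0] by simp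
      show "(\<Sum>y\<in>UNIV. chi x y * (g y 0)\<^sup>2) = 0" if "(B x ?a 0)\<^sup>2 = 0" for x
        using D(3)[OF k, of x 0] that by simp
    qed
    then have "w = 0" using ng[of w "qform (p ?a) w"] by (simp add: mult.commute)
    then show False using w by simp
  qed
  obtain q where q: "\<And>y w. jet2 (\<lambda>t. g y (t *s w)) (g y 0) 0 (2 * qform (q y) w)" using kummer_jets[OF k(1)] by blast
  obtain q' where q': "\<And>y w. jet2 (\<lambda>t. g' y (t *s w)) (g' y 0) 0 (2 * qform (q' y) w)" using kummer_jets[OF k(2)] by blast
  define p where "p = (\<lambda>y. (1 / g y 0) *s q y)"
  define p' where "p' = (\<lambda>y. (1 / g' y 0) *s q' y)"
  have nz': "g' y 0 \<noteq> 0" for y using nz f by metis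
  have Q: "qcond (g ?a 0) (g ?b 0) (g ?c 0) (g ?d 0) (p ?a) (p ?b) (p ?c) (p ?d)"
    unfolding p_def by (rule kummer_qcond[OF k(1) nz q])
  have Q': "qcond (g ?a 0) (g ?b 0) (g ?c 0) (g ?d 0) (p' ?a) (p' ?b) (p' ?c) (p' ?d)"
    unfolding p'_def f by (rule kummer_qcond[OF k(2) nz' q'])
  have N1: "bil (p ?a - p ?b) (p ?a - p ?b) \<noteq> 0 \<or> bil (p ?a - p ?c) (p ?a - p ?c) \<noteq> 0 \<or> bil (p ?a - p ?d) (p ?a - p ?d) \<noteq> 0"
    by (rule nondeg[OF k(1) nz _ q p_def]) (rule ng(1), assumption)
  have N2: "bil (p' ?a - p' ?b) (p' ?a - p' ?b) \<noteq> 0 \<or> bil (p' ?a - p' ?c) (p' ?a - p' ?c) \<noteq> 0 \<or> bil (p' ?a - p' ?d) (p' ?a - p' ?d) \<noteq> 0"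
    by (rule nondeg[OF k(2) nz' _ q' p'_def]) (rule ng(2), assumption)
  obtain M l where M: "invertible M" and l: "\<And>w. qform (p' ?a) (M *v w) = qform (p ?a) w + qform l w"
    "\<And>w. qform (p' ?b) (M *v w) = qform (p ?b) w + qform l w"
    "\<And>w. qform (p' ?c) (M *v w) = qform (p ?c) w + qform l w"
    "\<And>w. qform (p' ?d) (M *v w) = qform (p ?d) w + qform l w"
    using qcond_congruent[OF Q Q' nz nz nz nz N1 N2] by blast
  have ly: "qform (p' y) (M *v w) = qform (p y) w + qform l w" for y w
    by (rule f2_cases[of _ y]) (use l in simp_all)
  show thesis
  proof (rule that[OF M])
    fix y w
    have "g' y (1 *s (M *v w)) = exp (qform l w * 1\<^sup>2) * g y (1 *s w)"
    proof (rule unique[OF k f nz q', where r = "\<lambda>y. qform (q y) w" and h = "\<lambda>y t. g y (t *s w)"])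
      show "jet2 (\<lambda>t. g y (t *s w)) (g y 0) 0 (2 * qform (q y) w)" for y by (rule q)
      show "qform (q' y) (M *v w) = qform (q y) w + g y 0 * qform l w" for y
        using ly[of y w] nz[of y] f[of y] unfolding p_def p'_def qform_scale by (simp add: field_simps)
      show "(B x ?a 0)\<^sup>2 * (\<Sum>y\<in>UNIV. chi x y * (g y 0 * g y ((2 * t) *s w))) * 4 = (\<Sum>y\<in>UNIV. chi x y * (g y (t *s w))\<^sup>2)\<^sup>2" for x t
        using D(2)[OF k(1), of x "t *s w"] unfolding dbl .
      show "(\<Sum>y\<in>UNIV. chi x y * (g y (t *s w))\<^sup>2) = 0" if "(B x ?a 0)\<^sup>2 = 0" for x t
        using D(3)[OF k(1), of x "t *s w"] that by simp
    qed
    then show "g' y (M *v w) = exp (qform l w) * g y w" by (simp add: vector_scalar_mult_def)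
  qed
qed

lemma kummer_theta:
  assumes "\<tau> \<in> siegel_H2"
  shows "kummer (half_theta \<tau>) (quarter_theta \<tau>)"
proof -
  have "half_theta \<tau> y (- u) = half_theta \<tau> y u" for y u
  proof -
    have "- u + (1/2) *s cvec (iv y) = - (u + (1/2) *s cvec (iv y)) + cvec (iv y)" by (simp add: vec_eq_iff)
    then show ?thesis unfolding half_theta_def by (simp only: riemann_theta_periodic riemann_theta_even)
  qed
  then show ?thesis
    unfolding kummer_def
    using entire2_half_theta[OF assms] entire2_quarter_theta[OF assms] theta_addition[OF assms] quarter_theta_parity[OF assms]
    by blast
qed

section \<open>Change of basis\<close>

text \<open>When some theta null vanishes, the argument is applied to another basis of the same space of
  functions, obtained from the normaliser of the Heisenberg group.\<close>

definition om :: "bool \<Rightarrow> bool \<Rightarrow> f2 \<Rightarrow> complex" where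
  "om s t y = (if s \<and> fst y then \<i> else 1) * (if t \<and> snd y then \<i> else 1)"

definition hat :: "bool \<Rightarrow> bool \<Rightarrow> (f2 \<Rightarrow> 'a \<Rightarrow> complex) \<Rightarrow> f2 \<Rightarrow> 'a \<Rightarrow> complex" where
  "hat s t g a u = (\<Sum>y\<in>UNIV. chi a y * (om s t y * g y u))"

lemma chi_commute: "chi x y = chi y x"
  by (simp add: chi_def conj_commute)

lemma chi_xor_left: "chi (xor2 x y) z = chi x z * chi y z"
  by (auto simp: chi_def xor2_def)

lemma chi_xor_right: "chi z (xor2 x y) = chi z x * chi z y"
  by (auto simp: chi_def xor2_def)

lemma chi_square: "chi x y * chi x y = 1"
  by (simp add: chi_def)

lemma sum_xor2: "(\<Sum>y'\<in>UNIV. F y') = (\<Sum>d\<in>UNIV. F (xor2 y d))" for F :: "f2 \<Rightarrow> complex"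
  by (rule f2_cases[of _ y]) (simp_all add: sum_f2 xor2_def)

text \<open>For fixed e the product om_y om_(y+e) is om_e times a character of y, so the sum over y
  selects a single x.\<close>

lemma hat_inner:
  "(\<Sum>y\<in>UNIV. chi d y * (om s t y * om s t (xor2 y e)) * (\<Sum>x\<in>UNIV. chi x y * Z x))
    = 4 * om s t e * Z (fst d \<noteq> (s \<and> \<not> fst e), snd d \<noteq> (t \<and> \<not> snd e))"
  by (cases d; cases e; cases s; cases t) (auto simp: sum_f2 chi_def om_def xor2_def algebra_simps)

lemma kummer_hat:
  assumes "kummer g B"
  obtains B' where "kummer (hat s t g) B'"
proof -
  \<comment> \<open>The transform exchanges roles: the old difference e of characteristics becomes
    the new first index, and X e d is the old x that survives in \<open>hat_inner\<close>.\<close>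
  define X where "X e d = (fst d \<noteq> (s \<and> \<not> fst e), snd d \<noteq> (t \<and> \<not> snd e))" for e d :: f2
  \<comment> \<open>A square root, because the constant is shared equally between the two factors at
    u and at -v.\<close>
  define c where "c e d = csqrt (4 * chi d e * om s t e)" for e d
  define B' where "B' e d u = c e d * B (X e d) e u" for e d u
  have c2: "c e d * c e d = 4 * chi d e * om s t e" for e d
    unfolding c_def by (metis power2_csqrt power2_eq_square)
  have "kummer (hat s t g) B'"
    unfolding kummer_def
  proof (intro conjI allI)
    show "entire2 (hat s t g y)" for y
      unfolding hat_def[abs_def] sum_f2 by (intro entire2_add entire2_cmult kummerD(1)[OF assms])
    show "entire2 (B' x d)" for x d
      unfolding B'_def[abs_def] by (intro entire2_cmult kummerD(2)[OF assms])
    show "hat s t g y (- u) = hat s t g y u" for y u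
      unfolding hat_def kummerD(5)[OF assms] ..
    show "B' x d (- u) = chi x d * B' x d u" for x d u
    proof -
      have "chi (X x d) x = chi x d" by (auto simp: chi_def X_def)
      then show ?thesis unfolding B'_def kummerD(4)[OF assms] by (simp add: mult_ac)
    qed
    fix a d u v
    have "hat s t g a (u + v) * hat s t g (xor2 a d) (u - v)
      = (\<Sum>y\<in>UNIV. \<Sum>y'\<in>UNIV. (chi a y * (om s t y * g y (u + v))) * (chi (xor2 a d) y' * (om s t y' * g y' (u - v))))"
      unfolding hat_def by (rule sum_product)
    also have "\<dots> = (\<Sum>y\<in>UNIV. \<Sum>e\<in>UNIV. (chi a y * (om s t y * g y (u + v))) * (chi (xor2 a d) (xor2 y e) * (om s t (xor2 y e) * g (xor2 y e) (u - v))))"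
      by (intro sum.cong refl sum_xor2)
    also have "\<dots> = (\<Sum>e\<in>UNIV. \<Sum>y\<in>UNIV. (chi a y * (om s t y * g y (u + v))) * (chi (xor2 a d) (xor2 y e) * (om s t (xor2 y e) * g (xor2 y e) (u - v))))"
      by (rule sum.swap)
    also have "\<dots> = (\<Sum>e\<in>UNIV. chi a e * chi d e * (\<Sum>y\<in>UNIV. chi d y * (om s t y * om s t (xor2 y e)) * (\<Sum>x\<in>UNIV. chi x y * (B x e u * B x e (- v)))))"
    proof (rule sum.cong[OF refl])
      fix e
      have "chi a y * (om s t y * g y (u + v)) * (chi (xor2 a d) (xor2 y e) * (om s t (xor2 y e) * g (xor2 y e) (u - v)))
         = chi a e * chi d e * (chi d y * (om s t y * om s t (xor2 y e)) * (g y (u + v) * g (xor2 y e) (u - v)))" for y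
      proof -
        have "chi a y * chi (xor2 a d) (xor2 y e) = chi a e * chi d e * chi d y"
          unfolding chi_xor_left chi_xor_right using chi_square[of a y] by (simp add: mult_ac)
        then show ?thesis by algebra
      qed
      then show "(\<Sum>y\<in>UNIV. (chi a y * (om s t y * g y (u + v))) * (chi (xor2 a d) (xor2 y e) * (om s t (xor2 y e) * g (xor2 y e) (u - v))))
         = chi a e * chi d e * (\<Sum>y\<in>UNIV. chi d y * (om s t y * om s t (xor2 y e)) * (\<Sum>x\<in>UNIV. chi x y * (B x e u * B x e (- v))))"
        unfolding kummerD(3)[OF assms] sum_distrib_left by simp
    qed
    also have "\<dots> = (\<Sum>x\<in>UNIV. chi x a * (B' x d u * B' x d (- v)))"
    proof (rule sum.cong[OF refl])
      fix e
      have e1: "chi e a * (B' e d u * B' e d (- v)) = chi e a * (c e d * c e d) * (B (X e d) e u * B (X e d) e (- v))"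
        by (simp add: B'_def mult_ac)
      show "chi a e * chi d e * (\<Sum>y\<in>UNIV. chi d y * (om s t y * om s t (xor2 y e)) * (\<Sum>x\<in>UNIV. chi x y * (B x e u * B x e (- v))))
        = chi e a * (B' e d u * B' e d (- v))"
        unfolding hat_inner e1 unfolding c2 X_def chi_commute[of e a] by (simp add: mult_ac)
    qed
    finally show "hat s t g a (u + v) * hat s t g (xor2 a d) (u - v) = (\<Sum>x\<in>UNIV. chi x a * (B' x d u * B' x d (- v)))" .
  qed
  then show thesis by (rule that)
qed

lemma hat_eq_imp:
  assumes "\<And>a. hat s t g a u = k * hat s t h a v"
  shows "g y u = k * h y v"
proof -
  have "om s t y * (g y u - k * h y v) = 0"
  proof (rule chi_orthogonal[where g = "\<lambda>y. om s t y * (g y u - k * h y v)"])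
    fix x
    have "(\<Sum>y\<in>UNIV. chi x y * (om s t y * (g y u - k * h y v))) = hat s t g x u - k * hat s t h x v"
      unfolding hat_def by (simp add: algebra_simps sum_subtractf sum_distrib_left)
    then show "(\<Sum>y\<in>UNIV. chi x y * (om s t y * (g y u - k * h y v))) = 0" using assms by simp
  qed
  then show ?thesis by (auto simp: om_def split: if_splits)
qed

lemma prod4:
  fixes x y z w :: complex
  shows "(x + y + z + w) * (x - y + z - w) * (x + y - z - w) * (x - y - z + w)
    = (x\<^sup>2 + y\<^sup>2 + z\<^sup>2 + w\<^sup>2)\<^sup>2 - 4 * (x\<^sup>2 * y\<^sup>2 + x\<^sup>2 * z\<^sup>2 + x\<^sup>2 * w\<^sup>2 + y\<^sup>2 * z\<^sup>2 + y\<^sup>2 * w\<^sup>2 + z\<^sup>2 * w\<^sup>2) + 8 * (x * y * z * w)"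
  by algebra

text \<open>Suppose some coordinate vanishes for each choice of s and t. Then so does the product of
  the four coordinates, which by \<open>prod4\<close> depends only on the squares of x, y, z, w,
  apart from 8xyzw; this term is 0 because f y1 = 0. Changing s and t only changes signs of these
  squares, and the four resulting relations force A, B, C, D to vanish.\<close>

lemma hat_nonzero:
  assumes "f y0 \<noteq> 0" "f y1 = 0"
  obtains s t where "\<And>a. (\<Sum>y\<in>UNIV. chi a y * (om s t y * f y)) \<noteq> 0"
proof (rule ccontr)
  assume "\<not> thesis"
  then have ex: "\<exists>a. (\<Sum>y\<in>UNIV. chi a y * (om s t y * f y)) = 0" for s t using that by metis
  let ?x = "f (False, False)" and ?y = "f (False, True)" and ?z = "f (True, False)" and ?w = "f (True, True)"
  have z: "?x * ?y * ?z * ?w = 0" 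
    by (rule f2_cases[of "\<lambda>y. f y = 0 \<longrightarrow> ?x * ?y * ?z * ?w = 0" y1, THEN mp]) (use assms(2) in simp_all)
  have P: "(x + y + z + w) * (x - y + z - w) * (x + y - z - w) * (x - y - z + w) = 0"
    if "x = om s t (False, False) * ?x" "y = om s t (False, True) * ?y" "z = om s t (True, False) * ?z" "w = om s t (True, True) * ?w" for s t x y z w
  proof -
    obtain a where a: "(\<Sum>y\<in>UNIV. chi a y * (om s t y * f y)) = 0" using ex by blast
    have "x + y + z + w = 0 \<or> x - y + z - w = 0 \<or> x + y - z - w = 0 \<or> x - y - z + w = 0"
      using a unfolding sum_f2 that[symmetric] chi_def by (cases a) (auto split: if_splits simp: algebra_simps)
    then show ?thesis by auto
  qed
  define A B C D where "A = ?x\<^sup>2" and "B = ?y\<^sup>2" and "C = ?z\<^sup>2" and "D = ?w\<^sup>2"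
  have Q: "(A + e * B + h * C + e * h * D)\<^sup>2 - 4 * (e * A * B + h * A * C + e * h * A * D + e * h * B * C + h * B * D + e * C * D) = 0"
    if eh: "e = (if t then -1 else 1)" "h = (if s then -1 else 1)" for s t e h
  proof -
    define x y z w where "x = om s t (False, False) * ?x" "y = om s t (False, True) * ?y" "z = om s t (True, False) * ?z" "w = om s t (True, True) * ?w"
    note xyzw = x_y_z_w_def
    have sq: "x\<^sup>2 = A" "y\<^sup>2 = e * B" "z\<^sup>2 = h * C" "w\<^sup>2 = e * h * D"
      unfolding xyzw A_def B_def C_def D_def eh by (auto simp: om_def power_mult_distrib)
    have "x * y * z * w = om s t (False, False) * om s t (False, True) * om s t (True, False) * om s t (True, True) * (?x * ?y * ?z * ?w)"
      unfolding xyzw by (simp add: mult_ac)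
    then have "x * y * z * w = 0" using z by simp
    moreover have e2: "e * e = 1" "h * h = 1" using eh by auto
    ultimately show ?thesis
      using P[OF xyzw] unfolding prod4 sq by (simp add: e2) (use e2 in algebra)
  qed
  have q1: "(A + B + C + D)\<^sup>2 - 4 * (A * B + A * C + A * D + B * C + B * D + C * D) = 0"
    using Q[of 1 False 1 False] by simp
  have q2: "(A - B + C - D)\<^sup>2 - 4 * (- A * B + A * C - A * D - B * C + B * D - C * D) = 0"
    using Q[of "-1" True 1 False] by simp
  have q3: "(A + B - C - D)\<^sup>2 - 4 * (A * B - A * C - A * D - B * C - B * D + C * D) = 0"
    using Q[of 1 False "-1" True] by simp
  have q4: "(A - B - C + D)\<^sup>2 - 4 * (- A * B - A * C + A * D + B * C - B * D - C * D) = 0"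
    using Q[of "-1" True "-1" True] by simp
  \<comment> \<open>Adding q1 to q4 gives A^2 + B^2 + C^2 + D^2 = 0. Each relation then kills its
    own mixed terms, so each signed sum has square 0.\<close>
  have "4 * (A + B + C + D)\<^sup>2 = 0" "4 * (A - B + C - D)\<^sup>2 = 0" "4 * (A + B - C - D)\<^sup>2 = 0" "4 * (A - B - C + D)\<^sup>2 = 0"
    using q1 q2 q3 q4 by algebra+
  then have l: "A + B + C + D = 0" "A - B + C - D = 0" "A + B - C - D = 0" "A - B - C + D = 0" by simp_all
  have "4 * A = 0" "4 * B = 0" "4 * C = 0" "4 * D = 0" using l by algebra+
  then have "?x = 0" "?y = 0" "?z = 0" "?w = 0" by (simp_all add: A_def B_def C_def D_def)
  then have "f y = 0" for y by (rule f2_cases[of "\<lambda>y. f y = 0"])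
  then show False using assms(1) by blast
qed

theorem theta_nulls_determine_theta:
  assumes H: "\<tau> \<in> siegel_H2" "\<tau>' \<in> siegel_H2"
    and eq: "\<And>y. half_theta \<tau> y 0 = half_theta \<tau>' y 0"
  obtains M l where "invertible M" "\<And>w. riemann_theta \<tau>' (M *v w) = exp (qform l w) * riemann_theta \<tau> w"
proof -
  let ?g = "half_theta \<tau>" and ?g' = "half_theta \<tau>'"
  note k = kummer_theta[OF H(1)] kummer_theta[OF H(2)]
  obtain M l where M: "invertible M" "\<And>y w. ?g' y (M *v w) = exp (qform l w) * ?g y w"
  proof (cases "\<exists>y. ?g y 0 = 0")
    case False
    then have nz: "\<And>y. ?g y 0 \<noteq> 0" by blast
    show thesis
      by (rule kummer_congruent[OF k eq nz])
        (rule half_theta_not_gaussian[OF H(1)], assumption, rule half_theta_not_gaussian[OF H(2)], assumption, rule that)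
  next
    case True
    then obtain y1 where y1: "?g y1 0 = 0" by blast
    obtain y0 where y0: "?g y0 0 \<noteq> 0" using half_theta_no_common_zero[OF H(1)] by blast
    obtain s t where st: "\<And>a. (\<Sum>y\<in>UNIV. chi a y * (om s t y * ?g y 0)) \<noteq> 0"
      using hat_nonzero[of "\<lambda>y. ?g y 0", OF y0 y1] by blast
    obtain B where B: "kummer (hat s t ?g) B" using kummer_hat[OF k(1)] by blast
    obtain B' where B': "kummer (hat s t ?g') B'" using kummer_hat[OF k(2)] by blast
    have eq': "hat s t ?g y 0 = hat s t ?g' y 0" for y unfolding hat_def eq ..
    have nz: "hat s t ?g y 0 \<noteq> 0" for y unfolding hat_def by (rule st)
    have ng: "w = 0" if \<sigma>: "\<sigma> \<in> siegel_H2" and w: "\<And>r y. hat s t (half_theta \<sigma>) y (r *s w) = hat s t (half_theta \<sigma>) y 0 * exp (p * r\<^sup>2)" for \<sigma> w p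
    proof (rule half_theta_not_gaussian[OF \<sigma>])
      fix r y
      show "half_theta \<sigma> y (r *s w) = half_theta \<sigma> y 0 * exp (p * r\<^sup>2)"
        using hat_eq_imp[of s t "half_theta \<sigma>" "r *s w" "exp (p * r\<^sup>2)" "half_theta \<sigma>" 0 y] w by (simp add: mult.commute)
    qed
    obtain M l where M: "invertible M" "\<And>y w. hat s t ?g' y (M *v w) = exp (qform l w) * hat s t ?g y w"
      by (rule kummer_congruent[OF B B' eq' nz])
        (rule ng[OF H(1)], assumption, rule ng[OF H(2)], assumption, rule that)
    show thesis by (rule that[OF M(1)]) (rule hat_eq_imp[OF M(2)])
  qed
  have "half_theta \<sigma> (False, False) w = riemann_theta \<sigma> w" for \<sigma> w
  proof -
    have "(1/2) *s cvec (iv (False, False)) = 0" by (simp add: vec_eq_iff iv_def forall_2)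
    then show ?thesis by (simp add: half_theta_def)
  qed
  then have "riemann_theta \<tau>' (M *v w) = exp (qform l w) * riemann_theta \<tau> w" for w
    using M(2)[of "(False, False)" w] by simp
  then show thesis by (rule that[OF M(1)])
qed

section \<open>Isomorphism of the abelian surfaces\<close>

definition theta_lattice :: "complex^2^2 \<Rightarrow> (complex^2) set" where
  "theta_lattice \<tau> = {cvec m + \<tau> *v cvec n |m n. True}"

lemma exp_eq_1_imp_2pi_int:
  assumes "exp (2 * of_real pi * \<i> * x) = 1"
  obtains k :: int where "x = of_int k"
proof -
  obtain k :: int where k: "Re (2 * of_real pi * \<i> * x) = 0" "Im (2 * of_real pi * \<i> * x) = of_int (2 * k) * pi"
    using assms unfolding exp_eq_1 by blast
  have "Im x = 0" "Re x = of_int k" using k by simp_all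
  then have "x = of_int k" by (simp add: complex_eq_iff)
  then show thesis by (rule that)
qed

lemma integral_vector:
  assumes "\<And>m. exp (2 * of_real pi * \<i> * bdot (cvec m) v) = 1"
  obtains n where "v = cvec n"
proof -
  have "\<exists>k. v $ i = of_int k" for i
  proof -
    have "bdot (cvec (axis i 1)) v = v $ i" using exhaust_2[of i] by (auto simp: bdot_2 axis_def)
    then show ?thesis using exp_eq_1_imp_2pi_int[of "v $ i"] assms[of "axis i 1"] by metis
  qed
  then obtain k where "\<And>i. v $ i = of_int (k i)" by metis
  then have "v = cvec (\<chi> i. k i)" by (simp add: vec_eq_iff)
  then show thesis by (rule that)
qed

text \<open>Describes the lattice through theta in a way that survives linear substitutions and
  factors exp(quadratic form). For the converse, compatibility with integral translations forces
  kappa = 2 pi i n with n integral, and comparing the two orders of translating by omega and by tau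
  m forces omega + tau n to be integral.\<close>

lemma theta_lattice_iff:
  assumes "\<tau> \<in> siegel_H2"
  shows "\<omega> \<in> theta_lattice \<tau> \<longleftrightarrow>
    (\<exists>\<kappa> c. \<forall>z. riemann_theta \<tau> (z + \<omega>) = exp (bdot \<kappa> z + c) * riemann_theta \<tau> z)"
proof
  assume "\<omega> \<in> theta_lattice \<tau>"
  then obtain m n where \<omega>: "\<omega> = cvec m + \<tau> *v cvec n" by (auto simp: theta_lattice_def)
  have "riemann_theta \<tau> (z + \<omega>) = exp (bdot ((- 2 * of_real pi * \<i>) *s cvec n) z + (- of_real pi * \<i> * bdot (cvec n) (\<tau> *v cvec n))) * riemann_theta \<tau> z" for z
  proof -
    have "z + \<omega> = (z + \<tau> *v cvec n) + cvec m" by (simp add: \<omega>)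
    then show ?thesis
      by (simp only: riemann_theta_periodic riemann_theta_quasi_periodic[OF assms]) (simp add: bdot_simps algebra_simps)
  qed
  then show "\<exists>\<kappa> c. \<forall>z. riemann_theta \<tau> (z + \<omega>) = exp (bdot \<kappa> z + c) * riemann_theta \<tau> z" by blast
next
  assume "\<exists>\<kappa> c. \<forall>z. riemann_theta \<tau> (z + \<omega>) = exp (bdot \<kappa> z + c) * riemann_theta \<tau> z"
  then obtain \<kappa> c where \<kappa>: "\<And>z. riemann_theta \<tau> (z + \<omega>) = exp (bdot \<kappa> z + c) * riemann_theta \<tau> z" by blast
  obtain z where z: "riemann_theta \<tau> z \<noteq> 0" using riemann_theta_not_zero[OF assms] by blast
  define \<mu> where "\<mu> = (1 / (2 * of_real pi * \<i>)) *s \<kappa>"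
  have \<kappa>\<mu>: "\<kappa> = (2 * of_real pi * \<i>) *s \<mu>" by (simp add: \<mu>_def)
  have "exp (2 * of_real pi * \<i> * bdot (cvec m) \<mu>) = 1" for m
  proof -
    have "riemann_theta \<tau> (z + cvec m + \<omega>) = riemann_theta \<tau> (z + \<omega>)"
      using riemann_theta_periodic[of \<tau> "z + \<omega>" m] by (simp add: add_ac)
    then have "exp (bdot \<kappa> (z + cvec m) + c) = exp (bdot \<kappa> z + c)"
      using z unfolding \<kappa> riemann_theta_periodic by simp
    then show ?thesis by (simp add: bdot_simps exp_add \<kappa>\<mu> bdot_commute[of \<mu>])
  qed
  then obtain n where n: "\<mu> = cvec n" using integral_vector by blast
  have "exp (2 * of_real pi * \<i> * bdot (cvec m) (\<omega> + \<tau> *v cvec n)) = 1" for m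
  proof -
    have "riemann_theta \<tau> (z + \<tau> *v cvec m + \<omega>) = riemann_theta \<tau> (z + \<omega> + \<tau> *v cvec m)"
      by (simp add: add_ac)
    then have "exp (bdot \<kappa> (z + \<tau> *v cvec m) + c) * exp (- of_real pi * \<i> * (bdot (cvec m) (\<tau> *v cvec m) + 2 * bdot (cvec m) z))
        = exp (- of_real pi * \<i> * (bdot (cvec m) (\<tau> *v cvec m) + 2 * bdot (cvec m) (z + \<omega>))) * exp (bdot \<kappa> z + c)"
      using z unfolding \<kappa> riemann_theta_quasi_periodic[OF assms] by simp
    moreover define X where "X = exp (bdot \<kappa> z + c - of_real pi * \<i> * (bdot (cvec m) (\<tau> *v cvec m) + 2 * bdot (cvec m) z))"
    have "exp (bdot \<kappa> (z + \<tau> *v cvec m) + c) * exp (- of_real pi * \<i> * (bdot (cvec m) (\<tau> *v cvec m) + 2 * bdot (cvec m) z))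
        = X * exp (bdot \<kappa> (\<tau> *v cvec m))"
      unfolding X_def exp_add[symmetric] by (rule arg_cong[where f = exp]) (simp add: bdot_simps algebra_simps)
    moreover have "exp (- of_real pi * \<i> * (bdot (cvec m) (\<tau> *v cvec m) + 2 * bdot (cvec m) (z + \<omega>))) * exp (bdot \<kappa> z + c)
        = X * exp (- 2 * of_real pi * \<i> * bdot (cvec m) \<omega>)"
      unfolding X_def exp_add[symmetric] by (rule arg_cong[where f = exp]) (simp add: bdot_simps algebra_simps)
    moreover have "X \<noteq> 0" by (simp add: X_def)
    ultimately have "exp (bdot \<kappa> (\<tau> *v cvec m)) = exp (- 2 * of_real pi * \<i> * bdot (cvec m) \<omega>)"
      by (metis mult_cancel_left)
    then have "exp (bdot \<kappa> (\<tau> *v cvec m) + 2 * of_real pi * \<i> * bdot (cvec m) \<omega>) = 1"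
      by (simp add: exp_add exp_minus)
    moreover have "bdot \<kappa> (\<tau> *v cvec m) + 2 * of_real pi * \<i> * bdot (cvec m) \<omega> = 2 * of_real pi * \<i> * bdot (cvec m) (\<omega> + \<tau> *v cvec n)"
      using siegel_H2_bdot[OF assms, of "cvec n" "cvec m"] by (simp add: \<kappa>\<mu> n bdot_simps algebra_simps)
    ultimately show ?thesis by simp
  qed
  then obtain m where "\<omega> + \<tau> *v cvec n = cvec m" using integral_vector by blast
  then have "\<omega> = cvec m + \<tau> *v cvec (- n)"
    by (simp add: cvec_minus matrix_vector_mult_minus algebra_simps)
  then show "\<omega> \<in> theta_lattice \<tau>" unfolding theta_lattice_def by blast
qed

lemma theta_lattice_image:
  assumes H: "\<tau> \<in> siegel_H2" "\<tau>' \<in> siegel_H2" and M: "invertible M"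
    and eq: "\<And>w. riemann_theta \<tau>' (M *v w) = exp (qform l w) * riemann_theta \<tau> w"
    and \<omega>: "\<omega> \<in> theta_lattice \<tau>"
  shows "M *v \<omega> \<in> theta_lattice \<tau>'"
proof -
  obtain \<kappa> c where \<kappa>: "\<And>z. riemann_theta \<tau> (z + \<omega>) = exp (bdot \<kappa> z + c) * riemann_theta \<tau> z"
    using \<omega> unfolding theta_lattice_iff[OF H(1)] by blast
  \<comment> \<open>v is the polar form of l at omega, so the quadratic factor changes under the
    translation only by the exponential of an affine function.\<close>
  define v :: "complex^2" where "v = vector [2 * l $ 1 * \<omega> $ 1 + l $ 2 * \<omega> $ 2, l $ 2 * \<omega> $ 1 + 2 * l $ 3 * \<omega> $ 2]"
  have q: "qform l (u + \<omega>) = qform l u + bdot v u + qform l \<omega>" for u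
    by (simp add: qform_def v_def bdot_2 power2_eq_square algebra_simps)
  let ?N = "matrix_inv M"
  have "riemann_theta \<tau>' (z + M *v \<omega>) = exp (bdot (transpose ?N *v (v + \<kappa>)) z + (qform l \<omega> + c)) * riemann_theta \<tau>' z" for z
  proof -
    define u where "u = ?N *v z"
    have z: "z = M *v u" by (simp add: u_def matrix_vector_mult_compose_inv[OF M])
    have "riemann_theta \<tau>' (z + M *v \<omega>) = exp (qform l (u + \<omega>)) * (exp (bdot \<kappa> u + c) * riemann_theta \<tau> u)"
      unfolding z matrix_vector_right_distrib[symmetric] eq \<kappa> ..
    also have "\<dots> = exp (bdot (v + \<kappa>) u + (qform l \<omega> + c)) * (exp (qform l u) * riemann_theta \<tau> u)"
      unfolding q by (simp add: bdot_simps exp_add)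
    also have "exp (qform l u) * riemann_theta \<tau> u = riemann_theta \<tau>' z" unfolding z eq ..
    also have "bdot (v + \<kappa>) u = bdot (transpose ?N *v (v + \<kappa>)) z" unfolding u_def bdot_transpose ..
    finally show ?thesis .
  qed
  then show ?thesis unfolding theta_lattice_iff[OF H(2)] by blast
qed

lemma theta_nulls_determine_ppas:
  assumes H: "\<tau> \<in> siegel_H2" "\<tau>' \<in> siegel_H2"
    and eq: "\<And>y. half_theta \<tau> y 0 = half_theta \<tau>' y 0"
  shows "ppas_iso (ppas_of \<tau>) (ppas_of \<tau>')"
proof -
  obtain M l where M: "invertible M" and e: "\<And>w. riemann_theta \<tau>' (M *v w) = exp (qform l w) * riemann_theta \<tau> w"
    using theta_nulls_determine_theta[OF H eq] by blast
  let ?N = "matrix_inv M"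
  note MN = matrix_vector_mult_compose_inv[OF M]
  have e': "riemann_theta \<tau> (?N *v w) = exp (qform (pull ?N ((-1) *s l)) w) * riemann_theta \<tau>' w" for w
    using e[of "?N *v w"] unfolding MN qform_pull qform_scale by (simp add: exp_minus)
  have "(\<lambda>v. M *v v) ` theta_lattice \<tau> = theta_lattice \<tau>'"
  proof
    show "(\<lambda>v. M *v v) ` theta_lattice \<tau> \<subseteq> theta_lattice \<tau>'"
      using theta_lattice_image[OF H M e] by blast
    show "theta_lattice \<tau>' \<subseteq> (\<lambda>v. M *v v) ` theta_lattice \<tau>"
    proof
      fix \<omega> assume "\<omega> \<in> theta_lattice \<tau>'"
      then have "?N *v \<omega> \<in> theta_lattice \<tau>"
        using theta_lattice_image[OF H(2,1) invertible_matrix_inv[OF M] e'] by blast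
      moreover have "\<omega> = M *v (?N *v \<omega>)" by (simp add: MN)
      ultimately show "\<omega> \<in> (\<lambda>v. M *v v) ` theta_lattice \<tau>" by blast
    qed
  qed
  moreover have "(\<lambda>v. M *v v + 0) ` {z. riemann_theta \<tau> z = 0} = {z. riemann_theta \<tau>' z = 0}"
  proof
    show "(\<lambda>v. M *v v + 0) ` {z. riemann_theta \<tau> z = 0} \<subseteq> {z. riemann_theta \<tau>' z = 0}"
      using e by auto
    show "{z. riemann_theta \<tau>' z = 0} \<subseteq> (\<lambda>v. M *v v + 0) ` {z. riemann_theta \<tau> z = 0}"
    proof
      fix z assume "z \<in> {z. riemann_theta \<tau>' z = 0}"
      then have "riemann_theta \<tau> (?N *v z) = 0" using e' by simp
      moreover have "z = M *v (?N *v z) + 0" by (simp add: MN)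
      ultimately show "z \<in> (\<lambda>v. M *v v + 0) ` {z. riemann_theta \<tau> z = 0}" by blast
    qed
  qed
  ultimately show ?thesis
    unfolding ppas_iso_def ppas_of_def theta_lattice_def fst_conv snd_conv using M by blast
qed

lemma ppas_iso_trans:
  assumes "ppas_iso X Y" "ppas_iso Y Z"
  shows "ppas_iso X Z"
proof -
  obtain M c where M: "invertible M" "(\<lambda>v. M *v v) ` fst X = fst Y" "(\<lambda>v. M *v v + c) ` snd X = snd Y"
    using assms(1) unfolding ppas_iso_def by blast
  obtain N d where N: "invertible N" "(\<lambda>v. N *v v) ` fst Y = fst Z" "(\<lambda>v. N *v v + d) ` snd Y = snd Z"
    using assms(2) unfolding ppas_iso_def by blast
  have "invertible (N ** M)" using M N by (intro invertible_mult)
  moreover have "(\<lambda>v. (N ** M) *v v) ` fst X = fst Z"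
    unfolding N(2)[symmetric] M(2)[symmetric] by (simp add: image_image matrix_vector_mul_assoc)
  moreover have "(\<lambda>v. (N ** M) *v v + (N *v c + d)) ` snd X = snd Z"
    unfolding N(3)[symmetric] M(3)[symmetric]
    by (simp add: image_image matrix_vector_mul_assoc matrix_vector_right_distrib add.assoc)
  ultimately show ?thesis unfolding ppas_iso_def by blast
qed

lemma half_theta_0:
  "half_theta \<tau> (False, False) 0 = theta_f1 \<tau>" "half_theta \<tau> (True, True) 0 = theta_f2 \<tau>"
  "half_theta \<tau> (True, False) 0 = theta_f3 \<tau>" "half_theta \<tau> (False, True) 0 = theta_f4 \<tau>"
proof -
  have "half_theta \<tau> y 0 = theta_const (vector [0, 0]) (iv y) \<tau>" for y
  proof -
    have "(1/2) *s cvec (vector [0, 0]) = 0" by (simp add: vec_eq_iff forall_2)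
    then show ?thesis
      unfolding half_theta_def riemann_theta_def theta_const_def Let_def by (simp add: bdot_simps)
  qed
  then show "half_theta \<tau> (False, False) 0 = theta_f1 \<tau>" "half_theta \<tau> (True, True) 0 = theta_f2 \<tau>"
    "half_theta \<tau> (True, False) 0 = theta_f3 \<tau>" "half_theta \<tau> (False, True) 0 = theta_f4 \<tau>"
    by (simp_all add: theta_f1_def theta_f2_def theta_f3_def theta_f4_def iv_def)
qed

text \<open>\<open>value_at F\<close> sees tau only through \<open>jacobian_is\<close>, which is
  invariant under isomorphism of the polarized surfaces.\<close>

lemma theta_nulls_determine_values:
  assumes H: "\<tau> \<in> siegel_H2" "\<tau>' \<in> siegel_H2"
    and eq: "theta_f1 \<tau> = theta_f1 \<tau>'" "theta_f2 \<tau> = theta_f2 \<tau>'" "theta_f3 \<tau> = theta_f3 \<tau>'" "theta_f4 \<tau> = theta_f4 \<tau>'"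
  shows "value_at F \<tau> = value_at F \<tau>'"
proof -
  have e: "half_theta \<tau> y 0 = half_theta \<tau>' y 0" for y
    by (rule f2_cases[of _ y]) (simp_all add: half_theta_0 eq)
  have "jacobian_is a \<alpha> \<tau> \<longleftrightarrow> jacobian_is a \<alpha> \<tau>'" for a \<alpha>
    unfolding jacobian_is_def
    using ppas_iso_trans theta_nulls_determine_ppas[OF H e] theta_nulls_determine_ppas[OF H(2,1) e[symmetric]] by blast
  then show ?thesis unfolding value_at_def by simp
qed

section \<open>Uniqueness of Fourier coefficients\<close>

definition ec :: "int \<Rightarrow> real \<Rightarrow> complex" where
  "ec n x = exp (2 * of_real pi * \<i> * of_int n * of_real x)"

lemma continuous_ec [continuous_intros]: "continuous_on S (ec n)"
  unfolding ec_def by (intro continuous_intros)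

lemma ec_add: "ec m x * ec n x = ec (m + n) x"
  by (simp add: ec_def algebra_simps flip: exp_add)

definition fourier_null :: "(real \<Rightarrow> complex) \<Rightarrow> bool" where
  "fourier_null h \<longleftrightarrow> continuous_on {0..1} h \<and> (\<forall>n. integral {0..1} (\<lambda>x. h x * ec n x) = 0)"

text \<open>These multipliers are closed under sums and products and contain constants and all
  characters. This fits the induction over polynomial functions that Stone-Weierstrass calls
  for.\<close>

definition fourier_mult :: "(real \<Rightarrow> complex) \<Rightarrow> bool" where
  "fourier_mult p \<longleftrightarrow> (\<forall>h. fourier_null h \<longrightarrow> fourier_null (\<lambda>x. p x * h x))"

lemma fourier_mult_const: "fourier_mult (\<lambda>x. c)"
  by (auto simp: fourier_mult_def fourier_null_def mult.assoc intro!: continuous_intros)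

lemma fourier_mult_ec: "fourier_mult (ec m)"
  unfolding fourier_mult_def fourier_null_def
proof (intro allI impI conjI; elim conjE)
  fix h n assume h: "continuous_on {0..1} h" "\<forall>n. integral {0..1} (\<lambda>x. h x * ec n x) = 0"
  have "(\<lambda>x. ec m x * h x * ec n x) = (\<lambda>x. h x * ec (m + n) x)"
    by (simp add: fun_eq_iff mult_ac flip: ec_add)
  then show "integral {0..1} (\<lambda>x. ec m x * h x * ec n x) = 0" using h by simp
qed (intro continuous_intros)

lemma fourier_mult_add:
  assumes "fourier_mult p" "fourier_mult q"
  shows "fourier_mult (\<lambda>x. p x + q x)"
  unfolding fourier_mult_def
proof (intro allI impI)
  fix h assume "fourier_null h"
  then have n: "fourier_null (\<lambda>x. p x * h x)" "fourier_null (\<lambda>x. q x * h x)"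
    using assms by (auto simp: fourier_mult_def)
  then have c: "continuous_on {0..1} (\<lambda>x. p x * h x)" "continuous_on {0..1} (\<lambda>x. q x * h x)"
    by (auto simp: fourier_null_def)
  have i: "(\<lambda>x. p x * h x * ec n x) integrable_on {0..1}" "(\<lambda>x. q x * h x * ec n x) integrable_on {0..1}" for n
    by (intro integrable_continuous_interval continuous_intros c)+
  have "integral {0..1} (\<lambda>x. (p x + q x) * h x * ec n x) = integral {0..1} (\<lambda>x. p x * h x * ec n x) + integral {0..1} (\<lambda>x. q x * h x * ec n x)" for n
    using integral_add[OF i(1)[of n] i(2)[of n]] by (simp add: algebra_simps)
  then show "fourier_null (\<lambda>x. (p x + q x) * h x)"
    using n continuous_on_add[OF c] by (simp add: fourier_null_def algebra_simps)
qed

lemma fourier_mult_mult: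
  assumes "fourier_mult p" "fourier_mult q"
  shows "fourier_mult (\<lambda>x. p x * q x)"
  using assms unfolding fourier_mult_def by (simp add: mult.assoc)

lemma fourier_mult_polynomial:
  assumes "real_polynomial_function p"
  shows "fourier_mult (\<lambda>x. of_real (p (ec 1 x)))"
  using assms
proof induction
  case (linear f)
  have eq: "complex_of_real (f (ec 1 x)) = (of_real (f 1) / 2 - \<i> * of_real (f \<i>) / 2) * ec 1 x + (of_real (f 1) / 2 + \<i> * of_real (f \<i>) / 2) * ec (- 1) x" for x
  proof -
    have fz: "f z = Re z * f 1 + Im z * f \<i>" for z
    proof -
      have "z = Re z *\<^sub>R 1 + Im z *\<^sub>R \<i>" by (simp add: complex_eq_iff)
      then have "f z = f (Re z *\<^sub>R 1 + Im z *\<^sub>R \<i>)" by (rule arg_cong)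
      also have "\<dots> = Re z * f 1 + Im z * f \<i>"
        unfolding linear_simps(1)[OF linear] linear_simps(5)[OF linear] by simp
      finally show ?thesis .
    qed
    show ?thesis
      unfolding fz[of "ec 1 x"] by (simp add: ec_def complex_eq_iff Re_exp Im_exp field_simps)
  qed
  show ?case
    unfolding eq
    by (rule fourier_mult_add[OF fourier_mult_mult[OF fourier_mult_const fourier_mult_ec]
          fourier_mult_mult[OF fourier_mult_const fourier_mult_ec]])
next
  case (const c)
  show ?case by (rule fourier_mult_const)
next
  case (add f g)
  then show ?case using fourier_mult_add by simp
next
  case (mult f g)
  then show ?case using fourier_mult_mult by simp
qed

lemma ec_eq_imp:
  assumes "ec 1 x = ec 1 y"
  obtains k :: int where "x = y + of_int k"
proof -
  have "exp (2 * of_real pi * \<i> * of_real x) = exp (2 * of_real pi * \<i> * of_real y)"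
    using assms by (simp add: ec_def)
  then obtain k :: int where "2 * of_real pi * \<i> * of_real x = 2 * of_real pi * \<i> * of_real y + (of_int (2 * k) * pi) * \<i>"
    using exp_eq by metis
  then have "2 * pi * x = 2 * pi * y + of_int (2 * k) * pi"
    by (simp add: complex_eq_iff)
  then have "2 * pi * x = 2 * pi * (y + of_int k)" by (simp add: algebra_simps)
  then have "x = y + of_int k" by (simp only: mult_cancel_left) simp
  then show thesis by (rule that)
qed

lemma periodic_int:
  fixes h :: "real \<Rightarrow> 'a"
  assumes "\<And>x. h (x + 1) = h x"
  shows "h (x + of_int k) = h x"
proof -
  have nat: "h (x + of_nat n) = h x" for n x
    by (induction n arbitrary: x) (use assms in \<open>auto simp: add.assoc[symmetric] add.commute[of 1]\<close>)
  show ?thesis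
  proof (cases "k \<ge> 0")
    case True
    then show ?thesis using nat[of x "nat k"] by simp
  next
    case False
    then show ?thesis using nat[of "x + of_int k" "nat (- k)"] by simp
  qed
qed

text \<open>By periodicity h factors through a function k on the unit circle. A polynomial g within
  e of the conjugate of k satisfies that the integral of g h is 0, so the integral of |h|^2 is at
  most e times that of |h|.\<close>

lemma fourier_unique:
  assumes c: "continuous_on UNIV h" and p: "\<And>x. h (x + 1) = h x"
    and z: "\<And>n. integral {0..1} (\<lambda>x. h x * ec n x) = 0"
  shows "h x = 0"
proof -
  have c01: "continuous_on {0..1} h" using c continuous_on_subset by blast
  have null: "fourier_null h" using c01 z by (simp add: fourier_null_def)
  define k where "k \<zeta> = h (SOME x. ec 1 x = \<zeta>)" for \<zeta>
  have k: "k (ec 1 x) = h x" for x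
  proof -
    have "ec 1 (SOME x'. ec 1 x' = ec 1 x) = ec 1 x" by (rule someI) simp
    then obtain m :: int where "(SOME x'. ec 1 x' = ec 1 x) = x + of_int m" using ec_eq_imp by blast
    then show ?thesis using periodic_int[of h, OF p] by (simp add: k_def)
  qed
  have sph: "ec 1 ` {0..1} = sphere 0 1"
  proof
    show "ec 1 ` {0..1} \<subseteq> sphere 0 1" by (auto simp: ec_def norm_exp_eq_Re)
    show "sphere 0 1 \<subseteq> ec 1 ` {0..1}"
    proof
      fix \<zeta> :: complex assume "\<zeta> \<in> sphere 0 1"
      then have "\<zeta> = exp (\<i> * of_real (Arg2pi \<zeta>))" using Arg2pi_eq[of \<zeta>] by simp
      then have "\<zeta> = ec 1 (Arg2pi \<zeta> / (2 * pi))" by (simp add: ec_def mult_ac)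
      moreover have "Arg2pi \<zeta> / (2 * pi) \<in> {0..1}" using Arg2pi_ge_0[of \<zeta>] Arg2pi_lt_2pi[of \<zeta>] by (simp add: field_simps)
      ultimately show "\<zeta> \<in> ec 1 ` {0..1}" by blast
    qed
  qed
  \<comment> \<open>The preimage under k of a closed set is the image under \<open>ec 1\<close> of a
    compact subset of [0, 1].\<close>
  have ck: "continuous_on (sphere 0 1) k"
    unfolding continuous_on_closed_vimage[OF closed_sphere]
  proof (intro allI impI)
    fix B :: "complex set" assume B: "closed B"
    have "k -` B \<inter> sphere 0 1 = ec 1 ` ({0..1} \<inter> h -` B)"
      unfolding sph[symmetric] using k by auto
    moreover have "compact ({0..1} \<inter> h -` B)"
      using continuous_closed_vimage[OF B] c by (intro compact_Int_closed) (auto simp: continuous_on_eq_continuous_at)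
    then have "compact (ec 1 ` ({0..1} \<inter> h -` B))"
      by (intro compact_continuous_image continuous_ec)
    ultimately show "closed (k -` B \<inter> sphere 0 1)" by (simp add: compact_imp_closed)
  qed
  have approx: "integral {0..1} (\<lambda>x. (norm (h x))\<^sup>2) \<le> e * integral {0..1} (\<lambda>x. norm (h x))" if e: "e > 0" for e
  proof -
    have "continuous_on (sphere 0 1) (\<lambda>\<zeta>. cnj (k \<zeta>))" by (intro continuous_intros ck)
    then obtain g where g: "polynomial_function g" "\<And>\<zeta>. \<zeta> \<in> sphere 0 1 \<Longrightarrow> norm (cnj (k \<zeta>) - g \<zeta>) < e"
      using Stone_Weierstrass_polynomial_function[of "sphere 0 1" "\<lambda>\<zeta>. cnj (k \<zeta>)" e] e compact_sphere by blast
    have gp: "real_polynomial_function (\<lambda>\<zeta>. Re (g \<zeta>))" "real_polynomial_function (\<lambda>\<zeta>. Im (g \<zeta>))"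
      using g(1) bounded_linear_Re bounded_linear_Im unfolding polynomial_function_def o_def by blast+
    have "fourier_mult (\<lambda>x. of_real (Re (g (ec 1 x))) + \<i> * of_real (Im (g (ec 1 x))))"
      by (intro fourier_mult_add fourier_mult_mult fourier_mult_const fourier_mult_polynomial gp)
    then have "fourier_mult (\<lambda>x. g (ec 1 x))" by (simp flip: complex_eq)
    then have "fourier_null (\<lambda>x. g (ec 1 x) * h x)" using null by (simp add: fourier_mult_def)
    then have I: "continuous_on {0..1} (\<lambda>x. g (ec 1 x) * h x)" "integral {0..1} (\<lambda>x. g (ec 1 x) * h x) = 0"
      by (auto simp: fourier_null_def ec_def dest: spec[of _ 0])
    have "complex_of_real (integral {0..1} (\<lambda>x. (norm (h x))\<^sup>2)) = integral {0..1} (\<lambda>x. complex_of_real ((norm (h x))\<^sup>2))"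
    proof -
      have "(\<lambda>x. (norm (h x))\<^sup>2) integrable_on {0..1}"
        by (intro integrable_continuous_interval continuous_intros c01)
      from integral_linear[OF this bounded_linear_of_real[where 'a = complex], symmetric, unfolded o_def]
      show ?thesis .
    qed
    also have "\<dots> = integral {0..1} (\<lambda>x. cnj (h x) * h x)"
      by (intro integral_cong) (simp only: complex_norm_square mult.commute)
    also have "\<dots> = integral {0..1} (\<lambda>x. cnj (h x) * h x) - integral {0..1} (\<lambda>x. g (ec 1 x) * h x)" using I by simp
    also have "\<dots> = integral {0..1} (\<lambda>x. cnj (h x) * h x - g (ec 1 x) * h x)"
      by (rule integral_diff[symmetric]) (intro integrable_continuous_interval continuous_intros c01 I)+
    finally have eq: "complex_of_real (integral {0..1} (\<lambda>x. (norm (h x))\<^sup>2)) = integral {0..1} (\<lambda>x. cnj (h x) * h x - g (ec 1 x) * h x)" .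
    have "integral {0..1} (\<lambda>x. (norm (h x))\<^sup>2) \<le> norm (complex_of_real (integral {0..1} (\<lambda>x. (norm (h x))\<^sup>2)))" by simp
    also have "\<dots> \<le> integral {0..1} (\<lambda>x. e * norm (h x))"
      unfolding eq
    proof (rule integral_norm_bound_integral)
      show "(\<lambda>x. cnj (h x) * h x - g (ec 1 x) * h x) integrable_on {0..1}" "(\<lambda>x. e * norm (h x)) integrable_on {0..1}"
        by (intro integrable_continuous_interval continuous_intros c01 I)+
      fix x :: real assume "x \<in> {0..1}"
      then have "ec 1 x \<in> sphere 0 1" using sph by blast
      then have "norm (cnj (h x) - g (ec 1 x)) \<le> e" using g(2)[of "ec 1 x"] k[of x] by simp
      then have "norm (cnj (h x) - g (ec 1 x)) * norm (h x) \<le> e * norm (h x)" by (rule mult_right_mono) simp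
      then show "norm (cnj (h x) * h x - g (ec 1 x) * h x) \<le> e * norm (h x)"
        by (simp add: norm_mult[symmetric] algebra_simps)
    qed
    finally show ?thesis by simp
  qed
  have nn: "0 \<le> integral {0..1} (\<lambda>x. (norm (h x))\<^sup>2)"
    by (intro integral_nonneg integrable_continuous_interval continuous_intros c01) auto
  have "integral {0..1} (\<lambda>x. (norm (h x))\<^sup>2) \<le> 0"
  proof (rule field_le_epsilon)
    fix e :: real assume e: "e > 0"
    define J where "J = integral {0..1} (\<lambda>x. norm (h x))"
    have J: "J \<ge> 0" unfolding J_def
      by (intro integral_nonneg integrable_continuous_interval continuous_intros c01) auto
    have "integral {0..1} (\<lambda>x. (norm (h x))\<^sup>2) \<le> e / (J + 1) * J"
      using approx[of "e / (J + 1)"] e J by (simp add: J_def)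
    also have "\<dots> \<le> e" using e J by (simp add: field_simps)
    finally show "integral {0..1} (\<lambda>x. (norm (h x))\<^sup>2) \<le> 0 + e" by simp
  qed
  then have "integral {0..1} (\<lambda>x. (norm (h x))\<^sup>2) = 0" using nn by simp
  then have h0: "\<forall>x\<in>{0..1}. (norm (h x))\<^sup>2 = 0"
    by (subst (asm) integral_eq_0_iff) (auto intro!: continuous_intros c01)
  have "h x = h (frac x + of_int \<lfloor>x\<rfloor>)" by (simp add: frac_def)
  also have "\<dots> = h (frac x)" by (rule periodic_int[of h, OF p])
  also have "\<dots> = 0" using h0 frac_ge_0[of x] frac_lt_1[of x] by auto
  finally show ?thesis .
qed

lemma fourier_unique_2:
  fixes W :: "real \<Rightarrow> real \<Rightarrow> complex"
  assumes c: "continuous_on UNIV (\<lambda>p. W (fst p) (snd p))"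
    and p: "\<And>x y. W (x + 1) y = W x y" "\<And>x y. W x (y + 1) = W x y"
    and z: "\<And>m n. integral {0..1} (\<lambda>x. integral {0..1} (\<lambda>y. W x y * ec n y) * ec m x) = 0"
  shows "W x y = 0"
proof -
  have cW: "continuous_on UNIV (W x)" for x
  proof -
    have "continuous_on UNIV (\<lambda>y. (x, y))" by (intro continuous_intros)
    from continuous_on_compose2[OF c this] show ?thesis by simp
  qed
  have "integral {0..1} (\<lambda>y. W x y * ec n y) = 0" for x n
  proof (rule fourier_unique[where h = "\<lambda>x. integral {0..1} (\<lambda>y. W x y * ec n y)"])
    show "continuous_on UNIV (\<lambda>x. integral {0..1} (\<lambda>y. W x y * ec n y))"
    proof -
      have "continuous_on (UNIV \<times> cbox 0 1) (\<lambda>(x, y). W x y * ec n y)"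
      proof -
        have "continuous_on UNIV (\<lambda>p. W (fst p) (snd p) * ec n (snd p))"
          by (intro continuous_intros c continuous_on_compose2[OF continuous_ec[of UNIV]]) auto
        then show ?thesis unfolding case_prod_unfold by (rule continuous_on_subset) simp
      qed
      from integral_continuous_on_param[OF this] show ?thesis by simp
    qed
    show "integral {0..1} (\<lambda>y. W (x + 1) y * ec n y) = integral {0..1} (\<lambda>y. W x y * ec n y)" for x
      by (simp add: p)
  qed (rule z)
  then show ?thesis by (intro fourier_unique[OF cW p(2)])
qed

section \<open>Averages of periodic entire functions\<close>

text \<open>For a primitive P the integral is P(s + 1) - P(s), whose derivative h(s + 1) - h(s) is
  0. Thus even shifts by complex s do not change it.\<close>

lemma periodic_entire_integral:
  fixes h :: "complex \<Rightarrow> complex"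
  assumes h: "h holomorphic_on UNIV" and p: "\<And>s. h (s + 1) = h s"
  shows "integral {0..1} (\<lambda>y. h (s + of_real y)) = integral {0..1} (\<lambda>y. h (of_real y))"
proof -
  obtain P where P: "\<And>s. (P has_field_derivative h s) (at s)"
    using holomorphic_convex_primitive'[OF convex_UNIV open_UNIV h] by auto
  have I: "integral {0..1} (\<lambda>y. h (s + of_real y)) = P (s + 1) - P s" for s
  proof -
    have "((\<lambda>y. h (s + of_real y)) has_integral (P (s + of_real 1) - P (s + of_real 0))) {0..1}"
    proof (rule fundamental_theorem_of_calculus)
      fix x :: real
      have "((\<lambda>y. P (s + y)) has_field_derivative h (s + of_real x)) (at (of_real x))"
        using DERIV_shift[of P "h (s + of_real x)" "of_real x" s] P[of "s + of_real x"] by (simp add: add.commute)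
      then show "((\<lambda>y. P (s + of_real y)) has_vector_derivative h (s + of_real x)) (at x within {0..1})"
        using has_vector_derivative_real_field[of "\<lambda>y. P (s + y)"] by blast
    qed simp
    then show ?thesis by (simp add: integral_unique)
  qed
  have D: "((\<lambda>s. P (s + 1) - P s) has_field_derivative 0) (at s)" for s
  proof -
    have "((\<lambda>s. P (s + 1)) has_field_derivative h (s + 1)) (at s)"
      using DERIV_shift[of P "h (s + 1)" s 1] P[of "s + 1"] by simp
    from DERIV_diff[OF this P[of s]] show ?thesis by (simp add: p)
  qed
  obtain c where "\<And>s. P (s + 1) - P s = c"
    using has_field_derivative_zero_constant[of UNIV "\<lambda>s. P (s + 1) - P s"] D by auto
  then have "P (s + 1) - P s = P (0 + 1) - P 0" by metis
  then show ?thesis using I[of s] I[of 0] by simp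
qed

section \<open>Theta functions of level one\<close>

definition e1 :: "complex^2" where "e1 = vector [1, 0]"
definition e2 :: "complex^2" where "e2 = vector [0, 1]"

definition pt :: "complex^2 \<Rightarrow> complex \<Rightarrow> complex \<Rightarrow> complex^2" where
  "pt z s t = z + s *s e1 + t *s e2"

lemma pt_component: "pt z s t $ 1 = z $ 1 + s" "pt z s t $ 2 = z $ 2 + t"
  by (simp_all add: pt_def e1_def e2_def)

lemma pt_eq: "pt z s t = vector [z $ 1 + s, z $ 2 + t]"
  by (simp add: vec_eq_iff forall_2 pt_component)

definition average :: "(complex^2 \<Rightarrow> complex) \<Rightarrow> complex^2 \<Rightarrow> complex" where
  "average H z = integral {0..1} (\<lambda>x. integral {0..1} (\<lambda>y. H (pt z (of_real x) (of_real y))))"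

definition line_holomorphic :: "(complex^2 \<Rightarrow> complex) \<Rightarrow> bool" where
  "line_holomorphic H \<longleftrightarrow> continuous_on UNIV H \<and> (\<forall>z w. (\<lambda>t. H (z + t *s w)) holomorphic_on UNIV)"

lemma continuous_on_pt:
  assumes "continuous_on S f" "continuous_on S g"
  shows "continuous_on S (\<lambda>x. pt z (f x) (g x))"
  by (rule continuous_on_vec_2) (auto simp: pt_component intro!: continuous_intros assms)

text \<open>The shift is carried out one coordinate at a time, with the order of integration swapped
  so that the shifted coordinate is the inner one.\<close>

lemma average_const:
  assumes H: "line_holomorphic H" and p: "\<And>z. H (z + e1) = H z" "\<And>z. H (z + e2) = H z"
  shows "average H z = average H 0"
proof -
  have c: "continuous_on UNIV H" using H by (simp add: line_holomorphic_def)
  have h: "(\<lambda>t. H (z + t *s w)) holomorphic_on UNIV" for z w using H by (simp add: line_holomorphic_def)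
  have i2: "integral {0..1} (\<lambda>y. H (pt z s (t + of_real y))) = integral {0..1} (\<lambda>y. H (pt z s (of_real y)))" for z s t
  proof -
    have "integral {0..1} (\<lambda>y. (\<lambda>t. H (z + s *s e1 + t *s e2)) (t + of_real y)) = integral {0..1} (\<lambda>y. (\<lambda>t. H (z + s *s e1 + t *s e2)) (of_real y))"
    proof (rule periodic_entire_integral[OF h])
      fix t :: complex
      have "z + s *s e1 + (t + 1) *s e2 = (z + s *s e1 + t *s e2) + e2" by (simp add: vec_eq_iff algebra_simps)
      then show "H (z + s *s e1 + (t + 1) *s e2) = H (z + s *s e1 + t *s e2)" by (simp only: p)
    qed
    then show ?thesis by (simp add: pt_def)
  qed
  have i1: "integral {0..1} (\<lambda>x. H (pt z (s + of_real x) t)) = integral {0..1} (\<lambda>x. H (pt z (of_real x) t))" for z s t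
  proof -
    have "integral {0..1} (\<lambda>y. (\<lambda>s. H (z + t *s e2 + s *s e1)) (s + of_real y)) = integral {0..1} (\<lambda>y. (\<lambda>s. H (z + t *s e2 + s *s e1)) (of_real y))"
    proof (rule periodic_entire_integral[OF h])
      fix s :: complex
      have "z + t *s e2 + (s + 1) *s e1 = (z + t *s e2 + s *s e1) + e1" by (simp add: vec_eq_iff algebra_simps)
      then show "H (z + t *s e2 + (s + 1) *s e1) = H (z + t *s e2 + s *s e1)" by (simp only: p)
    qed
    then show ?thesis by (simp add: pt_def add_ac)
  qed
  have swap: "average H z = integral {0..1} (\<lambda>y. integral {0..1} (\<lambda>x. H (pt z (of_real x) (of_real y))))" for z
  proof -
    have "continuous_on (cbox (0::real, 0::real) (1, 1)) (\<lambda>(x, y). H (pt z (of_real x) (of_real y)))"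
      unfolding case_prod_unfold
      by (rule continuous_on_compose2[OF c]) (auto intro!: continuous_on_pt continuous_intros)
    from integral_swap_continuous[OF this] show ?thesis by (simp add: average_def)
  qed
  have z: "z = pt (pt 0 (z $ 1) 0) 0 (z $ 2)" by (simp add: vec_eq_iff forall_2 pt_component)
  have "average H z = average H (pt (pt 0 (z $ 1) 0) 0 (z $ 2))" using z by simp
  also have "\<dots> = integral {0..1} (\<lambda>x. integral {0..1} (\<lambda>y. H (pt (pt 0 (z $ 1) 0) (of_real x) (z $ 2 + of_real y))))"
    unfolding average_def by (simp add: pt_eq)
  also have "\<dots> = average H (pt 0 (z $ 1) 0)" unfolding i2 average_def ..
  also have "\<dots> = integral {0..1} (\<lambda>y. integral {0..1} (\<lambda>x. H (pt 0 (z $ 1 + of_real x) (of_real y))))"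
    unfolding swap by (simp add: pt_eq)
  also have "\<dots> = average H 0" unfolding i1 swap ..
  finally show ?thesis .
qed

definition quasi_periodic :: "complex^2^2 \<Rightarrow> (complex^2 \<Rightarrow> complex) \<Rightarrow> bool" where
  "quasi_periodic \<tau> F \<longleftrightarrow> line_holomorphic F \<and> (\<forall>z m. F (z + cvec m) = F z) \<and>
     (\<forall>z n. F (z + \<tau> *v cvec n) = exp (- of_real pi * \<i> * (bdot (cvec n) (\<tau> *v cvec n) + 2 * bdot (cvec n) z)) * F z)"

text \<open>Made so that \<open>average (twist n F)\<close> is the n-th Fourier coefficient of
  F.\<close>

definition twist :: "int^2 \<Rightarrow> (complex^2 \<Rightarrow> complex) \<Rightarrow> complex^2 \<Rightarrow> complex" where
  "twist n F z = F z * exp (- 2 * of_real pi * \<i> * bdot (cvec n) z)"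

lemma e_cvec: "e1 = cvec (vector [1, 0])" "e2 = cvec (vector [0, 1])"
  by (simp_all add: vec_eq_iff forall_2 e1_def e2_def)

lemma continuous_on_bdot: "continuous_on S (bdot v)"
  unfolding bdot_2[abs_def] by (intro continuous_intros)

lemma twist_line_holomorphic:
  assumes "line_holomorphic F"
  shows "line_holomorphic (twist n F)"
  unfolding line_holomorphic_def
proof (intro conjI allI)
  show "continuous_on UNIV (twist n F)"
    unfolding twist_def[abs_def] using assms by (intro continuous_intros continuous_on_bdot) (simp add: line_holomorphic_def)
  show "(\<lambda>t. twist n F (z + t *s w)) holomorphic_on UNIV" for z w
    unfolding twist_def bdot_simps using assms by (intro holomorphic_intros) (simp add: line_holomorphic_def)
qed

lemma twist_periodic:
  assumes "quasi_periodic \<tau> F"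
  shows "twist n F (z + cvec m) = twist n F z"
proof -
  have "exp (- 2 * of_real pi * \<i> * bdot (cvec n) (z + cvec m)) = exp (- 2 * of_real pi * \<i> * bdot (cvec n) z) * exp (2 * of_real pi * \<i> * of_int (- (n $ 1 * m $ 1 + n $ 2 * m $ 2)))"
    unfolding bdot_add_right bdot_cvec exp_add[symmetric] by (rule arg_cong[where f = exp]) (simp add: algebra_simps)
  then show ?thesis using assms unfolding twist_def quasi_periodic_def exp_2pi_int by simp
qed

lemma average_twist_const:
  assumes "quasi_periodic \<tau> F"
  shows "average (twist n F) z = average (twist n F) 0"
  using assms twist_periodic[OF assms]
  by (intro average_const twist_line_holomorphic) (auto simp: quasi_periodic_def e_cvec)

lemma average_cmult: "average (\<lambda>z. c * H z) z = c * average H z"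
  by (simp add: average_def)

text \<open>Translation by tau k preserves the average and, by quasi-periodicity, turns
  \<open>twist 0 F\<close> into a multiple of \<open>twist k F\<close>. So the zeroth coefficient
  determines all others.\<close>

lemma average_twist_shift:
  assumes F: "quasi_periodic \<tau> F" and H: "\<tau> \<in> siegel_H2"
  shows "average (twist k F) 0 = exp (of_real pi * \<i> * bdot (cvec k) (\<tau> *v cvec k)) * average (twist 0 F) 0"
proof -
  have t: "twist 0 F (z + \<tau> *v cvec k) = exp (- of_real pi * \<i> * bdot (cvec k) (\<tau> *v cvec k)) * twist k F z" for z
  proof -
    have "F (z + \<tau> *v cvec k) = exp (- of_real pi * \<i> * (bdot (cvec k) (\<tau> *v cvec k) + 2 * bdot (cvec k) z)) * F z"
      using F unfolding quasi_periodic_def by blast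
    also have "exp (- of_real pi * \<i> * (bdot (cvec k) (\<tau> *v cvec k) + 2 * bdot (cvec k) z))
      = exp (- of_real pi * \<i> * bdot (cvec k) (\<tau> *v cvec k)) * exp (- 2 * of_real pi * \<i> * bdot (cvec k) z)"
      unfolding exp_add[symmetric] by (rule arg_cong[where f = exp]) (simp add: algebra_simps)
    finally show ?thesis by (simp add: twist_def bdot_2)
  qed
  have "average (twist 0 F) 0 = average (twist 0 F) (\<tau> *v cvec k)" using average_twist_const[OF F] by metis
  also have "\<dots> = average (\<lambda>z. twist 0 F (z + \<tau> *v cvec k)) 0"
  proof -
    have "pt (\<tau> *v cvec k) s r = pt 0 s r + \<tau> *v cvec k" for s r by (simp add: pt_def add_ac)
    then show ?thesis by (simp add: average_def)
  qed
  also have "\<dots> = exp (- of_real pi * \<i> * bdot (cvec k) (\<tau> *v cvec k)) * average (twist k F) 0"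
    unfolding t average_cmult ..
  finally show ?thesis by (simp add: exp_minus)
qed

lemma quasi_periodic_zero:
  assumes F: "quasi_periodic \<tau> F" and H: "\<tau> \<in> siegel_H2" and z0: "average (twist 0 F) 0 = 0"
  shows "F z = 0"
proof -
  have av: "average (twist n F) z = 0" for n
    using average_twist_const[OF F, of n z] average_twist_shift[OF F H, of n] z0 by (metis mult_zero_right)
  define W where "W x y = F (pt z (of_real x) (of_real y))" for x y
  have c: "continuous_on UNIV F" using F by (simp add: quasi_periodic_def line_holomorphic_def)
  have per: "F (u + e1) = F u" "F (u + e2) = F u" for u using F unfolding quasi_periodic_def e_cvec by blast+
  have "W 0 0 = 0"
  proof (rule fourier_unique_2[where W = W])
    show "continuous_on UNIV (\<lambda>p. W (fst p) (snd p))"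
      unfolding W_def by (rule continuous_on_compose2[OF c]) (auto intro!: continuous_on_pt continuous_intros)
    show "W (x + 1) y = W x y" for x y
    proof -
      have "pt z (of_real (x + 1)) (of_real y) = pt z (of_real x) (of_real y) + e1" by (simp add: vec_eq_iff forall_2 pt_component e1_def)
      then show ?thesis unfolding W_def using per by simp
    qed
    show "W x (y + 1) = W x y" for x y
    proof -
      have "pt z (of_real x) (of_real (y + 1)) = pt z (of_real x) (of_real y) + e2" by (simp add: vec_eq_iff forall_2 pt_component e2_def)
      then show ?thesis unfolding W_def using per by simp
    qed
    fix m n :: int
    \<comment> \<open>The signs differ because \<open>ec\<close> carries a positive and
      \<open>twist\<close> a negative exponent; E accounts for the base point z.\<close>
    define k :: "int^2" where "k = vector [- m, - n]"
    define E where "E = exp (2 * of_real pi * \<i> * bdot (cvec k) z)"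
    have "W x y * ec n y * ec m x = E * twist k F (pt z (of_real x) (of_real y))" for x y
    proof -
      have "E * exp (- 2 * of_real pi * \<i> * bdot (cvec k) (pt z (of_real x) (of_real y))) = ec n y * ec m x"
        unfolding E_def ec_def exp_add[symmetric]
        by (rule arg_cong[where f = exp]) (simp add: bdot_2 pt_component k_def algebra_simps)
      then show ?thesis unfolding W_def twist_def by (simp add: mult_ac)
    qed
    then have "(\<lambda>x. integral {0..1} (\<lambda>y. W x y * ec n y) * ec m x) = (\<lambda>x. E * integral {0..1} (\<lambda>y. twist k F (pt z (of_real x) (of_real y))))"
      by (simp flip: integral_mult_left integral_mult_right)
    then have "integral {0..1} (\<lambda>x. integral {0..1} (\<lambda>y. W x y * ec n y) * ec m x) = E * average (twist k F) z"
      by (simp add: average_def)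
    then show "integral {0..1} (\<lambda>x. integral {0..1} (\<lambda>y. W x y * ec n y) * ec m x) = 0" using av by simp
  qed
  then show ?thesis by (simp add: W_def pt_def)
qed

lemma quasi_periodic_theta:
  assumes "\<tau> \<in> siegel_H2"
  shows "quasi_periodic \<tau> (riemann_theta \<tau>)"
proof -
  have "entire2 (riemann_theta \<tau>)" using entire2_riemann_theta[OF assms, of 1 0] by (simp add: vector_scalar_mult_def)
  then show ?thesis
    unfolding quasi_periodic_def line_holomorphic_def
    using continuous_riemann_theta[OF assms] riemann_theta_periodic riemann_theta_quasi_periodic[OF assms]
      entire2_holomorphic by blast
qed

lemma average_lincomb:
  assumes "continuous_on UNIV F" "continuous_on UNIV G"
  shows "average (\<lambda>z. a * F z - b * G z) z = a * average F z - b * average G z"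
proof -
  have c: "continuous_on (UNIV \<times> cbox 0 1) (\<lambda>(x, y). H (pt z (of_real x) (of_real y)))" if "continuous_on UNIV H" for H :: "complex^2 \<Rightarrow> complex"
    unfolding case_prod_unfold
    by (rule continuous_on_compose2[OF that]) (auto intro!: continuous_on_pt continuous_intros)
  have i: "(\<lambda>y. H (pt z (of_real x) (of_real y))) integrable_on {0..1}" if "continuous_on UNIV H" for H :: "complex^2 \<Rightarrow> complex" and x :: real
    by (intro integrable_continuous_interval continuous_on_compose2[OF that] continuous_on_pt continuous_intros) auto
  have j: "(\<lambda>x. integral {0..1} (\<lambda>y. H (pt z (of_real x) (of_real y)))) integrable_on {0..1}" if "continuous_on UNIV H" for H :: "complex^2 \<Rightarrow> complex"
    using integral_continuous_on_param[OF c[OF that]]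
    by (intro integrable_continuous_interval) (auto intro: continuous_on_subset)
  have ca: "continuous_on UNIV (\<lambda>z. a * F z)" "continuous_on UNIV (\<lambda>z. b * G z)"
    using assms by (auto intro!: continuous_intros)
  have "integral {0..1} (\<lambda>y. a * F (pt z (of_real x) (of_real y)) - b * G (pt z (of_real x) (of_real y)))
    = integral {0..1} (\<lambda>y. a * F (pt z (of_real x) (of_real y))) - integral {0..1} (\<lambda>y. b * G (pt z (of_real x) (of_real y)))" for x
    by (rule integral_diff[OF i[OF ca(1)] i[OF ca(2)]])
  then have "average (\<lambda>z. a * F z - b * G z) z = average (\<lambda>z. a * F z) z - average (\<lambda>z. b * G z) z"
    unfolding average_def using integral_diff[OF j[OF ca(1)] j[OF ca(2)]] by simp
  then show ?thesis by (simp only: average_cmult)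
qed

text \<open>In a F - b theta the zeroth Fourier coefficient cancels, so this combination vanishes.
  The coefficient a of theta is nonzero, since otherwise theta itself would vanish.\<close>

theorem quasi_periodic_proportional:
  assumes F: "quasi_periodic \<tau> F" and H: "\<tau> \<in> siegel_H2"
  obtains c where "\<And>z. F z = c * riemann_theta \<tau> z"
proof -
  let ?T = "riemann_theta \<tau>"
  note T = quasi_periodic_theta[OF H]
  define a b where "a = average (twist 0 ?T) 0" and "b = average (twist 0 F) 0"
  have a: "a \<noteq> 0" using quasi_periodic_zero[OF T H] riemann_theta_not_zero[OF H] unfolding a_def by metis
  have c: "continuous_on UNIV F" "continuous_on UNIV ?T"
    using F T by (auto simp: quasi_periodic_def line_holomorphic_def)
  have "quasi_periodic \<tau> (\<lambda>z. a * F z - b * ?T z)"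
    unfolding quasi_periodic_def line_holomorphic_def
  proof (intro conjI allI)
    show "continuous_on UNIV (\<lambda>z. a * F z - b * ?T z)" by (intro continuous_intros c)
    show "(\<lambda>t. a * F (z + t *s w) - b * ?T (z + t *s w)) holomorphic_on UNIV" for z w
      using F T by (intro holomorphic_intros) (auto simp: quasi_periodic_def line_holomorphic_def)
    show "a * F (z + cvec m) - b * ?T (z + cvec m) = a * F z - b * ?T z" for z m
      using F T unfolding quasi_periodic_def by simp
    show "a * F (z + \<tau> *v cvec n) - b * ?T (z + \<tau> *v cvec n)
      = exp (- of_real pi * \<i> * (bdot (cvec n) (\<tau> *v cvec n) + 2 * bdot (cvec n) z)) * (a * F z - b * ?T z)" for z n
    proof -
      have "F (z + \<tau> *v cvec n) = exp (- of_real pi * \<i> * (bdot (cvec n) (\<tau> *v cvec n) + 2 * bdot (cvec n) z)) * F z"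
        using F unfolding quasi_periodic_def by blast
      then show ?thesis unfolding riemann_theta_quasi_periodic[OF H] by (simp add: algebra_simps)
    qed
  qed
  moreover have "average (twist 0 (\<lambda>z. a * F z - b * ?T z)) 0 = 0"
  proof -
    have t0: "twist 0 G = G" for G by (simp add: twist_def[abs_def] bdot_2)
    show ?thesis using average_lincomb[OF c, of a b 0] by (simp add: t0 a_def b_def)
  qed
  ultimately have "a * F z - b * ?T z = 0" for z using quasi_periodic_zero H by blast
  then have "F z = b / a * ?T z" for z using a by (simp add: field_simps)
  then show thesis by (rule that)
qed

section \<open>The symplectic action\<close>

definition cmat :: "int^2^2 \<Rightarrow> complex^2^2" where
  "cmat M = (\<chi> i j. of_int (M $ i $ j))"

definition cconj :: "complex^2 \<Rightarrow> complex^2" where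
  "cconj v = (\<chi> i. cnj (v $ i))"

lemma cmat_component [simp]: "cmat M $ i $ j = of_int (M $ i $ j)"
  by (simp add: cmat_def)

lemma cmat_mult_cvec: "cmat M *v cvec n = cvec (M *v n)"
  by (simp add: vec_eq_iff matrix_vector_mult_def)

lemma cconj_mult: "cconj (cmat M *v v) = cmat M *v cconj v"
  by (simp add: vec_eq_iff matrix_vector_mult_def cconj_def)

lemma cconj_add: "cconj (u + v) = cconj u + cconj v"
  by (simp add: vec_eq_iff cconj_def)

lemma bdot_matrix: "bdot (M *v x) (N *v y) = bdot x ((transpose M ** N) *v y)"
  by (simp add: bdot_transpose[of x] bdot_commute matrix_transpose_mul transpose_transpose matrix_vector_mul_assoc[symmetric] bdot_transpose)

lemma bdot_ext:
  assumes "\<And>v. bdot x v = bdot y v"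
  shows "x = y"
  using assms[of e1] assms[of e2] by (simp add: vec_eq_iff forall_2 bdot_2 e1_def e2_def)

lemma hermitian_imq:
  assumes "\<tau> \<in> siegel_H2"
  shows "bdot (cconj v) (\<tau> *v v) - bdot (cconj (\<tau> *v v)) v
    = 2 * \<i> * of_real (imq \<tau> (\<chi> i. Re (v $ i)) + imq \<tau> (\<chi> i. Im (v $ i)))"
  by (simp add: imq_2[OF assms] bdot_2 cconj_def matrix_vector_mult_def sum_2 siegel_H2_nth[OF assms]
      complex_eq_iff power2_eq_square algebra_simps)

locale symplectic_blocks =
  fixes A B C D :: "int^2^2" and \<tau> :: "complex^2^2"
  assumes AC: "transpose A ** C = transpose C ** A"
    and BD: "transpose B ** D = transpose D ** B"
    and AD: "transpose A ** D - transpose C ** B = mat 1"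
    and \<tau>: "\<tau> \<in> siegel_H2"
begin

abbreviation "a \<equiv> cmat A"
abbreviation "b \<equiv> cmat B"
abbreviation "c \<equiv> cmat C"
abbreviation "d \<equiv> cmat D"

definition K where "K = c ** \<tau> + d"
definition L where "L = a ** \<tau> + b"

text \<open>The block relations say that the matrix preserves the alternating pairing of (x, y) and
  (x', y'). With x = tau v and y = v the transformed pair is (L v, K v), and the later identities
  are such instances.\<close>

lemma form: "bdot (c *v x + d *v y) (a *v x' + b *v y') - bdot (a *v x + b *v y) (c *v x' + d *v y')
  = bdot y x' - bdot x y'"
proof -
  have cm: "cmat (M ** N) = cmat M ** cmat N" "cmat (transpose M) = transpose (cmat M)"
    "cmat (M - N) = cmat M - cmat N" "cmat (mat 1) = mat 1" for M N
    by (simp_all add: vec_eq_iff matrix_matrix_mult_def transpose_def mat_def)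
  have 1: "transpose a ** c = transpose c ** a" "transpose b ** d = transpose d ** b" "transpose a ** d - transpose c ** b = mat 1"
    using arg_cong[OF AC, of cmat] arg_cong[OF BD, of cmat] arg_cong[OF AD, of cmat] by (simp_all add: cm)
  have "transpose (transpose a ** d - transpose c ** b) = mat 1" by (simp add: 1 transpose_mat)
  then have 2: "transpose d ** a - transpose b ** c = mat 1"
    by (simp add: matrix_transpose_mul transpose_def[of "_ - _"] vec_eq_iff)
       (simp add: matrix_transpose_mul[symmetric] transpose_def matrix_matrix_mult_def mult_ac)
  have 3: "transpose a ** d = mat 1 + transpose c ** b" "transpose d ** a = mat 1 + transpose b ** c"
    using 1(3) 2 by (simp_all add: algebra_simps)
  show ?thesis
    unfolding bdot_add_left bdot_add_right bdot_matrix 1(1,2) 3 matrix_vector_mult_add_rdistrib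
    by (simp add: bdot_simps)
qed

lemma K_mult: "K *v v = c *v (\<tau> *v v) + d *v v"
  by (simp add: K_def matrix_vector_mult_add_rdistrib matrix_vector_mul_assoc)
lemma L_mult: "L *v v = a *v (\<tau> *v v) + b *v v"
  by (simp add: L_def matrix_vector_mult_add_rdistrib matrix_vector_mul_assoc)

text \<open>Transports the positivity of Im tau. It yields the injectivity of K and, where K v is
  real, the positivity of Im tau'.\<close>

lemma hermitian_form:
  "bdot (cconj (K *v v)) (L *v v) - bdot (cconj (L *v v)) (K *v v)
    = 2 * \<i> * of_real (imq \<tau> (\<chi> i. Re (v $ i)) + imq \<tau> (\<chi> i. Im (v $ i)))"
  unfolding K_mult L_mult cconj_add cconj_mult form hermitian_imq[OF \<tau>, symmetric] ..

lemma imq_Re_Im_pos: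
  assumes "v \<noteq> 0"
  shows "imq \<tau> (\<chi> i. Re (v $ i)) + imq \<tau> (\<chi> i. Im (v $ i)) > 0"
proof -
  have nn: "imq \<tau> w \<ge> 0" for w using imq_pos[OF \<tau>, of w] by (cases "w = 0") (auto simp: imq_def)
  have "(\<chi> i. Re (v $ i)) \<noteq> 0 \<or> (\<chi> i. Im (v $ i)) \<noteq> 0"
    using assms by (auto simp: vec_eq_iff complex_eq_iff)
  then show ?thesis using imq_pos[OF \<tau>] nn by (metis add_pos_nonneg add_nonneg_pos)
qed

lemma K_invertible: "invertible K"
proof -
  have "v = 0" if "K *v v = 0" for v
  proof (rule ccontr)
    assume "v \<noteq> 0"
    have "cconj 0 = 0" "bdot 0 w = 0" "bdot w 0 = 0" for w by (simp_all add: vec_eq_iff cconj_def bdot_2)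
    then have "imq \<tau> (\<chi> i. Re (v $ i)) + imq \<tau> (\<chi> i. Im (v $ i)) = 0"
      using hermitian_form[of v] that by (simp add: complex_eq_iff)
    then show False using imq_Re_Im_pos[OF \<open>v \<noteq> 0\<close>] by simp
  qed
  then show ?thesis by (simp add: invertible_left_inverse matrix_left_invertible_ker)
qed

definition \<tau>' where "\<tau>' = L ** matrix_inv K"

lemma \<tau>'_K: "\<tau>' *v (K *v v) = L *v v"
  unfolding \<tau>'_def matrix_vector_mul_assoc matrix_mul_assoc[symmetric] matrix_inv_mult(2)[OF K_invertible] by simp

lemma K_surj: obtains v where "u = K *v v"
  using matrix_vector_mult_compose_inv(1)[OF K_invertible, of u] by metis

lemma \<tau>'_bdot: "bdot u (\<tau>' *v w) = bdot w (\<tau>' *v u)"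
proof -
  obtain v v' where u: "u = K *v v" and w: "w = K *v v'" using K_surj by metis
  have "bdot (K *v v) (L *v v') - bdot (L *v v) (K *v v') = bdot v (\<tau> *v v') - bdot (\<tau> *v v) v'"
    unfolding K_mult L_mult form ..
  also have "\<dots> = 0" using siegel_H2_bdot[OF \<tau>, of v v'] by (simp add: bdot_commute)
  finally show ?thesis unfolding u w \<tau>'_K by (simp add: bdot_commute)
qed

lemma \<tau>'_in: "\<tau>' \<in> siegel_H2"
proof -
  have "\<tau>' $ 1 $ 2 = \<tau>' $ 2 $ 1"
    using \<tau>'_bdot[of e1 e2] by (simp add: bdot_2 e1_def e2_def matrix_vector_mult_def sum_2)
  then have sym: "transpose \<tau>' = \<tau>'" by (simp add: vec_eq_iff forall_2 transpose_def)
  have "u \<bullet> ((\<chi> i j. Im (\<tau>' $ i $ j)) *v u) > 0" if "u \<noteq> 0" for u :: "real^2"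
  proof -
    obtain v where v: "rvec u = K *v v" using K_surj by blast
    have "rvec u \<noteq> 0" using that by (auto simp: vec_eq_iff)
    then have "v \<noteq> 0" using v by (auto simp: matrix_vector_mult_0_right)
    have "cconj (rvec u) = rvec u" by (simp add: vec_eq_iff cconj_def)
    then have "bdot (rvec u) (\<tau>' *v rvec u) - bdot (cconj (\<tau>' *v rvec u)) (rvec u)
        = 2 * \<i> * of_real (imq \<tau> (\<chi> i. Re (v $ i)) + imq \<tau> (\<chi> i. Im (v $ i)))"
      using hermitian_form[of v] unfolding \<tau>'_K[symmetric] v[symmetric] by simp
    then have "2 * Im (bdot (rvec u) (\<tau>' *v rvec u)) = 2 * (imq \<tau> (\<chi> i. Re (v $ i)) + imq \<tau> (\<chi> i. Im (v $ i)))"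
      by (simp add: complex_eq_iff bdot_2 cconj_def algebra_simps)
    moreover have "Im (bdot (rvec u) (\<tau>' *v rvec u)) = u \<bullet> ((\<chi> i j. Im (\<tau>' $ i $ j)) *v u)"
      by (simp add: bdot_2 matrix_vector_mult_def sum_2 inner_vec_def)
    ultimately show ?thesis using imq_Re_Im_pos[OF \<open>v \<noteq> 0\<close>] by simp
  qed
  then show ?thesis using sym by (simp add: siegel_H2_def)
qed

text \<open>This is \<open>(C\<tau> + D)\<^bsup>-T\<^esup>\<close>, in a form that makes the images of lattice points visible.\<close>

definition P where "P z = a *v z - \<tau>' *v (c *v z)"

lemma P_K: "bdot (P z) (K *v v) = bdot z v"
proof -
  have "bdot (c *v z + d *v 0) (a *v (\<tau> *v v) + b *v v) - bdot (a *v z + b *v 0) (c *v (\<tau> *v v) + d *v v) = bdot 0 (\<tau> *v v) - bdot z v"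
    by (rule form)
  then have "bdot (c *v z) (L *v v) - bdot (a *v z) (K *v v) = - bdot z v"
    by (simp add: K_mult L_mult matrix_vector_mult_0_right bdot_2)
  moreover have "bdot (\<tau>' *v (c *v z)) (K *v v) = bdot (c *v z) (L *v v)"
    using \<tau>'_bdot[of "K *v v" "c *v z"] by (simp add: \<tau>'_K bdot_commute)
  ultimately show ?thesis by (simp add: P_def bdot_simps algebra_simps)
qed

lemma P_\<tau>: "P (\<tau> *v w) = \<tau>' *v (d *v w) - b *v w"
proof (rule bdot_ext)
  fix u
  obtain v where u: "u = K *v v" using K_surj by blast
  have "bdot (c *v 0 + d *v w) (a *v (\<tau> *v v) + b *v v) - bdot (a *v 0 + b *v w) (c *v (\<tau> *v v) + d *v v) = bdot w (\<tau> *v v) - bdot 0 v"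
    by (rule form)
  then have "bdot (d *v w) (L *v v) - bdot (b *v w) (K *v v) = bdot w (\<tau> *v v)"
    by (simp add: K_mult L_mult matrix_vector_mult_0_right bdot_2)
  moreover have "bdot (\<tau>' *v (d *v w)) (K *v v) = bdot (d *v w) (L *v v)"
    using \<tau>'_bdot[of "K *v v" "d *v w"] by (simp add: \<tau>'_K bdot_commute)
  moreover have "bdot (\<tau> *v w) v = bdot w (\<tau> *v v)" using siegel_H2_bdot[OF \<tau>, of v w] by (simp add: bdot_commute)
  ultimately show "bdot (P (\<tau> *v w)) u = bdot (\<tau>' *v (d *v w) - b *v w) u"
    unfolding u P_K by (simp add: bdot_simps)
qed

lemma P_add: "P (z + w) = P z + P w"
  by (simp add: P_def matrix_vector_right_distrib)

lemma P_scale: "P (k *s z) = k *s P z"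
  by (simp add: P_def matrix_vector_mult_scale vector_sub_rdistrib)

lemma P_surj: obtains z where "u = P z"
proof
  show "u = P (transpose K *v u)"
  proof (rule bdot_ext)
    fix w
    obtain v where w: "w = K *v v" using K_surj by blast
    show "bdot u w = bdot (P (transpose K *v u)) w"
      unfolding w P_K bdot_transpose[of u K v] ..
  qed
qed

text \<open>As P is the inverse transpose of K, this is the bilinear form belonging to the quadratic
  form z^T (C tau + D)^(-1) C z of the automorphy factor.\<close>

definition N where "N z w = bdot (c *v z) (P w)"

lemma N_sym: "N z w = N w z"
proof -
  have "bdot (c *v z + d *v 0) (a *v w + b *v 0) - bdot (a *v z + b *v 0) (c *v w + d *v 0) = bdot 0 w - bdot z 0"
    by (rule form)
  then have "bdot (c *v z) (a *v w) = bdot (c *v w) (a *v z)"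
    by (simp add: matrix_vector_mult_0_right bdot_2 algebra_simps)
  then show ?thesis
    using \<tau>'_bdot[of "c *v z" "c *v w"] by (simp add: N_def P_def bdot_simps)
qed

lemma N_add: "N (z + w) (z + w) = N z z + 2 * N w z + N w w"
  using N_sym[of z w] by (simp add: N_def P_add matrix_vector_right_distrib bdot_simps)

definition F where "F z = exp (- of_real pi * \<i> * N z z) * riemann_theta \<tau>' (P z)"

text \<open>P maps m to the lattice vector A m - tau' C m. The quadratic factor cancels the
  quasi-period of theta except for the phase exp(-pi i (Cm).(Am)), which the evenness makes
  1.\<close>

lemma F_periodic:
  assumes "\<And>n. even (\<Sum>i\<in>UNIV. (C *v n) $ i * (A *v n) $ i)"
  shows "F (z + cvec m) = F z"
proof -
  have P: "P (z + cvec m) = (P z + \<tau>' *v cvec (- (C *v m))) + cvec (A *v m)"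
    by (simp add: P_add) (simp add: P_def cmat_mult_cvec cvec_minus matrix_vector_mult_minus)
  have Nm: "N (cvec m) (cvec m) = bdot (cvec (C *v m)) (cvec (A *v m)) - bdot (cvec (C *v m)) (\<tau>' *v cvec (C *v m))"
    by (simp add: N_def P_def cmat_mult_cvec bdot_simps)
  have Nz: "N (cvec m) z = bdot (cvec (C *v m)) (P z)" by (simp add: N_def cmat_mult_cvec)
  obtain k where k: "(\<Sum>i\<in>UNIV. (C *v m) $ i * (A *v m) $ i) = 2 * k" using assms by blast
  have e: "bdot (cvec (C *v m)) (cvec (A *v m)) = 2 * of_int k"
    using arg_cong[OF k, of "of_int :: int \<Rightarrow> complex"] by (simp add: bdot_2 sum_2)
  have "F (z + cvec m) = exp (- of_real pi * \<i> * N z z) * riemann_theta \<tau>' (P z) * exp (2 * of_real pi * \<i> * of_int (- k))"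
    unfolding F_def P riemann_theta_periodic riemann_theta_quasi_periodic[OF \<tau>'_in] N_add Nm Nz e
    by (simp add: cvec_minus matrix_vector_mult_minus bdot_simps algebra_simps flip: exp_add)
  then show ?thesis unfolding exp_2pi_int F_def by simp
qed

text \<open>P maps tau n to the lattice vector tau' D n - B n. Evaluating N at tau n by means of
  \<open>form\<close> leaves, besides the desired factor, the phase exp(-pi i (Dn).(Bn)).\<close>

lemma F_quasi_periodic:
  assumes "\<And>n. even (\<Sum>i\<in>UNIV. (D *v n) $ i * (B *v n) $ i)"
  shows "F (z + \<tau> *v cvec n) = exp (- of_real pi * \<i> * (bdot (cvec n) (\<tau> *v cvec n) + 2 * bdot (cvec n) z)) * F z"
proof -
  let ?t = "\<tau> *v cvec n" and ?D = "cvec (D *v n)" and ?B = "cvec (B *v n)"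
  have P: "P (z + ?t) = (P z + \<tau>' *v ?D) + cvec (- (B *v n))"
    by (simp add: P_add P_\<tau> cmat_mult_cvec cvec_minus)
  have N1: "N ?t z = bdot (cvec n) z - bdot ?D (P z)"
    using P_K[of z "cvec n"] by (simp add: N_def K_mult bdot_simps cmat_mult_cvec bdot_commute eq_diff_eq)
  have N2: "N ?t ?t + bdot ?D (\<tau>' *v ?D) = bdot (cvec n) ?t + bdot ?D ?B"
  proof -
    have "N ?t ?t = bdot (c *v ?t) (\<tau>' *v ?D) - bdot (c *v ?t) ?B"
      by (simp add: N_def P_\<tau> cmat_mult_cvec bdot_simps)
    then have "N ?t ?t + bdot ?D (\<tau>' *v ?D) = bdot (K *v cvec n) (\<tau>' *v ?D) - bdot (c *v ?t) ?B"
      by (simp add: K_mult bdot_simps cmat_mult_cvec)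
    also have "bdot (K *v cvec n) (\<tau>' *v ?D) = bdot ?D (L *v cvec n)"
      using \<tau>'_bdot[of "K *v cvec n" ?D] by (simp add: \<tau>'_K)
    also have "\<dots> = bdot ?D (a *v ?t) + bdot ?D ?B" by (simp add: L_mult bdot_simps cmat_mult_cvec)
    finally have 1: "N ?t ?t + bdot ?D (\<tau>' *v ?D) = bdot ?D (a *v ?t) - bdot (c *v ?t) ?B + bdot ?D ?B" by simp
    have "bdot (c *v 0 + d *v cvec n) (a *v ?t + b *v 0) - bdot (a *v 0 + b *v cvec n) (c *v ?t + d *v 0) = bdot (cvec n) ?t - bdot 0 0"
      by (rule form)
    then have "bdot ?D (a *v ?t) - bdot (c *v ?t) ?B = bdot (cvec n) ?t"
      by (simp add: matrix_vector_mult_0_right cmat_mult_cvec bdot_commute[of "c *v ?t"]) (simp add: bdot_2)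
    then show ?thesis using 1 by simp
  qed
  obtain k where k: "(\<Sum>i\<in>UNIV. (D *v n) $ i * (B *v n) $ i) = 2 * k" using assms by blast
  have e: "bdot ?D ?B = 2 * of_int k"
    using arg_cong[OF k, of "of_int :: int \<Rightarrow> complex"] by (simp add: bdot_2 sum_2)
  have N3: "N ?t ?t = bdot (cvec n) ?t + 2 * of_int k - bdot ?D (\<tau>' *v ?D)"
    using N2 e by (simp add: algebra_simps)
  have "F (z + ?t) = exp (- of_real pi * \<i> * (bdot (cvec n) ?t + 2 * bdot (cvec n) z)) * F z * exp (2 * of_real pi * \<i> * of_int (- k))"
    unfolding F_def P riemann_theta_periodic riemann_theta_quasi_periodic[OF \<tau>'_in] N_add N1 N3
    by (simp add: algebra_simps flip: exp_add)
  then show ?thesis unfolding exp_2pi_int by simp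
qed

lemma F_line_holomorphic: "line_holomorphic F"
  unfolding line_holomorphic_def
proof (intro conjI allI)
  have cP: "continuous_on UNIV P"
    unfolding P_def[abs_def]
    by (rule continuous_on_vec_2) (auto simp: matrix_vector_mult_def sum_2 intro!: continuous_intros)
  have "continuous_on UNIV (\<lambda>z. N z z)"
    unfolding N_def bdot_2 by (intro continuous_intros cP)
  then show "continuous_on UNIV F"
    unfolding F_def[abs_def]
    by (intro continuous_intros continuous_on_compose2[OF continuous_riemann_theta[OF \<tau>'_in] cP]) auto
  fix z w
  have N: "N (z + t *s w) (z + t *s w) = N z z + 2 * (t * N w z) + t * t * N w w" for t
    unfolding N_add by (simp add: N_def P_scale matrix_vector_mult_scale bdot_simps)
  have P: "P (z + t *s w) = P z + t *s P w" for t by (simp add: P_add P_scale)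
  have "entire2 (riemann_theta \<tau>')" using entire2_riemann_theta[OF \<tau>'_in, of 1 0] by (simp add: vector_scalar_mult_def)
  then show "(\<lambda>t. F (z + t *s w)) holomorphic_on UNIV"
    unfolding F_def N P by (intro holomorphic_intros entire2_holomorphic)
qed

theorem theta_transformation:
  assumes "\<And>n. even (\<Sum>i\<in>UNIV. (C *v n) $ i * (A *v n) $ i)" "\<And>n. even (\<Sum>i\<in>UNIV. (D *v n) $ i * (B *v n) $ i)"
  obtains k where "k \<noteq> 0" "\<And>z. F z = k * riemann_theta \<tau> z"
proof -
  have "quasi_periodic \<tau> F"
    unfolding quasi_periodic_def using F_line_holomorphic F_periodic[OF assms(1)] F_quasi_periodic[OF assms(2)] by blast
  then obtain k where k: "\<And>z. F z = k * riemann_theta \<tau> z" using quasi_periodic_proportional \<tau> by blast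
  have "k \<noteq> 0"
  proof
    assume "k = 0"
    then have "riemann_theta \<tau>' (P z) = 0" for z using k[of z] by (simp add: F_def)
    then have "riemann_theta \<tau>' u = 0" for u using P_surj by metis
    then show False using riemann_theta_not_zero[OF \<tau>'_in] by blast
  qed
  then show thesis using that k by blast
qed

text \<open>P(y/2) = y/2 + tau' p + q with p = -4 C' y and q = 4 A' y integral. What remains of the
  factors is exp(pi i (p.q - p.y/2)); both p.q and p.y/2 are even because p is divisible by
  4.\<close>

lemma F_half:
  assumes A: "\<And>i j. A $ i $ j = (mat 1 :: int^2^2) $ i $ j + 8 * A' $ i $ j" and C: "\<And>i j. C $ i $ j = 8 * C' $ i $ j"
  shows "F ((1/2) *s cvec y) = riemann_theta \<tau>' ((1/2) *s cvec y)"
proof -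
  define p q where "p = - (4 *s (C' *v y))" and "q = 4 *s (A' *v y)"
  have Cy: "c *v cvec y = (-2) *s cvec p"
    by (simp add: cmat_mult_cvec vec_eq_iff p_def matrix_vector_mult_def sum_2 C algebra_simps)
  have Ay: "a *v cvec y = cvec y + 2 *s cvec q"
    by (simp add: cmat_mult_cvec vec_eq_iff forall_2 q_def matrix_vector_mult_def sum_2 A mat_def algebra_simps)
  have P: "P ((1/2) *s cvec y) = ((1/2) *s cvec y + \<tau>' *v cvec p) + cvec q"
    by (simp add: P_def matrix_vector_mult_scale Cy Ay) (simp add: vec_eq_iff matrix_vector_mult_minus)
  obtain i where i: "p $ 1 * y $ 1 + p $ 2 * y $ 2 + 2 * (p $ 1 * q $ 1 + p $ 2 * q $ 2) - 2 * (p $ 1 * y $ 1 + p $ 2 * y $ 2) = 4 * i"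
  proof
    show "p $ 1 * y $ 1 + p $ 2 * y $ 2 + 2 * (p $ 1 * q $ 1 + p $ 2 * q $ 2) - 2 * (p $ 1 * y $ 1 + p $ 2 * y $ 2)
       = 4 * ((C' *v y) $ 1 * y $ 1 + (C' *v y) $ 2 * y $ 2 - 2 * ((C' *v y) $ 1 * q $ 1 + (C' *v y) $ 2 * q $ 2))"
      by (simp add: p_def algebra_simps)
  qed
  have Ny: "N ((1/2) *s cvec y) ((1/2) *s cvec y) = - bdot (cvec p) ((1/2) *s cvec y) - bdot (cvec p) (\<tau>' *v cvec p) - bdot (cvec p) (cvec q)"
    unfolding N_def P by (simp add: matrix_vector_mult_scale Cy bdot_simps)
  have "F ((1/2) *s cvec y) = exp (of_real pi * \<i> * (bdot (cvec p) (cvec q) - bdot (cvec p) ((1/2) *s cvec y))) * riemann_theta \<tau>' ((1/2) *s cvec y)"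
    unfolding F_def P riemann_theta_periodic riemann_theta_quasi_periodic[OF \<tau>'_in] Ny
    by (simp add: algebra_simps flip: exp_add)
  also have "bdot (cvec p) (cvec q) - bdot (cvec p) ((1/2) *s cvec y) = 2 * of_int i"
  proof -
    define X where "X = bdot (cvec p) (cvec q) - bdot (cvec p) ((1/2) *s cvec y)"
    have "2 * X = of_int (4 * i)"
      unfolding X_def i[symmetric] by (simp add: bdot_2 algebra_simps)
    then have "X = 2 * of_int i" by simp
    then show ?thesis unfolding X_def .
  qed
  also have "exp (of_real pi * \<i> * (2 * of_int i)) = 1" using exp_2pi_int[of i] by (simp add: mult_ac)
  finally show ?thesis by simp
qed

end

section \<open>From Gamma(8) to the block relations, and conclusion\<close>

lemma sum_Plus_UNIV: "(\<Sum>x\<in>UNIV. f x) = (\<Sum>i\<in>UNIV. f (Inl i)) + (\<Sum>i\<in>UNIV. f (Inr i))"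
  for f :: "'a::finite + 'b::finite \<Rightarrow> int"
  unfolding UNIV_Plus_UNIV[symmetric] by (subst sum.Plus) auto

lemma symplectic_entry:
  "(transpose \<gamma> ** symplectic_J ** \<gamma>) $ p $ q =
    (\<Sum>i\<in>UNIV. \<gamma> $ Inl i $ p * \<gamma> $ Inr i $ q - \<gamma> $ Inr i $ p * \<gamma> $ Inl i $ q)"
proof -
  have "(transpose \<gamma> ** symplectic_J) $ p $ Inl i = - \<gamma> $ Inr i $ p" "(transpose \<gamma> ** symplectic_J) $ p $ Inr i = \<gamma> $ Inl i $ p" for i
    using exhaust_2[of i]
    by (auto simp: matrix_matrix_mult_def sum_Plus_UNIV transpose_def symplectic_J_def sum_2)
  then show ?thesis
    unfolding matrix_matrix_mult_def[of "_ ** _"] by (simp add: sum_Plus_UNIV sum_2 algebra_simps)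
qed

text \<open>All four theta nulls acquire the same k, since they are values of the single identity F
  = k theta at the points y/2.\<close>

lemma theta_nulls_congruence_8:
  assumes \<gamma>: "\<gamma> \<in> principal_congruence 8" and \<tau>: "\<tau> \<in> siegel_H2"
  obtains k where "k \<noteq> 0" "\<And>y. half_theta (siegel_act \<gamma> \<tau>) y 0 = k * half_theta \<tau> y 0"
proof -
  define A B C D :: "int^2^2" where "A = (\<chi> i j. \<gamma> $ Inl i $ Inl j)" and "B = (\<chi> i j. \<gamma> $ Inl i $ Inr j)"
    and "C = (\<chi> i j. \<gamma> $ Inr i $ Inl j)" and "D = (\<chi> i j. \<gamma> $ Inr i $ Inr j)"
  have J: "(\<Sum>i\<in>UNIV. \<gamma> $ Inl i $ p * \<gamma> $ Inr i $ q - \<gamma> $ Inr i $ p * \<gamma> $ Inl i $ q) = symplectic_J $ p $ q" for p q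
    using \<gamma> symplectic_entry[of \<gamma> p q] by (simp add: principal_congruence_def Sp4_Z_def)
  have cong: "[\<gamma> $ i $ j = (mat 1 :: int^(2+2)^(2+2)) $ i $ j] (mod 8)" for i j
    using \<gamma> by (simp add: principal_congruence_def)
  interpret symplectic_blocks A B C D \<tau>
  proof
    show "transpose A ** C = transpose C ** A"
      using J[of "Inl _" "Inl _"]
      by (simp add: vec_eq_iff matrix_matrix_mult_def transpose_def A_def C_def symplectic_J_def sum_subtractf)
    show "transpose B ** D = transpose D ** B"
      using J[of "Inr _" "Inr _"]
      by (simp add: vec_eq_iff matrix_matrix_mult_def transpose_def B_def D_def symplectic_J_def sum_subtractf)
    show "transpose A ** D - transpose C ** B = mat 1"
      using J[of "Inl _" "Inr _"]
      by (simp add: vec_eq_iff matrix_matrix_mult_def transpose_def A_def B_def C_def D_def symplectic_J_def sum_subtractf mat_def)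
  qed (rule \<tau>)
  have "cmat A = (\<chi> i j. of_int (\<gamma> $ Inl i $ Inl j))" "cmat B = (\<chi> i j. of_int (\<gamma> $ Inl i $ Inr j))"
    "cmat C = (\<chi> i j. of_int (\<gamma> $ Inr i $ Inl j))" "cmat D = (\<chi> i j. of_int (\<gamma> $ Inr i $ Inr j))"
    by (simp_all add: cmat_def A_def B_def C_def D_def)
  then have act: "siegel_act \<gamma> \<tau> = \<tau>'"
    unfolding siegel_act_def Let_def \<tau>'_def K_def L_def by simp
  have d8: "8 dvd \<gamma> $ i $ j - (mat 1 :: int^(2+2)^(2+2)) $ i $ j" for i j
    using cong[of i j] by (simp add: cong_iff_dvd_diff)
  have "\<exists>A'. \<forall>i j. A $ i $ j = (mat 1 :: int^2^2) $ i $ j + 8 * A' $ i $ j"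
  proof (intro exI allI)
    fix i j
    show "A $ i $ j = (mat 1 :: int^2^2) $ i $ j + 8 * (\<chi> i j. (A $ i $ j - (mat 1 :: int^2^2) $ i $ j) div 8) $ i $ j"
      using d8[of "Inl i" "Inl j"] by (simp add: A_def mat_def)
  qed
  then obtain A' where A': "\<And>i j. A $ i $ j = (mat 1 :: int^2^2) $ i $ j + 8 * A' $ i $ j" by blast
  have "\<exists>C'. \<forall>i j. C $ i $ j = 8 * C' $ i $ j"
  proof (intro exI allI)
    fix i j
    show "C $ i $ j = 8 * (\<chi> i j. C $ i $ j div 8) $ i $ j"
      using d8[of "Inr i" "Inl j"] by (simp add: C_def mat_def)
  qed
  then obtain C' where C': "\<And>i j. C $ i $ j = 8 * C' $ i $ j" by blast
  have evC: "even ((C *v n) $ i)" for n i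
    unfolding matrix_vector_mult_def using C' by (auto intro!: dvd_sum)
  have evB: "even ((B *v n) $ i)" for n i
  proof -
    have "8 dvd B $ i $ j" for j using d8[of "Inl i" "Inr j"] by (simp add: B_def mat_def)
    then have "even (B $ i $ j)" for j by (metis dvd_trans even_numeral)
    then show ?thesis unfolding matrix_vector_mult_def by (auto intro!: dvd_sum)
  qed
  obtain k where k: "k \<noteq> 0" "\<And>z. F z = k * riemann_theta \<tau> z"
    using theta_transformation evC evB by (metis (no_types, lifting) dvd_mult2 dvd_mult dvd_sum)
  have "half_theta (siegel_act \<gamma> \<tau>) y 0 = k * half_theta \<tau> y 0" for y
    using F_half[OF A' C', of "iv y"] k(2)[of "(1/2) *s cvec (iv y)"] by (simp add: half_theta_def act)
  then show thesis by (rule that[OF k(1)])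
qed

theorem theorem4p2:
  shows "(\<forall>\<tau>\<in>siegel_H2. \<forall>\<tau>'\<in>siegel_H2.
            igusa_defined \<tau> \<longrightarrow> igusa_defined \<tau>' \<longrightarrow>
            (theta_f1 \<tau>, theta_f2 \<tau>, theta_f3 \<tau>, theta_f4 \<tau>) =
              (theta_f1 \<tau>', theta_f2 \<tau>', theta_f3 \<tau>', theta_f4 \<tau>') \<longrightarrow>
            (igusa_j1 \<tau>, igusa_j2 \<tau>, igusa_j3 \<tau>) = (igusa_j1 \<tau>', igusa_j2 \<tau>', igusa_j3 \<tau>'))
       \<and> (\<forall>\<gamma>\<in>principal_congruence 8. \<forall>\<tau>\<in>siegel_H2.
            theta_f1 (siegel_act \<gamma> \<tau>) / theta_f4 (siegel_act \<gamma> \<tau>) = theta_f1 \<tau> / theta_f4 \<tau> \<and>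
            theta_f2 (siegel_act \<gamma> \<tau>) / theta_f4 (siegel_act \<gamma> \<tau>) = theta_f2 \<tau> / theta_f4 \<tau> \<and>
            theta_f3 (siegel_act \<gamma> \<tau>) / theta_f4 (siegel_act \<gamma> \<tau>) = theta_f3 \<tau> / theta_f4 \<tau>)"
proof (intro conjI ballI impI)
  fix \<tau> \<tau>'
  assume H: "\<tau> \<in> siegel_H2" "\<tau>' \<in> siegel_H2"
    and eq: "(theta_f1 \<tau>, theta_f2 \<tau>, theta_f3 \<tau>, theta_f4 \<tau>) = (theta_f1 \<tau>', theta_f2 \<tau>', theta_f3 \<tau>', theta_f4 \<tau>')"
  have "value_at F \<tau> = value_at F \<tau>'" for F
    by (rule theta_nulls_determine_values[OF H]) (use eq in simp_all)
  then show "(igusa_j1 \<tau>, igusa_j2 \<tau>, igusa_j3 \<tau>) = (igusa_j1 \<tau>', igusa_j2 \<tau>', igusa_j3 \<tau>')"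
    by (simp add: igusa_j1_def igusa_j2_def igusa_j3_def)
next
  fix \<gamma> \<tau>
  assume "\<gamma> \<in> principal_congruence 8" "\<tau> \<in> siegel_H2"
  then obtain k where k: "k \<noteq> 0" "\<And>y. half_theta (siegel_act \<gamma> \<tau>) y 0 = k * half_theta \<tau> y 0"
    using theta_nulls_congruence_8 by blast
  note f = k(2)[of "(False, False)"] k(2)[of "(True, True)"] k(2)[of "(True, False)"] k(2)[of "(False, True)"]
  \<comment> \<open>The factor k cancels. If \<open>theta_f4\<close> vanishes at tau, it also
    vanishes at the image of tau, and both quotients are 0 by the convention x / 0 = 0.\<close>
  show "theta_f1 (siegel_act \<gamma> \<tau>) / theta_f4 (siegel_act \<gamma> \<tau>) = theta_f1 \<tau> / theta_f4 \<tau>"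
    "theta_f2 (siegel_act \<gamma> \<tau>) / theta_f4 (siegel_act \<gamma> \<tau>) = theta_f2 \<tau> / theta_f4 \<tau>"
    "theta_f3 (siegel_act \<gamma> \<tau>) / theta_f4 (siegel_act \<gamma> \<tau>) = theta_f3 \<tau> / theta_f4 \<tau>"
    using f k(1) unfolding half_theta_0 by simp_all
qed

end
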